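(* Let $X$ be a polynomial process on a closed state space $S\subset\mathbb{R}^d$ with transition operators $(P_{s,t})_{(s,t)\in\Delta}$ and infinitesimal generator $(\mathscr{H}_s)_{0\le s<T}$. Fix $k\in\mathbb{N}_0$ and a basis of $\mathscr{P}_k(S)$, and denote by $\mathbf{P}_{s,t}$ and $\mathbf{H}_s$ the representing matrices of $P_{s,t}$ and $\mathscr{H}_s$ (as operators on $\mathscr{P}_k(S)$) with respect to this basis. If $$\int_s^T\|\mathbf{H}_u\|_2\,du<\pi,$$ then for $0\le s\le t\le T$ we have $\mathbf{P}_{s,t}=e^{\mathbf{\Omega}(s,t)}$, where $\mathbf{\Omega}(s,t)$ is expressible as an absolutely convergent series $$\mathbf{\Omega}(s,t)=\sum_{k=1}^\infty\mathbf{\Omega}_k(s,t)$$ whose coefficients depend on $s,t$ and $(\mathbf{H}_u)_{s\le u\le t}$. The first three terms of this series are given by $$\mathbf{\Omega}_1(s,t)=\int_s^t\mathbf{H}_u\,du,$$ $$\mathbf{\Omega}_2(s,t)=-\frac12\int_s^tdu\int_s^udv\,[\mathbf{H}_u,\mathbf{H}_v],$$ $$\mathbf{\Omega}_3(s,t)=\frac16\int_s^tdu\int_s^udv\int_s^vdw\,\big([\mathbf{H}_u,[\mathbf{H}_v,\mathbf{H}_w]]+[\mathbf{H}_w,[\mathbf{H}_v,\mathbf{H}_u]]\big).$$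
   Context: Fix $T>0$ and let $\Delta=\{(s,t):0\le s\le t\le T\}$. $S$ carries its Borel $\sigma$-algebra $\mathcal{S}$. Transition operators $(P_{s,t})_{(s,t)\in\Delta}$ are given by $P_{s,t}f(x)=\int_S f(\xi)\,p_{s,t}(x,d\xi)$, where $p$ is a transition probability function: $p_{s,t}(x,A)$ is jointly measurable in $(s,t,x)$ for each $A\in\mathcal{S}$; $p_{s,t}(x,\cdot)$ is a probability measure on $\mathcal{S}$; $p_{t,t}(x,\cdot)=\delta_x$; and $p_{s,u}(x,A)=\int_S p_{s,t}(x,dy)\,p_{t,u}(y,A)$ for $0\le s\le t\le u\le T$. For a multi-index $\mathbf{k}\in\mathbb{N}_0^d$ write $|\mathbf{k}|=k_1+\dots+k_d$ and $x^{\mathbf{k}}=x_1^{k_1}\cdots x_d^{k_d}$. $\mathscr{P}_k(S)$ is the finite-dimensional space of functions $S\ni x\mapsto\sum_{|\mathbf{l}|=0}^k\alpha_{\mathbf{l}}x^{\mathbf{l}}$ with $\alpha_{\mathbf{l}}\in\mathbb{R}$. $\tilde{\mathscr{P}}_k(S)$ is the space of functions $\Delta\times S\ni(s,t,x)\mapsto\sum_{|\mathbf{l}|=0}^k\alpha_{\mathbf{l}}(s,t)x^{\mathbf{l}}$ with $\alpha_{\mathbf{l}}\in C^1(\Delta,\mathbb{R})$, the once continuously differentiable functions $\Delta\to\mathbb{R}$. The transition operators are $m$-polynomial if for all $k\in\{0,\dots,m\}$ and $f\in\mathscr{P}_k(S)$ the map $(s,t,x)\mapsto P_{s,t}f(x)$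 is in $\tilde{\mathscr{P}}_k(S)$ (in particular all moments involved are finite), and polynomial if $m$-polynomial for all $m\ge0$. A polynomial process is a càdlàg $S$-valued Markov process with polynomial transition operators. The infinitesimal generator is $(\mathscr{H}_sf)(x)=\lim_{h\downarrow0}\frac1h(P_{s,s+h}f-f)(x)$, $x\in S$, defined for measurable $f$ for which the limit exists for all $x$; for a polynomial process, $P_{s,t}$ and $\mathscr{H}_s$ map $\mathscr{P}_k(S)$ into itself. The representing matrix of a linear operator $L$ with respect to a basis $(v_1,\dots,v_N)$ is $(l_{ij})$ with $Lv_j=\sum_{i=1}^Nl_{ij}v_i$. $\|\mathbf{A}\|_2=\max_{|x|=1}|\mathbf{A}x|$ is the spectral norm and $[\mathbf{A},\mathbf{B}]=\mathbf{A}\mathbf{B}-\mathbf{B}\mathbf{A}$ the commutator. The series for $\mathbf{\Omega}$ is the Magnus series: its $k$-th term is obtained from the $k$-th term $\tilde{\mathbf{\Omega}}_k$ of the Magnus expansion $\mathbf{U}(r)=\exp\big(\sum_k\tilde{\mathbf{\Omega}}_k(r)\big)$ of the solution of $\frac{d}{dr}\mathbf{U}(r)=\mathbf{H}_{s+r}^\top\mathbf{U}(r)$, $\mathbf{U}(0)=\mathbf{I}$, by $\mathbf{\Omega}_k(s,t)=\tilde{\mathbf{\Omega}}_k(t-s)^\top$. *)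

theory Defs
  imports "HOL-Analysis.Analysis" "HOL-Probability.Probability"
begin

section \<open>Polynomial processes\<close>

definition time_triangle :: "real \<Rightarrow> (real \<times> real) set" where
  "time_triangle T = {(s, t). 0 \<le> s \<and> s \<le> t \<and> t \<le> T}"

text \<open>Only the values \<open>p s t x\<close> with \<open>(s, t)\<close> in the triangle and \<open>x \<in> S\<close> are constrained.\<close>

locale transition_function =
  fixes T :: real and S :: "(real ^ 'd) set"
    and p :: "real \<Rightarrow> real \<Rightarrow> real ^ 'd \<Rightarrow> (real ^ 'd) measure"
  assumes T_pos: "0 < T"
    and prob_space_p: "\<And>s t x. (s, t) \<in> time_triangle T \<Longrightarrow> x \<in> S \<Longrightarrow> prob_space (p s t x)"
    and sets_p: "\<And>s t x. (s, t) \<in> time_triangle T \<Longrightarrow> x \<in> S \<Longrightarrow>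
      sets (p s t x) = sets (restrict_space borel S)"
    and measurable_p: "\<And>A. A \<in> sets (restrict_space borel S) \<Longrightarrow>
      (\<lambda>(s, t, x). measure (p s t x) A) \<in> borel_measurable
        (restrict_space borel {(s, t, x). (s, t) \<in> time_triangle T \<and> x \<in> S})"
    and p_refl: "\<And>t x. 0 \<le> t \<Longrightarrow> t \<le> T \<Longrightarrow> x \<in> S \<Longrightarrow>
      p t t x = return (restrict_space borel S) x"
    and Chapman_Kolmogorov: "\<And>s t u x A. 0 \<le> s \<Longrightarrow> s \<le> t \<Longrightarrow> t \<le> u \<Longrightarrow> u \<le> T \<Longrightarrow> x \<in> S \<Longrightarrow>
      A \<in> sets (restrict_space borel S) \<Longrightarrow>
      measure (p s u x) A = (\<integral>y. measure (p t u y) A \<partial>(p s t x))"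

definition transition_op ::
  "(real \<Rightarrow> real \<Rightarrow> real ^ 'd \<Rightarrow> (real ^ 'd) measure) \<Rightarrow> real \<Rightarrow> real \<Rightarrow> (real ^ 'd \<Rightarrow> real) \<Rightarrow> real ^ 'd \<Rightarrow> real"
  where "transition_op p s t f x = (\<integral>\<xi>. f \<xi> \<partial>(p s t x))"

text \<open>Multi-indices are functions \<open>'d \<Rightarrow> nat\<close>.\<close>

definition mindices :: "nat \<Rightarrow> ('d::finite \<Rightarrow> nat) set" where
  "mindices k = {l. (\<Sum>i\<in>UNIV. l i) \<le> k}"

definition monomial :: "('d::finite \<Rightarrow> nat) \<Rightarrow> real ^ 'd \<Rightarrow> real" where
  "monomial l x = (\<Prod>i\<in>UNIV. (x $ i) ^ l i)"

text \<open>Functions on \<open>S\<close> are represented by total functions of which only the values on \<open>S\<close>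
  matter; all notions below identify functions that agree on \<open>S\<close>.\<close>

definition polys_on :: "(real ^ 'd) set \<Rightarrow> nat \<Rightarrow> (real ^ 'd \<Rightarrow> real) set" where
  "polys_on S k = {f. \<exists>\<alpha>. \<forall>x\<in>S. f x = (\<Sum>l\<in>mindices k. \<alpha> l * monomial l x)}"

text \<open>On the boundary of a (convex, solid) set \<open>D\<close> the derivative is taken within \<open>D\<close>.\<close>

definition C1_on :: "(real \<times> real) set \<Rightarrow> (real \<times> real \<Rightarrow> real) \<Rightarrow> bool" where
  "C1_on D \<alpha> \<longleftrightarrow> (\<exists>a b. continuous_on D a \<and> continuous_on D b \<and>
     (\<forall>z\<in>D. (\<alpha> has_derivative (\<lambda>(h, k). a z * h + b z * k)) (at z within D)))"

definition time_polys_on :: "real \<Rightarrow> (real ^ 'd) set \<Rightarrow> nat \<Rightarrow> (real \<times> real \<times> (real ^ 'd) \<Rightarrow> real) set" where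
  "time_polys_on T S k = {g. \<exists>\<alpha>. (\<forall>l\<in>mindices k. C1_on (time_triangle T) (\<alpha> l)) \<and>
     (\<forall>(s, t)\<in>time_triangle T. \<forall>x\<in>S. g (s, t, x) = (\<Sum>l\<in>mindices k. \<alpha> l (s, t) * monomial l x))}"

text \<open>Integrability is required explicitly because the integral of a non-integrable function is 0.\<close>

definition m_polynomial ::
  "real \<Rightarrow> (real ^ 'd) set \<Rightarrow> (real \<Rightarrow> real \<Rightarrow> real ^ 'd \<Rightarrow> (real ^ 'd) measure) \<Rightarrow> nat \<Rightarrow> bool" where
  "m_polynomial T S p m \<longleftrightarrow> (\<forall>k\<le>m. \<forall>f\<in>polys_on S k.
     (\<forall>(s, t)\<in>time_triangle T. \<forall>x\<in>S. integrable (p s t x) f) \<and>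
     (\<lambda>(s, t, x). transition_op p s t f x) \<in> time_polys_on T S k)"

locale polynomial_process = transition_function T S p + prob_space M
  for T :: real and S :: "(real ^ 'd) set" and p and M :: "'w measure" +
  fixes F :: "real \<Rightarrow> 'w measure" and X :: "real \<Rightarrow> 'w \<Rightarrow> real ^ 'd"
  assumes filtration_sub: "\<And>t. 0 \<le> t \<Longrightarrow> t \<le> T \<Longrightarrow> subalgebra M (F t)"
    and filtration_mono: "\<And>s t. (s, t) \<in> time_triangle T \<Longrightarrow> sets (F s) \<subseteq> sets (F t)"
    and adapted: "\<And>t. 0 \<le> t \<Longrightarrow> t \<le> T \<Longrightarrow> X t \<in> measurable (F t) (restrict_space borel S)"
    and right_continuous: "\<And>\<omega> t. \<omega> \<in> space M \<Longrightarrow> 0 \<le> t \<Longrightarrow> t < T \<Longrightarrow>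
      ((\<lambda>u. X u \<omega>) \<longlongrightarrow> X t \<omega>) (at_right t)"
    and left_limits: "\<And>\<omega> t. \<omega> \<in> space M \<Longrightarrow> 0 < t \<Longrightarrow> t \<le> T \<Longrightarrow>
      \<exists>l. ((\<lambda>u. X u \<omega>) \<longlongrightarrow> l) (at_left t)"
    and Markov: "\<And>s t A. (s, t) \<in> time_triangle T \<Longrightarrow> A \<in> sets (restrict_space borel S) \<Longrightarrow>
      AE \<omega> in M. real_cond_exp M (F s) (\<lambda>\<omega>. indicator A (X t \<omega>)) \<omega> = measure (p s t (X s \<omega>)) A"
    and polynomial: "\<And>m. m_polynomial T S p m"

definition generator_domain ::
  "(real ^ 'd) set \<Rightarrow> (real \<Rightarrow> real \<Rightarrow> real ^ 'd \<Rightarrow> (real ^ 'd) measure) \<Rightarrow> real \<Rightarrow> (real ^ 'd \<Rightarrow> real) set"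
  where "generator_domain S p s = {f. f \<in> borel_measurable (restrict_space borel S) \<and>
     (\<forall>x\<in>S. (\<forall>\<^sub>F h in at_right 0. integrable (p s (s + h) x) f) \<and>
       (\<exists>l. ((\<lambda>h. (transition_op p s (s + h) f x - f x) / h) \<longlongrightarrow> l) (at_right 0)))}"

definition generator ::
  "(real ^ 'd) set \<Rightarrow> (real \<Rightarrow> real \<Rightarrow> real ^ 'd \<Rightarrow> (real ^ 'd) measure) \<Rightarrow> real \<Rightarrow>
    (real ^ 'd \<Rightarrow> real) \<Rightarrow> real ^ 'd \<Rightarrow> real"
  where "generator S p s f x =
    (if f \<in> generator_domain S p s
     then Lim (at_right 0) (\<lambda>h. (transition_op p s (s + h) f x - f x) / h) else undefined)"

section \<open>Bases and representing matrices\<close>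

text \<open>A basis \<open>v\<close> is indexed by a finite type \<open>'n\<close>, so that \<open>CARD('n)\<close> is the dimension.\<close>

definition is_basis_on ::
  "(real ^ 'd) set \<Rightarrow> (real ^ 'd \<Rightarrow> real) set \<Rightarrow> ('n::finite \<Rightarrow> real ^ 'd \<Rightarrow> real) \<Rightarrow> bool" where
  "is_basis_on S V v \<longleftrightarrow>
     (\<forall>j. v j \<in> V) \<and>
     (\<forall>c. (\<forall>x\<in>S. (\<Sum>j\<in>UNIV. c j * v j x) = 0) \<longrightarrow> (\<forall>j. c j = 0)) \<and>
     (\<forall>f\<in>V. \<exists>c. \<forall>x\<in>S. f x = (\<Sum>j\<in>UNIV. c j * v j x))"

definition representing_matrix ::
  "(real ^ 'd) set \<Rightarrow> ('n::finite \<Rightarrow> real ^ 'd \<Rightarrow> real) \<Rightarrow>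
    ((real ^ 'd \<Rightarrow> real) \<Rightarrow> real ^ 'd \<Rightarrow> real) \<Rightarrow> real ^ 'n ^ 'n" where
  "representing_matrix S v L =
     (THE A. \<forall>j. \<forall>x\<in>S. L (v j) x = (\<Sum>i\<in>UNIV. A $ i $ j * v i x))"

section \<open>Matrix exponential and Magnus series\<close>

text \<open>Multiplication, and hence \<open>^\<close> and \<open>exp\<close>, on \<open>real ^ 'n ^ 'n\<close> would be componentwise.\<close>

definition mat_exp :: "real ^ 'n ^ 'n \<Rightarrow> real ^ 'n ^ 'n" where
  "mat_exp A = (\<Sum>n. (1 / fact n) *\<^sub>R (((**) A ^^ n) (mat 1)))"

definition commutator :: "real ^ 'n ^ 'n \<Rightarrow> real ^ 'n ^ 'n \<Rightarrow> real ^ 'n ^ 'n" where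
  "commutator A B = A ** B - B ** A"

definition spectral_norm :: "real ^ 'n ^ 'n \<Rightarrow> real" where
  "spectral_norm A = onorm ((*v) A)"

text \<open>Bernoulli numbers with the convention \<open>B\<^sub>1 = -1/2\<close>.\<close>

fun bernoulli :: "nat \<Rightarrow> real" where
  "bernoulli 0 = 1"
| "bernoulli (Suc n) = - (\<Sum>k\<le>n. real ((n + 2) choose k) * bernoulli k) / real (n + 2)"

text \<open>
  The terms of the Magnus expansion \<open>U(r) = exp (\<Sum>n. \<Omega>\<^sub>n(r))\<close> of the solution of \<open>U' = A U\<close>,
  \<open>U(0) = I\<close>. They are obtained by inserting \<open>\<Omega> = \<Sum>n. \<Omega>\<^sub>n\<close>, with \<open>\<Omega>\<^sub>n\<close> of order \<open>n\<close> in \<open>A\<close>, into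
  Magnus' equation \<open>\<Omega>' = (\<Sum>j. B\<^sub>j / j! ad\<^sub>\<Omega>\<^sup>j A)\<close>, \<open>\<Omega>(0) = 0\<close>, and collecting the terms of order \<open>n\<close>:
  \<open>magnus_ad A j n\<close> is the part of \<open>ad\<^sub>\<Omega>\<^sup>j A\<close> of order \<open>n\<close> in \<open>A\<close> (zero for \<open>j \<ge> n\<close>). For \<open>j \<ge> 1\<close>
  this is the usual recursion with \<open>S\<^sub>n\<^sup>1 = [\<Omega>\<^sub>n\<^sub>-\<^sub>1, A]\<close> and \<open>S\<^sub>n\<^sup>j = (\<Sum>m = 1..n-j. [\<Omega>\<^sub>m, S\<^sub>n\<^sub>-\<^sub>m\<^sup>j\<^sup>-\<^sup>1])\<close>.
\<close>

function magnus_ad :: "(real \<Rightarrow> real ^ 'n ^ 'n) \<Rightarrow> nat \<Rightarrow> nat \<Rightarrow> real \<Rightarrow> real ^ 'n ^ 'n"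
  and magnus_term :: "(real \<Rightarrow> real ^ 'n ^ 'n) \<Rightarrow> nat \<Rightarrow> real \<Rightarrow> real ^ 'n ^ 'n" where
  "magnus_ad A 0 n r = (if n = 1 then A r else 0)"
| "magnus_ad A (Suc j) n r =
     (\<Sum>m\<in>{1..<n}. commutator (magnus_term A m r) (magnus_ad A j (n - m) r))"
| "magnus_term A n r =
     (\<Sum>j<n. (bernoulli j / fact j) *\<^sub>R integral {0..r} (magnus_ad A j n))"
  by pat_completeness auto
termination
  by (relation "inv_image (less_than <*lex*> less_than)
      (case_sum (\<lambda>(A, j, n, r). (n, j)) (\<lambda>(A, n, r). (n, n)))") auto

text \<open>The representing matrices \<open>P\<^sub>s\<^sub>,\<^sub>t\<close> satisfy \<open>d/dt P\<^sub>s\<^sub>,\<^sub>t = P\<^sub>s\<^sub>,\<^sub>t H\<^sub>t\<close>, with the generator on the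
  right; transposition turns this into \<open>U' = A U\<close>.\<close>

definition magnus_coeff ::
  "(real \<Rightarrow> real ^ 'n ^ 'n) \<Rightarrow> real \<Rightarrow> real \<Rightarrow> nat \<Rightarrow> real ^ 'n ^ 'n" where
  "magnus_coeff H s t n = transpose (magnus_term (\<lambda>r. transpose (H (s + r))) n (t - s))"

end

theory Submission
  imports Defs "HOL-Complex_Analysis.Complex_Analysis"
begin

text \<open>
  The proof follows Casas. Replace \<open>A\<close> by \<open>z A\<close> with complex \<open>z\<close> and let \<open>Y(z)\<close> be the solution at
  the final time. The angle between a solution \<open>y\<close> of \<open>y' = z A y\<close> and its initial value is at most
  \<open>\<bar>z\<bar> \<integral> \<parallel>A\<parallel>\<close>, so for \<open>\<bar>z\<bar> \<integral> \<parallel>A\<parallel> < pi\<close> no vector is mapped by \<open>Y(z)\<close> to a negative multiple of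
  itself. Hence \<open>Y(z)\<close> has no spectrum on the negative real axis, and its principal logarithm
  \<open>\<integral>\<^sub>0\<^sup>1 (Y - 1) / (1 + \<tau> (Y - 1)) d\<tau>\<close> is holomorphic on a disc that contains \<open>z = 1\<close> in its interior. As a
  formal power series in \<open>z\<close>, the Magnus series satisfies a differential equation by which its
  formal exponential is the Dyson series of \<open>Y\<close>. A formal logarithm is unique, so the Magnus series
  is the Taylor series of the holomorphic one and converges absolutely at \<open>z = 1\<close>.
\<close>

text \<open>The strict bound by pi leaves room for some radius above 1 whose product with the norm
  integral is still below pi; a disc reaching beyond z = 1 is what turns holomorphy into absolute
  convergence at z = 1. Values of A at different times do not commute, so differentiating a formal
  exponential produces all iterated commutators \<open>ad\<close>. The Bernoulli numbers in Magnus'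
  equation are the coefficients that invert this operator. Since every series involved has no
  constant term, each degree sees only finitely many powers, and the formal argument runs with
  truncated sums compared degree by degree. The angle estimate is Euclidean and therefore calls for
  the spectral norm, which must survive both the passage to complex matrices and transposition. Two
  features of the process shape the end. The generator stands on the right in d/dt P = P H, whence
  the transposed equation. It is a right derivative and so gives no information at time T:
  \<open>H T\<close> is arbitrary. The continuously differentiable coefficients supply a continuous
  \<open>G\<close> on the closed interval that agrees with \<open>H\<close> before T, and a single
  time does not affect any integral.\<close>

no_notation fps_nth (infixl \<open>$\<close> 75)

section \<open>The algebra of complex matrices\<close>

text \<open>On \<open>complex ^ 'n ^ 'n\<close> the class product would be componentwise. A separate
  type carries the matrix product and the operator norm as a Banach algebra, so that
  \<open>exp\<close> and power series over matrices have their intended meaning. The entries are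
  complex because the equation is deformed by a complex parameter.\<close>

typedef (overloaded) ('n::finite) cmat = "UNIV :: (complex ^ 'n ^ 'n) set"
  morphisms mat_of Cmat ..

setup_lifting type_definition_cmat

lemma linear_matrix_vector_mult_complex: "linear (\<lambda>x. (A :: complex ^ 'n ^ 'm) *v x)"
  by (rule linearI) (simp_all add: matrix_vector_right_distrib vec_eq_iff matrix_vector_mult_def
      scaleR_sum_right sum.distrib distrib_left)

lemma bounded_linear_matrix_vector_mult_complex:
  "bounded_linear (\<lambda>x. (A :: complex ^ 'n ^ 'm) *v x)"
  using linear_matrix_vector_mult_complex linear_conv_bounded_linear by blast

lemma norm_matrix_vector_mult_complex:
  "norm ((A :: complex ^ 'n ^ 'm) *v x) \<le> onorm ((*v) A) * norm x"
  by (rule onorm[OF bounded_linear_matrix_vector_mult_complex])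

lemma norm_entry_le_onorm: "norm ((A :: complex ^ 'n ^ 'm) $ i $ j) \<le> onorm ((*v) A)"
proof -
  have "norm (A $ i $ j) = norm ((A *v axis j 1) $ i)"
    by (simp add: matrix_vector_mult_def axis_def if_distrib cong: if_cong)
  also have "\<dots> \<le> norm (A *v axis j 1)"
    by (rule Finite_Cartesian_Product.norm_nth_le)
  also have "\<dots> \<le> onorm ((*v) A)"
    using norm_matrix_vector_mult_complex[of A "axis j 1"] by simp
  finally show ?thesis .
qed

lemma onorm_le_sum_entries:
  "onorm ((*v) (A :: complex ^ 'n ^ 'm)) \<le> (\<Sum>i\<in>UNIV. \<Sum>j\<in>UNIV. norm (A $ i $ j))"
proof (rule onorm_le)
  fix x
  have "norm (A *v x) \<le> (\<Sum>i\<in>UNIV. norm ((A *v x) $ i))"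
    by (simp add: norm_vec_def L2_set_le_sum)
  also have "\<dots> \<le> (\<Sum>i\<in>UNIV. \<Sum>j\<in>UNIV. norm (A $ i $ j) * norm x)"
  proof (rule sum_mono)
    fix i
    have "norm ((A *v x) $ i) \<le> (\<Sum>j\<in>UNIV. norm (A $ i $ j * x $ j))"
      by (simp add: matrix_vector_mult_def norm_sum)
    also have "\<dots> \<le> (\<Sum>j\<in>UNIV. norm (A $ i $ j) * norm x)"
      by (intro sum_mono) (simp add: norm_mult mult_left_mono Finite_Cartesian_Product.norm_nth_le)
    finally show "norm ((A *v x) $ i) \<le> (\<Sum>j\<in>UNIV. norm (A $ i $ j) * norm x)" .
  qed
  finally show "norm (A *v x) \<le> (\<Sum>i\<in>UNIV. \<Sum>j\<in>UNIV. norm (A $ i $ j)) * norm x"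
    by (simp add: sum_distrib_right)
qed

instantiation cmat :: (finite) ring_1
begin

lift_definition zero_cmat :: "'a cmat" is 0 .
lift_definition one_cmat :: "'a cmat" is "mat 1" .
lift_definition plus_cmat :: "'a cmat \<Rightarrow> 'a cmat \<Rightarrow> 'a cmat" is "(+)" .
lift_definition minus_cmat :: "'a cmat \<Rightarrow> 'a cmat \<Rightarrow> 'a cmat" is "(-)" .
lift_definition uminus_cmat :: "'a cmat \<Rightarrow> 'a cmat" is uminus .
lift_definition times_cmat :: "'a cmat \<Rightarrow> 'a cmat \<Rightarrow> 'a cmat" is "(**)" .

instance
proof
  fix A B C :: "'a cmat"
  show "(A * B) * C = A * (B * C)"
    by transfer (simp add: matrix_mul_assoc)
  show "1 * A = A" "A * 1 = A"
    by (transfer; simp)+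
  show "(A + B) * C = A * C + B * C"
    by transfer (simp add: vec_eq_iff matrix_matrix_mult_def sum.distrib distrib_right)
  show "A * (B + C) = A * B + A * C"
    by transfer (rule matrix_add_ldistrib)
  show "(0 :: 'a cmat) \<noteq> 1"
    by transfer (auto simp: vec_eq_iff mat_def)
qed (transfer; simp)+

end

instantiation cmat :: (finite) real_normed_algebra_1
begin

lift_definition scaleR_cmat :: "real \<Rightarrow> 'a cmat \<Rightarrow> 'a cmat" is "(*\<^sub>R)" .
lift_definition norm_cmat :: "'a cmat \<Rightarrow> real" is "\<lambda>A. onorm ((*v) A)" .
definition dist_cmat :: "'a cmat \<Rightarrow> 'a cmat \<Rightarrow> real" where "dist_cmat A B = norm (A - B)"
definition uniformity_cmat :: "('a cmat \<times> 'a cmat) filter"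
  where "uniformity_cmat = (INF e\<in>{0<..}. principal {(x, y). dist x y < e})"
definition open_cmat :: "'a cmat set \<Rightarrow> bool"
  where "open_cmat U \<longleftrightarrow> (\<forall>x\<in>U. eventually (\<lambda>(x', y). x' = x \<longrightarrow> y \<in> U) uniformity)"
definition sgn_cmat :: "'a cmat \<Rightarrow> 'a cmat" where "sgn_cmat A = inverse (norm A) *\<^sub>R A"

instance
proof
  fix A B :: "'a cmat" and r :: real
  show "norm A = 0 \<longleftrightarrow> A = 0"
  proof transfer
    fix A :: "complex ^ 'a ^ 'a"
    have "A = 0" if "\<And>x. A *v x = 0"
    proof -
      have "A $ i $ j = 0" for i j
        using arg_cong[OF that[of "axis j 1"], of "\<lambda>v. v $ i"]
        by (simp add: matrix_vector_mult_def axis_def if_distrib cong: if_cong)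
      then show ?thesis by (simp add: vec_eq_iff)
    qed
    then show "onorm ((*v) A) = 0 \<longleftrightarrow> A = 0"
      by (auto simp: onorm_eq_0[OF bounded_linear_matrix_vector_mult_complex])
  qed
  show "norm (A + B) \<le> norm A + norm B"
  proof transfer
    fix A B :: "complex ^ 'a ^ 'a"
    have "(*v) (A + B) = (\<lambda>x. A *v x + B *v x)"
      by (simp add: fun_eq_iff matrix_vector_mult_add_rdistrib)
    then show "onorm ((*v) (A + B)) \<le> onorm ((*v) A) + onorm ((*v) B)"
      by (simp add: onorm_triangle bounded_linear_matrix_vector_mult_complex)
  qed
  show "norm (r *\<^sub>R A) = \<bar>r\<bar> * norm A"
  proof transfer
    fix r and A :: "complex ^ 'a ^ 'a"
    have "(*v) (r *\<^sub>R A) = (\<lambda>x. r *\<^sub>R (A *v x))"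
      by (auto simp: fun_eq_iff vec_eq_iff matrix_vector_mult_def scaleR_sum_right sum.distrib distrib_left)
    then show "onorm ((*v) (r *\<^sub>R A)) = \<bar>r\<bar> * onorm ((*v) A)"
      by (simp add: onorm_scaleR bounded_linear_matrix_vector_mult_complex)
  qed
  show "norm (A * B) \<le> norm A * norm B"
  proof transfer
    fix A B :: "complex ^ 'a ^ 'a"
    have "(*v) (A ** B) = (*v) A \<circ> (*v) B"
      by (simp add: fun_eq_iff matrix_vector_mul_assoc)
    then show "onorm ((*v) (A ** B)) \<le> onorm ((*v) A) * onorm ((*v) B)"
      by (simp add: onorm_compose bounded_linear_matrix_vector_mult_complex)
  qed
  show "norm (1 :: 'a cmat) = 1"
  proof transfer
    have "(*v) (mat 1) = (\<lambda>x :: complex ^ 'a. x)"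
      by (simp add: fun_eq_iff)
    then show "onorm ((*v) (mat 1) :: complex ^ 'a \<Rightarrow> complex ^ 'a) = 1"
      by (simp add: onorm_id)
  qed
  show "r *\<^sub>R (A + B) = r *\<^sub>R A + r *\<^sub>R B"
    by transfer (rule scaleR_right_distrib)
  show "(r + r') *\<^sub>R A = r *\<^sub>R A + r' *\<^sub>R A" for r'
    by transfer (rule scaleR_left_distrib)
  show "r *\<^sub>R r' *\<^sub>R A = (r * r') *\<^sub>R A" for r'
    by transfer simp
  show "1 *\<^sub>R A = A"
    by transfer simp
  show "r *\<^sub>R A * B = r *\<^sub>R (A * B)" "A * r *\<^sub>R B = r *\<^sub>R (A * B)"
    by (transfer; simp add: vec_eq_iff matrix_matrix_mult_def scaleR_sum_right)+
qed (simp_all add: dist_cmat_def uniformity_cmat_def open_cmat_def sgn_cmat_def)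

end

definition entry :: "'n::finite cmat \<Rightarrow> 'n \<Rightarrow> 'n \<Rightarrow> complex" where
  "entry A i j = mat_of A $ i $ j"

lemma entry_add [simp]: "entry (A + B) i j = entry A i j + entry B i j"
  and entry_diff [simp]: "entry (A - B) i j = entry A i j - entry B i j"
  and entry_scaleR [simp]: "entry (r *\<^sub>R A) i j = r *\<^sub>R entry A i j"
  and entry_zero [simp]: "entry 0 i j = 0"
  and entry_one: "entry 1 i j = (if i = j then 1 else 0)"
  and entry_mult: "entry (A * B) i j = (\<Sum>k\<in>UNIV. entry A i k * entry B k j)"
  unfolding entry_def by (transfer; simp add: mat_def matrix_matrix_mult_def)+

lemma cmat_eqI: "(\<And>i j. entry A i j = entry B i j) \<Longrightarrow> A = B"
  unfolding entry_def by transfer (simp add: vec_eq_iff)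

lemma entry_Cmat [simp]: "entry (Cmat A) i j = A $ i $ j"
  by (simp add: entry_def Cmat_inverse)

lemma norm_entry_le: "norm (entry A i j) \<le> norm A"
  unfolding entry_def by transfer (rule norm_entry_le_onorm)

lemma norm_cmat_le_sum: "norm A \<le> (\<Sum>i\<in>UNIV. \<Sum>j\<in>UNIV. norm (entry A i j))"
  unfolding entry_def by transfer (rule onorm_le_sum_entries)

lemma bounded_linear_entry: "bounded_linear (\<lambda>A. entry A i j)"
  by (rule bounded_linear_intro[of _ 1]) (use norm_entry_le in auto)

text \<open>The operator norm is squeezed between a single entry and the sum of all entries.
  Completeness, continuity and summation in \<open>cmat\<close> are reduced to scalars through
  this.\<close>

lemma tendsto_cmat_iff:
  "(f \<longlongrightarrow> l) F \<longleftrightarrow> (\<forall>i j. ((\<lambda>x. entry (f x) i j) \<longlongrightarrow> entry l i j) F)"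
proof
  assume "(f \<longlongrightarrow> l) F"
  then show "\<forall>i j. ((\<lambda>x. entry (f x) i j) \<longlongrightarrow> entry l i j) F"
    by (intro allI bounded_linear.tendsto[OF bounded_linear_entry])
next
  assume *: "\<forall>i j. ((\<lambda>x. entry (f x) i j) \<longlongrightarrow> entry l i j) F"
  have "((\<lambda>x. \<Sum>i\<in>UNIV. \<Sum>j\<in>UNIV. norm (entry (f x) i j - entry l i j)) \<longlongrightarrow>
      (\<Sum>i\<in>UNIV. \<Sum>j\<in>UNIV. norm (entry l i j - entry l i j))) F"
    by (intro tendsto_sum tendsto_norm tendsto_diff *[rule_format] tendsto_const)
  then have "((\<lambda>x. \<Sum>i\<in>UNIV. \<Sum>j\<in>UNIV. norm (entry (f x) i j - entry l i j)) \<longlongrightarrow> 0) F"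
    by simp
  then have "((\<lambda>x. f x - l) \<longlongrightarrow> 0) F"
    by (rule Lim_null_comparison[rotated])
      (intro always_eventually allI order_trans[OF norm_cmat_le_sum], simp)
  then show "(f \<longlongrightarrow> l) F"
    by (rule LIM_zero_cancel)
qed

instance cmat :: (finite) banach
proof
  fix X :: "nat \<Rightarrow> 'a cmat"
  assume X: "Cauchy X"
  have "convergent (\<lambda>n. entry (X n) i j)" for i j
    by (rule Cauchy_convergent[OF bounded_linear.Cauchy[OF bounded_linear_entry X]])
  then obtain l where l: "\<And>i j. (\<lambda>n. entry (X n) i j) \<longlonglongrightarrow> l i j"
    unfolding convergent_def by metis
  have "X \<longlonglongrightarrow> Cmat (\<chi> i j. l i j)"
    using l by (simp add: tendsto_cmat_iff)
  then show "convergent X"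
    by (auto simp: convergent_def)
qed

text \<open>The algebra is a real one; multiplication by a complex number is expressed by a scalar
  matrix, which is central and has the norm of that number.\<close>

definition cscalar :: "complex \<Rightarrow> 'n::finite cmat" where
  "cscalar z = Cmat (mat z)"

lemma entry_cscalar: "entry (cscalar z) i j = (if i = j then z else 0)"
  by (simp add: cscalar_def mat_def)

lemma entry_cscalar_mult [simp]: "entry (cscalar z * A) i j = z * entry A i j"
  and entry_mult_cscalar [simp]: "entry (A * cscalar z) i j = z * entry A i j"
  by (simp_all add: entry_mult entry_cscalar if_distrib if_distribR cong: if_cong)

lemma cscalar_commute: "cscalar z * A = A * cscalar z"
  by (rule cmat_eqI) simp

lemma cscalar_1 [simp]: "cscalar 1 = 1" and cscalar_0 [simp]: "cscalar 0 = 0"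
  by (rule cmat_eqI; simp add: entry_cscalar entry_one)+

lemma cscalar_mult: "cscalar (x * y) = cscalar x * cscalar y"
  by (rule cmat_eqI) (simp add: entry_cscalar)

lemma cscalar_power: "cscalar (x ^ n) = cscalar x ^ n"
  by (induction n) (simp_all add: cscalar_mult)

lemma norm_cscalar [simp]: "norm (cscalar z) = norm z"
proof -
  have 1: "(*v) (mat z) = (\<lambda>x :: complex ^ 'a. z *s x)"
    by (simp add: fun_eq_iff vec_eq_iff matrix_vector_mult_def mat_def if_distribR if_distrib
        cong: if_cong)
  have 2: "norm (z *s x) = norm z * norm x" for x :: "complex ^ 'a"
    by (simp add: norm_vec_def norm_mult L2_set_right_distrib)
  have "onorm (\<lambda>x :: complex ^ 'a. z *s x) = norm z"
  proof (rule antisym)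
    show "onorm (\<lambda>x :: complex ^ 'a. z *s x) \<le> norm z"
      by (rule onorm_le) (simp add: 2)
    have "bounded_linear (\<lambda>x :: complex ^ 'a. z *s x)"
      unfolding 1[symmetric] by (rule bounded_linear_matrix_vector_mult_complex)
    from le_onorm[OF this, of "axis undefined 1"]
    show "norm z \<le> onorm (\<lambda>x :: complex ^ 'a. z *s x)"
      by (simp only: 2) simp
  qed
  then have "onorm ((*v) (mat z) :: complex ^ 'a \<Rightarrow> complex ^ 'a) = norm z"
    by (simp only: 1)
  then show ?thesis
    by (simp add: cscalar_def norm_cmat.rep_eq Cmat_inverse)
qed

section \<open>Real matrices inside the complex algebra, and the real matrix exponential\<close>

definition cmat_of_real :: "real ^ 'n ^ 'n \<Rightarrow> 'n::finite cmat" where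
  "cmat_of_real A = Cmat (\<chi> i j. of_real (A $ i $ j))"

definition cmat_Re :: "'n::finite cmat \<Rightarrow> real ^ 'n ^ 'n" where
  "cmat_Re A = (\<chi> i j. Re (entry A i j))"

lemma entry_cmat_of_real [simp]: "entry (cmat_of_real A) i j = of_real (A $ i $ j)"
  by (simp add: cmat_of_real_def)

lemma cmat_Re_of_real [simp]: "cmat_Re (cmat_of_real A) = A"
  by (simp add: cmat_Re_def)

lemma cmat_of_real_eq_iff: "cmat_of_real A = cmat_of_real B \<longleftrightarrow> A = B"
  by (metis cmat_Re_of_real)

lemma cmat_of_real_mult: "cmat_of_real (A ** B) = cmat_of_real A * cmat_of_real B"
  by (rule cmat_eqI) (simp add: entry_mult matrix_matrix_mult_def)

lemma cmat_of_real_mat_1: "cmat_of_real (mat 1) = 1"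
  by (rule cmat_eqI) (simp add: entry_one mat_def)

lemma bounded_linear_cmat_of_real: "bounded_linear cmat_of_real"
proof -
  have "linear cmat_of_real"
    by (rule linearI) (simp_all add: cmat_eqI scaleR_conv_of_real[where 'a=complex])
  then show ?thesis
    by (simp add: linear_conv_bounded_linear)
qed

lemma norm_le_sum_entries:
  "norm (A :: real ^ 'n ^ 'm) \<le> (\<Sum>i\<in>UNIV. \<Sum>j\<in>UNIV. norm (A $ i $ j))"
proof -
  have "norm A \<le> (\<Sum>i\<in>UNIV. norm (A $ i))"
    by (simp add: norm_vec_def[of A] L2_set_le_sum)
  also have "\<dots> \<le> (\<Sum>i\<in>UNIV. \<Sum>j\<in>UNIV. norm (A $ i $ j))"
    by (intro sum_mono) (simp add: norm_vec_def L2_set_le_sum)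
  finally show ?thesis .
qed

lemma bounded_linear_cmat_Re: "bounded_linear cmat_Re"
proof (rule bounded_linear_intro)
  fix A :: "'a cmat"
  have "norm (cmat_Re A) \<le> (\<Sum>i\<in>UNIV. \<Sum>j\<in>UNIV. norm (cmat_Re A $ i $ j))"
    by (rule norm_le_sum_entries)
  also have "\<dots> \<le> (\<Sum>i\<in>(UNIV :: 'a set). \<Sum>j\<in>(UNIV :: 'a set). norm A)"
    by (intro sum_mono) (auto simp: cmat_Re_def intro: order_trans[OF abs_Re_le_cmod norm_entry_le])
  finally show "norm (cmat_Re A) \<le> norm A * (real CARD('a) * real CARD('a))"
    by (simp add: algebra_simps)
qed (simp_all add: cmat_Re_def vec_eq_iff)

lemmas cmat_of_real_linear = bounded_linear.linear[OF bounded_linear_cmat_of_real]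

lemma cmat_of_real_add: "cmat_of_real (A + B) = cmat_of_real A + cmat_of_real B"
  and cmat_of_real_diff: "cmat_of_real (A - B) = cmat_of_real A - cmat_of_real B"
  and cmat_of_real_scaleR: "cmat_of_real (r *\<^sub>R A) = r *\<^sub>R cmat_of_real A"
  and cmat_of_real_sum: "cmat_of_real (sum f I) = (\<Sum>i\<in>I. cmat_of_real (f i))"
  by (simp_all add: linear_add[OF cmat_of_real_linear] linear_diff[OF cmat_of_real_linear]
      linear_scale[OF cmat_of_real_linear] linear_sum[OF cmat_of_real_linear])

lemma cmat_of_real_0 [simp]: "cmat_of_real 0 = 0"
  by (rule cmat_eqI) simp

lemma cmat_of_real_funpow: "cmat_of_real (((**) A ^^ n) (mat 1)) = cmat_of_real A ^ n"
  by (induction n) (simp_all add: cmat_of_real_mat_1 cmat_of_real_mult)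

text \<open>\<open>cmat_Re\<close> is a bounded linear left inverse of the algebra embedding
  \<open>cmat_of_real\<close>. Convergence of the series behind \<open>mat_exp\<close> is thus
  inherited from \<open>exp\<close> in the Banach algebra.\<close>

lemma mat_exp_sums:
  "(\<lambda>n. (1 / fact n) *\<^sub>R (((**) A ^^ n) (mat 1))) sums cmat_Re (exp (cmat_of_real A))"
proof -
  have "(\<lambda>n. cmat_Re (cmat_of_real A ^ n /\<^sub>R fact n)) sums cmat_Re (exp (cmat_of_real A))"
    by (rule bounded_linear.sums[OF bounded_linear_cmat_Re exp_converges])
  moreover have "cmat_of_real A ^ n /\<^sub>R fact n
      = cmat_of_real ((1 / fact n) *\<^sub>R (((**) A ^^ n) (mat 1)))" for n
    by (simp add: cmat_of_real_scaleR cmat_of_real_funpow inverse_eq_divide)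
  ultimately show ?thesis
    by simp
qed

lemma mat_exp_eq: "mat_exp A = cmat_Re (exp (cmat_of_real A))"
  unfolding mat_exp_def by (rule sums_unique[symmetric, OF mat_exp_sums])

lemma transpose_funpow:
  "transpose (((**) (A :: real ^ 'n ^ 'n) ^^ n) (mat 1)) = ((**) (transpose A) ^^ n) (mat 1)"
proof (induction n)
  case (Suc n)
  \<comment> \<open>Transposition reverses products, which is harmless here because a matrix
    commutes with its own powers.\<close>
  have comm: "A ** ((**) A ^^ n) (mat 1) = ((**) A ^^ n) (mat 1) ** A" for n
    by (induction n) (simp_all add: matrix_mul_assoc)
  show ?case
    by (simp add: comm matrix_transpose_mul Suc.IH)
qed simp

lemma bounded_linear_transpose: "bounded_linear (transpose :: real ^ 'n ^ 'n \<Rightarrow> real ^ 'n ^ 'n)"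
proof -
  have "linear (transpose :: real ^ 'n ^ 'n \<Rightarrow> real ^ 'n ^ 'n)"
    by (rule linearI) (simp_all add: transpose_def vec_eq_iff)
  then show ?thesis
    by (simp add: linear_conv_bounded_linear)
qed

lemma mat_exp_transpose: "mat_exp (transpose A) = transpose (mat_exp A)"
proof -
  have "(\<lambda>n. transpose ((1 / fact n) *\<^sub>R (((**) A ^^ n) (mat 1)))) sums transpose (mat_exp A)"
    unfolding mat_exp_eq
    by (rule bounded_linear.sums[OF bounded_linear_transpose mat_exp_sums])
  then have "(\<lambda>n. (1 / fact n) *\<^sub>R (((**) (transpose A) ^^ n) (mat 1))) sums transpose (mat_exp A)"
    by (simp add: linear_scale[OF bounded_linear.linear[OF bounded_linear_transpose]] transpose_funpow)
  from sums_unique[OF this] show ?thesis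
    by (simp add: mat_exp_def)
qed

section \<open>Growth of the angle between a solution and its initial value\<close>

lemma nonneg_derivative_imp_le:
  fixes g :: "real \<Rightarrow> real"
  assumes "a \<le> b"
    and d: "\<And>r. r \<in> {a..b} \<Longrightarrow> (g has_real_derivative g' r) (at r within {a..b})"
    and nn: "\<And>r. r \<in> {a<..<b} \<Longrightarrow> 0 \<le> g' r"
  shows "g a \<le> g b"
proof (rule DERIV_nonneg_imp_increasing_open[OF \<open>a \<le> b\<close>])
  fix r assume "a < r" "r < b"
  then show "\<exists>y. DERIV g r :> y \<and> 0 \<le> y"
    using d[of r] nn[of r] by (auto simp: at_within_Icc_at)
next
  show "continuous_on {a..b} g"
    using d by (meson DERIV_continuous_on)
qed

text \<open>A Gronwall bound from below: with \<open>\<phi>\<close> an antiderivative of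
  \<open>a\<close>, the function \<open>(y r \<bullet> y r) * exp (2 * \<phi> r)\<close> is
  nondecreasing. The angle with the initial value is therefore defined at all times.\<close>

lemma norm_growth_nonzero:
  fixes y :: "real \<Rightarrow> 'a::real_inner"
  assumes R: "0 \<le> R"
    and dy: "\<And>r. r \<in> {0..R} \<Longrightarrow> (y has_vector_derivative y' r) (at r within {0..R})"
    and y': "\<And>r. r \<in> {0..R} \<Longrightarrow> norm (y' r) \<le> a r * norm (y r)"
    and d\<phi>: "\<And>r. r \<in> {0..R} \<Longrightarrow> (\<phi> has_real_derivative a r) (at r within {0..R})"
    and "y 0 \<noteq> 0"
  shows "y R \<noteq> 0"
proof -
  have "(y 0 \<bullet> y 0) * exp (2 * \<phi> 0) \<le> (y R \<bullet> y R) * exp (2 * \<phi> R)"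
  proof (rule nonneg_derivative_imp_le[OF R])
    fix r assume r: "r \<in> {0..R}"
    have "((\<lambda>r. y r \<bullet> y r) has_real_derivative (2 * (y r \<bullet> y' r))) (at r within {0..R})"
      using bounded_bilinear.has_vector_derivative[OF bounded_bilinear_inner dy[OF r] dy[OF r]]
      by (simp add: has_real_derivative_iff_has_vector_derivative inner_commute)
    then show "((\<lambda>r. (y r \<bullet> y r) * exp (2 * \<phi> r)) has_real_derivative
        2 * (y r \<bullet> y' r + a r * (y r \<bullet> y r)) * exp (2 * \<phi> r)) (at r within {0..R})"
      using d\<phi>[OF r] by (auto intro!: derivative_eq_intros simp: algebra_simps)
  next
    fix r assume "r \<in> {0<..<R}"
    then have r: "r \<in> {0..R}" by simp
    have "- (y r \<bullet> y' r) \<le> norm (y r) * norm (y' r)"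
      using Cauchy_Schwarz_ineq2[of "y r" "y' r"] by linarith
    also have "\<dots> \<le> norm (y r) * (a r * norm (y r))"
      by (intro mult_left_mono y' r) simp
    also have "\<dots> = a r * (y r \<bullet> y r)"
      by (simp add: power2_norm_eq_inner[symmetric] power2_eq_square)
    finally show "0 \<le> 2 * (y r \<bullet> y' r + a r * (y r \<bullet> y r)) * exp (2 * \<phi> r)"
      by simp
  qed
  moreover have "0 < (y 0 \<bullet> y 0) * exp (2 * \<phi> 0)"
    using \<open>y 0 \<noteq> 0\<close> by simp
  ultimately show ?thesis
    by auto
qed

text \<open>\<open>c\<close> is the cosine of the angle between \<open>y r\<close> and
  \<open>x\<close>. Its derivative is the inner product of \<open>v\<close> with the part of
  \<open>x\<close> orthogonal to \<open>y r\<close>, divided by both lengths; that part has length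
  \<open>norm x\<close> times the sine of the angle, which gives the bound.\<close>

lemma cos_angle_derivative:
  fixes y :: "real \<Rightarrow> 'a::real_inner"
  assumes dy: "(y has_vector_derivative v) (at r within D)"
    and v: "norm v \<le> a * norm (y r)" and "y r \<noteq> 0" "x \<noteq> 0"
  defines "c \<equiv> \<lambda>r. (y r \<bullet> x) / (norm (y r) * norm x)"
  obtains c' where "(c has_real_derivative c') (at r within D)" "\<bar>c'\<bar> \<le> a * sqrt (1 - (c r)\<^sup>2)"
proof -
  define n where "n = norm (y r)"
  have n: "0 < n" and nx: "0 < norm x"
    using assms by (simp_all add: n_def)
  have n2: "n * n = y r \<bullet> y r"
    by (simp add: n_def power2_norm_eq_inner[symmetric] power2_eq_square)
  \<comment> \<open>The component of \<open>x\<close> orthogonal to \<open>y r\<close>.\<close>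
  define u where "u = x - ((y r \<bullet> x) / n\<^sup>2) *\<^sub>R y r"
  have dn: "((\<lambda>r. norm (y r)) has_real_derivative (y r \<bullet> v) / n) (at r within D)"
  proof -
    have "((\<lambda>r. y r \<bullet> y r) has_real_derivative (2 * (y r \<bullet> v))) (at r within D)"
      using bounded_bilinear.has_vector_derivative[OF bounded_bilinear_inner dy dy]
      by (simp add: has_real_derivative_iff_has_vector_derivative inner_commute)
    then have "((\<lambda>r. sqrt (y r \<bullet> y r)) has_real_derivative (y r \<bullet> v) / n) (at r within D)"
      using \<open>y r \<noteq> 0\<close>
      by (auto intro!: derivative_eq_intros simp: n_def norm_eq_sqrt_inner field_simps)
        (metis inner_ge_zero not_le)
    then show ?thesis
      by (simp add: norm_eq_sqrt_inner)
  qed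
  have di: "((\<lambda>r. y r \<bullet> x) has_real_derivative (v \<bullet> x)) (at r within D)"
    using bounded_linear.has_vector_derivative[OF bounded_linear_inner_left dy]
    by (simp add: has_real_derivative_iff_has_vector_derivative)
  have "(c has_real_derivative ((v \<bullet> x) * (n * norm x) - (y r \<bullet> x) * ((y r \<bullet> v) / n * norm x)) /
      (n * norm x * (n * norm x))) (at r within D)"
    unfolding c_def n_def
    by (rule DERIV_divide[OF di DERIV_cmult_right[OF dn[unfolded n_def]], of "norm x"])
      (use n nx in \<open>auto simp: n_def\<close>)
  moreover have "((v \<bullet> x) * (n * norm x) - (y r \<bullet> x) * ((y r \<bullet> v) / n * norm x)) /
      (n * norm x * (n * norm x)) = (v \<bullet> u) / (n * norm x)"
    using n nx by (simp add: u_def inner_diff_right inner_commute field_simps power2_eq_square)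
  ultimately have "(c has_real_derivative (v \<bullet> u) / (n * norm x)) (at r within D)"
    by simp
  moreover have "\<bar>(v \<bullet> u) / (n * norm x)\<bar> \<le> a * sqrt (1 - (c r)\<^sup>2)"
  proof -
    have "(norm u)\<^sup>2 = (norm x)\<^sup>2 * (1 - (c r)\<^sup>2)"
    proof -
      have "(norm u)\<^sup>2 = x \<bullet> x - (y r \<bullet> x)\<^sup>2 / n\<^sup>2"
        using n n2 unfolding u_def power2_norm_eq_inner
        by (simp add: inner_diff_left inner_diff_right inner_commute field_simps power2_eq_square)
      moreover have "(norm x)\<^sup>2 * (c r)\<^sup>2 = (y r \<bullet> x)\<^sup>2 / n\<^sup>2"
        using nx by (simp add: c_def n_def[symmetric] power_divide power_mult_distrib)
      ultimately show ?thesis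
        by (simp add: right_diff_distrib power2_norm_eq_inner)
    qed
    then have "norm u = norm x * sqrt (1 - (c r)\<^sup>2)"
      by (metis norm_ge_zero real_sqrt_mult real_sqrt_unique)
    then have "\<bar>v \<bullet> u\<bar> \<le> (a * n) * (norm x * sqrt (1 - (c r)\<^sup>2))"
      using Cauchy_Schwarz_ineq2[of v u] mult_right_mono[OF v norm_ge_zero[of u]]
      by (simp add: n_def)
    then show ?thesis
      using n nx by (simp add: field_simps abs_mult)
  qed
  ultimately show ?thesis
    by (rule that)
qed

text \<open>The angle \<open>arccos (c r)\<close> moves with speed at most \<open>a r\<close>, so
  reaching pi from 0 would cost an integral of at least pi. Since \<open>arccos\<close> is not
  differentiable at 1 and -1, the comparison is made on an interval in whose interior
  \<open>c\<close> avoids both values.\<close>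

lemma not_opposite_direction:
  fixes y :: "real \<Rightarrow> 'a::real_inner"
  assumes R: "0 \<le> R"
    and dy: "\<And>r. r \<in> {0..R} \<Longrightarrow> (y has_vector_derivative y' r) (at r within {0..R})"
    and y': "\<And>r. r \<in> {0..R} \<Longrightarrow> norm (y' r) \<le> a r * norm (y r)"
    and d\<phi>: "\<And>r. r \<in> {0..R} \<Longrightarrow> (\<phi> has_real_derivative a r) (at r within {0..R})"
    and a: "\<And>r. r \<in> {0..R} \<Longrightarrow> 0 \<le> a r"
    and pi: "\<phi> R - \<phi> 0 < pi"
    and "y 0 \<noteq> 0" "0 \<le> \<mu>"
  shows "y R \<noteq> - \<mu> *\<^sub>R y 0"
proof
  assume opp: "y R = - \<mu> *\<^sub>R y 0"
  have sub: "{0..r} \<subseteq> {0..R}" if "r \<in> {0..R}" for r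
    using that by auto
  have nz: "y r \<noteq> 0" if "r \<in> {0..R}" for r
  proof (rule norm_growth_nonzero[of r y y' a \<phi>])
    show "(y has_vector_derivative y' q) (at q within {0..r})" if "q \<in> {0..r}" for q
      using has_vector_derivative_within_subset[OF dy sub[OF \<open>r \<in> {0..R}\<close>]] that \<open>r \<in> {0..R}\<close> by auto
    show "(\<phi> has_real_derivative a q) (at q within {0..r})" if "q \<in> {0..r}" for q
      using DERIV_subset[OF d\<phi> sub[OF \<open>r \<in> {0..R}\<close>]] that \<open>r \<in> {0..R}\<close> by auto
  qed (use that y' \<open>y 0 \<noteq> 0\<close> in auto)
  define c where "c = (\<lambda>r. (y r \<bullet> y 0) / (norm (y r) * norm (y 0)))"
  have "\<exists>c'. (c has_real_derivative c') (at r within {0..R}) \<and> \<bar>c'\<bar> \<le> a r * sqrt (1 - (c r)\<^sup>2)"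
    if r: "r \<in> {0..R}" for r
    using cos_angle_derivative[OF dy[OF r] y'[OF r] nz[OF r] \<open>y 0 \<noteq> 0\<close>] unfolding c_def by blast
  then obtain c' where dc: "\<And>r. r \<in> {0..R} \<Longrightarrow> (c has_real_derivative c' r) (at r within {0..R})"
    and c': "\<And>r. r \<in> {0..R} \<Longrightarrow> \<bar>c' r\<bar> \<le> a r * sqrt (1 - (c r)\<^sup>2)"
    by metis
  have cont: "continuous_on {0..R} c"
    using dc by (meson DERIV_continuous_on)
  have c_le: "\<bar>c r\<bar> \<le> 1" if "r \<in> {0..R}" for r
    using Cauchy_Schwarz_ineq2[of "y r" "y 0"] nz[OF that] \<open>y 0 \<noteq> 0\<close> by (simp add: c_def field_simps)
  have "c 0 = 1"
    using \<open>y 0 \<noteq> 0\<close> by (simp add: c_def dot_square_norm power2_eq_square)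
  \<comment> \<open>The value 0 is excluded because the solution never vanishes.\<close>
  have "0 < \<mu>"
    using opp nz[of R] R \<open>0 \<le> \<mu>\<close> by (cases "\<mu> = 0") auto
  then have "c R = - 1"
    using \<open>y 0 \<noteq> 0\<close> by (simp add: c_def opp dot_square_norm power2_eq_square)
  \<comment> \<open>\<open>r2\<close> is to be the first time at which the direction is
    opposite.\<close>
  have "compact {r \<in> {0..R}. c r = - 1}"
  proof -
    have "closed ({0..R} \<inter> c -` {-1})"
      by (rule continuous_closed_preimage[OF cont]) auto
    then show ?thesis
      by (auto simp: compact_eq_bounded_closed vimage_def Int_def intro: bounded_subset[of "{0..R}"])
  qed
  moreover have "R \<in> {r \<in> {0..R}. c r = - 1}"
    using R \<open>c R = -1\<close> by simp
  ultimately obtain r2 where r2: "r2 \<in> {0..R}" "c r2 = - 1"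
    and r2_le: "\<And>r. r \<in> {0..R} \<Longrightarrow> c r = - 1 \<Longrightarrow> r2 \<le> r"
    using compact_attains_inf[of "{r \<in> {0..R}. c r = - 1}"] by blast
  \<comment> \<open>\<open>r1\<close> is to be the last time before \<open>r2\<close> at which the
    angle is 0; strictly between them \<open>c\<close> lies in the open interval from -1 to
    1.\<close>
  have "compact {r \<in> {0..r2}. c r = 1}"
  proof -
    have "closed ({0..r2} \<inter> c -` {1})"
      by (rule continuous_closed_preimage[OF continuous_on_subset[OF cont]]) (use r2 in auto)
    then show ?thesis
      by (auto simp: compact_eq_bounded_closed vimage_def Int_def intro: bounded_subset[of "{0..r2}"])
  qed
  moreover have "0 \<in> {r \<in> {0..r2}. c r = 1}"
    using r2 \<open>c 0 = 1\<close> by simp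
  ultimately obtain r1 where r1: "r1 \<in> {0..r2}" "c r1 = 1"
    and r1_ge: "\<And>r. r \<in> {0..r2} \<Longrightarrow> c r = 1 \<Longrightarrow> r \<le> r1"
    using compact_attains_sup[of "{r \<in> {0..r2}. c r = 1}"] by blast
  \<comment> \<open>The angle is 0 at \<open>r1\<close> and pi at \<open>r2\<close>, so this
    inequality says that \<open>\<phi>\<close> grows by at least pi between them.\<close>
  have "\<phi> r1 - arccos (c r1) \<le> \<phi> r2 - arccos (c r2)"
  proof (rule DERIV_nonneg_imp_increasing_open[where f = "\<lambda>r. \<phi> r - arccos (c r)"])
    show "r1 \<le> r2" using r1 by simp
    have s: "{r1..r2} \<subseteq> {0..R}" using r1 r2 by auto
    have "continuous_on {0..R} \<phi>"
      using d\<phi> by (meson DERIV_continuous_on)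
    then show "continuous_on {r1..r2} (\<lambda>r. \<phi> r - arccos (c r))"
      using s c_le by (intro continuous_intros continuous_on_arccos continuous_on_subset[OF cont s]
          continuous_on_subset[OF _ s, of \<phi>]) (auto simp: abs_le_iff)
    fix r assume r: "r1 < r" "r < r2"
    then have r': "r \<in> {0..R}" "0 < r" "r < R" using r1 r2 by auto
    have "c r \<noteq> 1" "c r \<noteq> - 1"
      using r r1_ge[of r] r2_le[of r] r1 r' by auto
    then have lt: "- 1 < c r" "c r < 1"
      using c_le[OF r'(1)] by (auto simp: abs_le_iff)
    then have "0 < 1 - (c r)\<^sup>2"
      by (simp add: power2_eq_square abs_square_less_1[unfolded power2_eq_square])
    then have sq: "0 < sqrt (1 - (c r)\<^sup>2)"
      by simp
    have "DERIV c r :> c' r" "DERIV \<phi> r :> a r"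
      using dc[OF r'(1)] d\<phi>[OF r'(1)] r' by (simp_all add: at_within_Icc_at)
    then have "DERIV (\<lambda>r. \<phi> r - arccos (c r)) r :> a r - inverse (- sqrt (1 - (c r)\<^sup>2)) * c' r"
      using DERIV_chain2[where f = arccos and g = c, OF DERIV_arccos[OF lt]] lt by (auto intro!: derivative_eq_intros)
    moreover have "0 \<le> a r - inverse (- sqrt (1 - (c r)\<^sup>2)) * c' r"
      using c'[OF r'(1)] sq by (simp add: field_simps abs_le_iff)
    ultimately show "\<exists>D. DERIV (\<lambda>r. \<phi> r - arccos (c r)) r :> D \<and> 0 \<le> D"
      by blast
  qed
  moreover have "\<phi> 0 \<le> \<phi> r1"
    by (rule nonneg_derivative_imp_le[of _ _ _ a])
      (use r1 r2 a DERIV_subset[OF d\<phi>, of _ "{0..r1}"] in auto)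
  moreover have "\<phi> r2 \<le> \<phi> R"
    by (rule nonneg_derivative_imp_le[of _ _ _ a])
      (use r1 r2 a DERIV_subset[OF d\<phi>, of _ "{r2..R}"] in auto)
  ultimately show False
    using pi r1 r2 by simp
qed

section \<open>The logarithm of a matrix without spectrum on the negative real axis\<close>

text \<open>Replacing \<open>fact (n + k)\<close> by the smaller \<open>fact n\<close> lets the
  factor \<open>norm x ^ k\<close> be pulled out of the tail. The case \<open>k = 2\<close> yields
  the derivative of \<open>exp\<close> at 0; general \<open>k\<close> later controls the Taylor
  coefficients of an exponential.\<close>

lemma exp_remainder_bound:
  fixes x :: "'a::{real_normed_algebra_1,banach}"
  shows "norm (exp x - (\<Sum>n<k. x ^ n /\<^sub>R fact n)) \<le> norm x ^ k * exp (norm x)"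
proof -
  have s: "summable (\<lambda>n. norm x ^ k * (norm x ^ n /\<^sub>R fact n))"
    by (intro summable_mult summable_exp_generic)
  have le: "norm (x ^ (n + k) /\<^sub>R fact (n + k)) \<le> norm x ^ k * (norm x ^ n /\<^sub>R fact n)" for n
  proof -
    have "norm (x ^ (n + k) /\<^sub>R fact (n + k)) \<le> norm x ^ (n + k) / fact (n + k)"
      by (simp add: divide_inverse mult.commute mult_left_mono norm_power_ineq)
    also have "\<dots> \<le> norm x ^ (n + k) / fact n"
      by (intro divide_left_mono fact_mono) auto
    finally show ?thesis
      by (simp add: power_add divide_inverse mult_ac)
  qed
  have "exp x - (\<Sum>n<k. x ^ n /\<^sub>R fact n) = (\<Sum>n. x ^ (n + k) /\<^sub>R fact (n + k))"
    unfolding exp_first_terms[of x k] by simp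
  also have "norm \<dots> \<le> (\<Sum>n. norm x ^ k * (norm x ^ n /\<^sub>R fact n))"
    by (rule norm_suminf_le[OF le s])
  also have "\<dots> = norm x ^ k * exp (norm x)"
    by (simp only: exp_def suminf_mult[OF summable_exp_generic])
  finally show ?thesis .
qed


text \<open>In a noncommutative algebra the derivative of \<open>exp\<close> is simple only at 0.
  Other base points are reached below by splitting off a commuting factor.\<close>

lemma exp_has_derivative_at_0:
  "(exp has_derivative (\<lambda>h. h)) (at (0 :: 'a::{real_normed_algebra_1,banach}))"
proof (rule has_derivativeI_sandwich[of 1])
  show "bounded_linear (\<lambda>h :: 'a. h)"
    by (rule bounded_linear_ident)
  show "((\<lambda>h :: 'a. norm h * exp (norm h)) \<longlongrightarrow> 0) (at 0)"
    by (rule tendsto_eq_intros refl | simp)+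
  fix h :: 'a
  assume "h \<noteq> 0"
  then show "norm (exp h - exp 0 - (h - 0)) / norm (h - 0) \<le> norm h * exp (norm h)"
    using exp_remainder_bound[of h 2]
    by (simp add: eval_nat_numeral divide_le_eq algebra_simps)
qed simp_all

text \<open>Let \<open>L \<sigma>\<close> be the integral up to \<open>\<sigma>\<close>. Formally it
  is the logarithm of \<open>1 + \<sigma> *\<^sub>R B\<close>, so
  \<open>exp (- L \<sigma>) * (1 + \<sigma> *\<^sub>R B)\<close> should be constant. Everything
  involved commutes, because \<open>G\<close> consists of inverses of polynomials in
  \<open>B\<close>, and the derivative is indeed 0.\<close>

lemma exp_integral_resolvent:
  fixes B :: "'a::{real_normed_algebra_1,banach}"
  assumes G: "continuous_on {0..1} G"
    and inv: "\<And>\<tau>. \<tau> \<in> {0..1} \<Longrightarrow> (1 + \<tau> *\<^sub>R B) * G \<tau> = 1 \<and> G \<tau> * (1 + \<tau> *\<^sub>R B) = 1"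
  shows "exp (integral {0..1} (\<lambda>\<tau>. B * G \<tau>)) = 1 + B"
proof -
  \<comment> \<open>Whatever commutes with \<open>B\<close> commutes with
    \<open>1 + \<tau> *\<^sub>R B\<close> and hence with its inverse.\<close>
  have commG: "X * G \<tau> = G \<tau> * X" if "\<tau> \<in> {0..1}" "X * B = B * X" for X \<tau>
  proof -
    have "X * (1 + \<tau> *\<^sub>R B) = (1 + \<tau> *\<^sub>R B) * X"
      using that by (simp add: distrib_left distrib_right)
    then have "G \<tau> * (X * (1 + \<tau> *\<^sub>R B)) * G \<tau> = G \<tau> * ((1 + \<tau> *\<^sub>R B) * X) * G \<tau>"
      by simp
    moreover have "G \<tau> * (X * (1 + \<tau> *\<^sub>R B)) * G \<tau> = G \<tau> * X * ((1 + \<tau> *\<^sub>R B) * G \<tau>)"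
      by (simp only: mult.assoc)
    moreover have "G \<tau> * ((1 + \<tau> *\<^sub>R B) * X) * G \<tau> = (G \<tau> * (1 + \<tau> *\<^sub>R B)) * (X * G \<tau>)"
      by (simp only: mult.assoc)
    ultimately show ?thesis
      using inv[OF that(1)] by simp
  qed
  define g where "g = (\<lambda>\<tau>. B * G \<tau>)"
  define L where "L = (\<lambda>\<sigma>. integral {0..\<sigma>} g)"
  have g: "continuous_on {0..1} g"
    unfolding g_def by (intro continuous_intros G)
  have BG: "B * G \<tau> = G \<tau> * B" if "\<tau> \<in> {0..1}" for \<tau>
    using commG[OF that, of B] by simp
  have gg: "g \<sigma> * g \<tau> = g \<tau> * g \<sigma>" if "\<sigma> \<in> {0..1}" "\<tau> \<in> {0..1}" for \<sigma> \<tau>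
  proof -
    have "g \<sigma> * B = B * (G \<sigma> * B)"
      by (simp only: g_def mult.assoc)
    then have "g \<sigma> * B = B * g \<sigma>"
      by (simp only: g_def BG[OF that(1)])
    then have "g \<sigma> * (B * G \<tau>) = (B * G \<tau>) * g \<sigma>"
      using commG[OF that(2), of "g \<sigma>"] by (metis mult.assoc)
    then show ?thesis
      by (simp add: g_def)
  qed
  have int: "g integrable_on {0..\<sigma>}" if "\<sigma> \<in> {0..1}" for \<sigma>
    by (intro integrable_continuous_real continuous_on_subset[OF g]) (use that in auto)
  have commL: "X * L \<sigma> = L \<sigma> * X"
    if "\<sigma> \<in> {0..1}" and X: "\<And>\<tau>. \<tau> \<in> {0..1} \<Longrightarrow> X * g \<tau> = g \<tau> * X" for X \<sigma>
  proof -
    have "X * L \<sigma> = integral {0..\<sigma>} (\<lambda>\<tau>. X * g \<tau>)"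
      using integral_linear[OF int[OF that(1)] bounded_linear_mult_right[of X]]
      by (simp add: L_def o_def)
    also have "\<dots> = integral {0..\<sigma>} (\<lambda>\<tau>. g \<tau> * X)"
      using that by (intro integral_cong) auto
    also have "\<dots> = L \<sigma> * X"
      using integral_linear[OF int[OF that(1)] bounded_linear_mult_left[of X]]
      by (simp add: L_def o_def)
    finally show ?thesis .
  qed
  have LL: "L \<sigma> * L \<tau> = L \<tau> * L \<sigma>" if "\<sigma> \<in> {0..1}" "\<tau> \<in> {0..1}" for \<sigma> \<tau>
    using commL[OF that(2), of "L \<sigma>"] commL[OF that(1)] gg by metis
  have dL: "(L has_vector_derivative g \<sigma>) (at \<sigma> within {0..1})" if "\<sigma> \<in> {0..1}" for \<sigma>
    unfolding L_def by (rule integral_has_vector_derivative[OF g that])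
  define W where "W = (\<lambda>\<sigma>. exp (- L \<sigma>) * (1 + \<sigma> *\<^sub>R B))"
  have "(W has_vector_derivative 0) (at \<sigma> within {0..1})" if \<sigma>: "\<sigma> \<in> {0..1}" for \<sigma>
  proof -
    \<comment> \<open>The increment of \<open>L\<close> vanishes at
      \<open>\<tau> = \<sigma>\<close>, so the derivative of \<open>exp\<close> at 0 suffices. The
      factor \<open>exp (- L \<sigma>)\<close> is multiplied back afterwards by
      commutativity.\<close>
    have "((\<lambda>\<tau>. - (L \<tau> - L \<sigma>)) has_vector_derivative - g \<sigma>) (at \<sigma> within {0..1})"
      using dL[OF \<sigma>] by (auto intro!: derivative_eq_intros)
    then have "((\<lambda>\<tau>. exp (- (L \<tau> - L \<sigma>))) has_derivative (\<lambda>h. h *\<^sub>R - g \<sigma>)) (at \<sigma> within {0..1})"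
      unfolding has_vector_derivative_def
      by (rule has_derivative_compose) (simp add: exp_has_derivative_at_0)
    then have "((\<lambda>\<tau>. exp (- (L \<tau> - L \<sigma>))) has_vector_derivative - g \<sigma>) (at \<sigma> within {0..1})"
      by (simp add: has_vector_derivative_def)
    moreover have "((\<lambda>\<tau>. 1 + \<tau> *\<^sub>R B) has_vector_derivative B) (at \<sigma> within {0..1})"
      by (auto intro!: derivative_eq_intros simp: has_vector_derivative_def)
    ultimately have "((\<lambda>\<tau>. exp (- (L \<tau> - L \<sigma>)) * (1 + \<tau> *\<^sub>R B)) has_vector_derivative
        exp (- (L \<sigma> - L \<sigma>)) * B + - g \<sigma> * (1 + \<sigma> *\<^sub>R B)) (at \<sigma> within {0..1})"
      by (rule has_vector_derivative_mult)
    moreover have "exp (- (L \<sigma> - L \<sigma>)) * B + - g \<sigma> * (1 + \<sigma> *\<^sub>R B) = 0"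
      using inv[OF \<sigma>] by (simp add: g_def mult.assoc)
    ultimately have "((\<lambda>\<tau>. exp (- (L \<tau> - L \<sigma>)) * (1 + \<tau> *\<^sub>R B)) has_vector_derivative 0)
        (at \<sigma> within {0..1})"
      by simp
    from bounded_linear.has_vector_derivative[OF bounded_linear_mult_right[of "exp (- L \<sigma>)"] this]
    have "((\<lambda>\<tau>. exp (- L \<sigma>) * (exp (- (L \<tau> - L \<sigma>)) * (1 + \<tau> *\<^sub>R B))) has_vector_derivative 0)
        (at \<sigma> within {0..1})"
      by simp
    then show ?thesis
    proof (rule has_vector_derivative_transform[OF \<sigma>, rotated])
      fix \<tau> :: real assume \<tau>: "\<tau> \<in> {0..1}"
      have "- L \<sigma> * - (L \<tau> - L \<sigma>) = - (L \<tau> - L \<sigma>) * - L \<sigma>"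
        using LL[OF \<sigma> \<tau>] by (simp add: algebra_simps)
      from exp_add_commuting[OF this] show "W \<tau> = exp (- L \<sigma>) * (exp (- (L \<tau> - L \<sigma>)) * (1 + \<tau> *\<^sub>R B))"
        by (simp add: W_def mult.assoc[symmetric])
    qed
  qed
  then obtain c where c: "\<And>\<sigma>. \<sigma> \<in> {0..1} \<Longrightarrow> W \<sigma> = c"
    using has_vector_derivative_zero_constant[of "{0..1}" W] by auto
  have "W 0 = 1"
    by (simp add: W_def L_def)
  then have "exp (- L 1) * (1 + B) = 1"
    using c[of 0] c[of 1] by (simp add: W_def)
  then have "exp (L 1) * exp (- L 1) * (1 + B) = exp (L 1)"
    by (simp add: mult.assoc)
  then show ?thesis
    by (simp add: exp_minus_inverse L_def g_def)
qed

text \<open>Cramer's rule. As quotients of determinants, the entries visibly depend holomorphically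
  on the entries of \<open>A\<close> wherever the determinant is nonzero.\<close>

definition cinv :: "'n::finite cmat \<Rightarrow> 'n cmat" where
  "cinv A = Cmat (\<chi> k j. det (\<chi> i l. if l = k then (if i = j then 1 else 0) else entry A i l)
     / det (\<chi> i l. entry A i l))"

lemma mat_of_eq_entry: "mat_of A = (\<chi> i j. entry A i j)"
  by (simp add: entry_def vec_eq_iff)

lemma cmat_left_inverse: "A * B = 1 \<Longrightarrow> B * A = (1 :: 'n::finite cmat)"
  by transfer (simp add: matrix_left_right_inverse)

lemma cinv:
  assumes "det (mat_of A) \<noteq> 0"
  shows "A * cinv A = 1" "cinv A * A = 1"
proof -
  have "entry (A * cinv A) i j = entry 1 i j" for i j
  proof -
    define x where "x = (\<chi> k. entry (cinv A) k j)"
    have "mat_of A *v x = axis j 1"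
      using assms by (subst cramer)
        (simp_all add: x_def cinv_def vec_eq_iff axis_def mat_of_eq_entry cong: if_cong)
    moreover have "entry (A * cinv A) i j = (mat_of A *v x) $ i"
      by (simp add: entry_mult x_def matrix_vector_mult_def) (simp add: entry_def)
    ultimately show ?thesis
      by (simp add: entry_one axis_def)
  qed
  then show "A * cinv A = 1"
    by (rule cmat_eqI)
  then show "cinv A * A = 1"
    by (rule cmat_left_inverse)
qed

text \<open>These are the hypotheses for differentiating under an integral over the unit interval.
  They are stable under sums, products and inverses, hence pass to determinants and to
  \<open>cinv\<close>.\<close>

definition holomorphic_param :: "complex set \<Rightarrow> (complex \<Rightarrow> real \<Rightarrow> complex) \<Rightarrow> bool" where
  "holomorphic_param D f \<longleftrightarrow> (\<exists>f'.
     (\<forall>z\<in>D. \<forall>\<tau>\<in>{0..1}. ((\<lambda>z. f z \<tau>) has_field_derivative f' z \<tau>) (at z within D)) \<and>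
     continuous_on (D \<times> {0..1}) (\<lambda>(z, \<tau>). f z \<tau>) \<and>
     continuous_on (D \<times> {0..1}) (\<lambda>(z, \<tau>). f' z \<tau>))"

lemma holomorphic_paramI:
  assumes "\<And>z \<tau>. z \<in> D \<Longrightarrow> \<tau> \<in> {0..1} \<Longrightarrow>
      ((\<lambda>z. f z \<tau>) has_field_derivative f' z \<tau>) (at z within D)"
    and "continuous_on (D \<times> {0..1}) (\<lambda>x. f (fst x) (snd x))"
    and "continuous_on (D \<times> {0..1}) (\<lambda>x. f' (fst x) (snd x))"
  shows "holomorphic_param D f"
  using assms unfolding holomorphic_param_def case_prod_beta by blast

lemma holomorphic_paramE:
  assumes "holomorphic_param D f"
  obtains f' where "\<And>z \<tau>. z \<in> D \<Longrightarrow> \<tau> \<in> {0..1} \<Longrightarrow>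
      ((\<lambda>z. f z \<tau>) has_field_derivative f' z \<tau>) (at z within D)"
    and "continuous_on (D \<times> {0..1}) (\<lambda>x. f (fst x) (snd x))"
    and "continuous_on (D \<times> {0..1}) (\<lambda>x. f' (fst x) (snd x))"
  using assms unfolding holomorphic_param_def case_prod_beta by blast

lemma holomorphic_param_of_real: "holomorphic_param D (\<lambda>z \<tau>. of_real (g \<tau>))"
  if "continuous_on {0..1} g"
  by (rule holomorphic_paramI[of _ _ "\<lambda>_ _. 0"])
    (auto intro!: continuous_intros continuous_on_compose2[OF that])

lemma holomorphic_param_const: "holomorphic_param D (\<lambda>z \<tau>. c)"
  by (rule holomorphic_paramI[of _ _ "\<lambda>_ _. 0"]) (auto intro!: continuous_intros)

lemma holomorphic_param_holomorphic:
  assumes "open D" "f holomorphic_on D"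
  shows "holomorphic_param D (\<lambda>z \<tau>. f z)"
proof (rule holomorphic_paramI)
  show "(f has_field_derivative deriv f z) (at z within D)" if "z \<in> D" for z
    using holomorphic_derivI[OF assms(2,1) that] by (rule has_field_derivative_at_within)
  show "continuous_on (D \<times> {0..1}) (\<lambda>x. f (fst x))"
    by (rule continuous_on_compose2[OF holomorphic_on_imp_continuous_on[OF assms(2)]])
      (auto intro!: continuous_intros)
  show "continuous_on (D \<times> {0..1}) (\<lambda>x. deriv f (fst x))"
    by (rule continuous_on_compose2[OF holomorphic_on_imp_continuous_on[OF holomorphic_deriv[OF assms(2,1)]]])
      (auto intro!: continuous_intros)
qed

lemma holomorphic_param_add:
  assumes "holomorphic_param D f" "holomorphic_param D g"
  shows "holomorphic_param D (\<lambda>z \<tau>. f z \<tau> + g z \<tau>)"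
proof -
  obtain f' g' where *:
    "\<And>z \<tau>. z \<in> D \<Longrightarrow> \<tau> \<in> {0..1} \<Longrightarrow> ((\<lambda>z. f z \<tau>) has_field_derivative f' z \<tau>) (at z within D)"
    "continuous_on (D \<times> {0..1}) (\<lambda>x. f (fst x) (snd x))"
    "continuous_on (D \<times> {0..1}) (\<lambda>x. f' (fst x) (snd x))"
    "\<And>z \<tau>. z \<in> D \<Longrightarrow> \<tau> \<in> {0..1} \<Longrightarrow> ((\<lambda>z. g z \<tau>) has_field_derivative g' z \<tau>) (at z within D)"
    "continuous_on (D \<times> {0..1}) (\<lambda>x. g (fst x) (snd x))"
    "continuous_on (D \<times> {0..1}) (\<lambda>x. g' (fst x) (snd x))"
    using assms by (elim holomorphic_paramE) blast
  show ?thesis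
    by (rule holomorphic_paramI[of _ _ "\<lambda>z \<tau>. f' z \<tau> + g' z \<tau>"])
      (auto intro!: DERIV_add continuous_intros * simp del: atLeastAtMost_iff)
qed

lemma holomorphic_param_mult:
  assumes "holomorphic_param D f" "holomorphic_param D g"
  shows "holomorphic_param D (\<lambda>z \<tau>. f z \<tau> * g z \<tau>)"
proof -
  obtain f' g' where *:
    "\<And>z \<tau>. z \<in> D \<Longrightarrow> \<tau> \<in> {0..1} \<Longrightarrow> ((\<lambda>z. f z \<tau>) has_field_derivative f' z \<tau>) (at z within D)"
    "continuous_on (D \<times> {0..1}) (\<lambda>x. f (fst x) (snd x))"
    "continuous_on (D \<times> {0..1}) (\<lambda>x. f' (fst x) (snd x))"
    "\<And>z \<tau>. z \<in> D \<Longrightarrow> \<tau> \<in> {0..1} \<Longrightarrow> ((\<lambda>z. g z \<tau>) has_field_derivative g' z \<tau>) (at z within D)"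
    "continuous_on (D \<times> {0..1}) (\<lambda>x. g (fst x) (snd x))"
    "continuous_on (D \<times> {0..1}) (\<lambda>x. g' (fst x) (snd x))"
    using assms by (elim holomorphic_paramE) blast
  show ?thesis
    by (rule holomorphic_paramI[of _ _ "\<lambda>z \<tau>. f' z \<tau> * g z \<tau> + g' z \<tau> * f z \<tau>"])
      (auto intro!: DERIV_mult continuous_intros * simp del: atLeastAtMost_iff)
qed

lemma holomorphic_param_inverse:
  assumes "holomorphic_param D f" and nz: "\<And>z \<tau>. z \<in> D \<Longrightarrow> \<tau> \<in> {0..1} \<Longrightarrow> f z \<tau> \<noteq> 0"
  shows "holomorphic_param D (\<lambda>z \<tau>. inverse (f z \<tau>))"
proof -
  obtain f' where *:
    "\<And>z \<tau>. z \<in> D \<Longrightarrow> \<tau> \<in> {0..1} \<Longrightarrow> ((\<lambda>z. f z \<tau>) has_field_derivative f' z \<tau>) (at z within D)"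
    "continuous_on (D \<times> {0..1}) (\<lambda>x. f (fst x) (snd x))"
    "continuous_on (D \<times> {0..1}) (\<lambda>x. f' (fst x) (snd x))"
    using assms by (elim holomorphic_paramE) blast
  show ?thesis
    by (rule holomorphic_paramI[of _ _ "\<lambda>z \<tau>. - (inverse (f z \<tau>) * f' z \<tau> * inverse (f z \<tau>))"])
      (auto intro!: DERIV_inverse' continuous_intros * simp: nz simp del: atLeastAtMost_iff)
qed

lemma holomorphic_param_sum:
  "(\<And>i. i \<in> I \<Longrightarrow> holomorphic_param D (f i)) \<Longrightarrow> holomorphic_param D (\<lambda>z \<tau>. \<Sum>i\<in>I. f i z \<tau>)"
  by (induction I rule: infinite_finite_induct)
    (simp_all add: holomorphic_param_const holomorphic_param_add)

lemma holomorphic_param_prod: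
  "(\<And>i. i \<in> I \<Longrightarrow> holomorphic_param D (f i)) \<Longrightarrow> holomorphic_param D (\<lambda>z \<tau>. \<Prod>i\<in>I. f i z \<tau>)"
  by (induction I rule: infinite_finite_induct)
    (simp_all add: holomorphic_param_const holomorphic_param_mult)

lemma holomorphic_param_det:
  "(\<And>i j. holomorphic_param D (\<lambda>z \<tau>. M z \<tau> $ i $ j)) \<Longrightarrow> holomorphic_param D (\<lambda>z \<tau>. det (M z \<tau>))"
  unfolding det_def
  by (intro holomorphic_param_sum holomorphic_param_mult holomorphic_param_const holomorphic_param_prod)

lemma holomorphic_param_continuous:
  assumes "holomorphic_param D f" "z \<in> D"
  shows "continuous_on {0..1} (f z)"
proof -
  obtain f' where "continuous_on (D \<times> {0..1}) (\<lambda>x. f (fst x) (snd x))"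
    using assms by (elim holomorphic_paramE) blast
  from continuous_on_compose2[OF this continuous_on_Pair[OF continuous_on_const continuous_on_id], of z]
  show ?thesis
    using \<open>z \<in> D\<close> by auto
qed

lemma holomorphic_param_integral:
  assumes f: "holomorphic_param D f" and "convex D"
  shows "(\<lambda>z. integral {0..1} (f z)) holomorphic_on D"
proof -
  obtain f' where *:
    "\<And>z \<tau>. z \<in> D \<Longrightarrow> \<tau> \<in> {0..1} \<Longrightarrow> ((\<lambda>z. f z \<tau>) has_field_derivative f' z \<tau>) (at z within D)"
    "continuous_on (D \<times> {0..1}) (\<lambda>x. f' (fst x) (snd x))"
    using f by (elim holomorphic_paramE) blast
  have "(\<lambda>z. integral (cbox 0 1) (f z)) holomorphic_on D"
    by (rule leibniz_rule_holomorphic[of D 0 1 f f'])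
      (use * \<open>convex D\<close> holomorphic_param_continuous[OF f] in
        \<open>auto simp: case_prod_beta intro!: integrable_continuous_real\<close>)
  then show ?thesis
    by simp
qed

definition log_integrand :: "'n::finite cmat \<Rightarrow> real \<Rightarrow> 'n cmat" where
  "log_integrand Y \<tau> = (Y - 1) * cinv (1 + \<tau> *\<^sub>R (Y - 1))"

text \<open>A logarithm of \<open>Y\<close> for a spectrum disjoint from the negative real axis:
  \<open>log y = (\<integral>\<^sub>0\<^sup>1 (y - 1) / (1 + \<tau> (y - 1)) d\<tau>)\<close>.\<close>

definition clog :: "'n::finite cmat \<Rightarrow> 'n cmat" where
  "clog Y = integral {0..1} (log_integrand Y)"

text \<open>The determinant condition says that no eigenvalue y satisfies 1 + \<tau> (y - 1) = 0,
  that is y = 1 - 1/\<tau> for 0 < \<tau> \<le> 1: the spectrum avoids 0 and the negative real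
  axis.\<close>

lemma holomorphic_param_log_integrand:
  fixes Y :: "complex \<Rightarrow> 'n::finite cmat"
  assumes "open D" and Y: "\<And>i j. (\<lambda>z. entry (Y z) i j) holomorphic_on D"
    and nz: "\<And>z \<tau>. z \<in> D \<Longrightarrow> \<tau> \<in> {0..1} \<Longrightarrow> det (mat_of (1 + \<tau> *\<^sub>R (Y z - 1))) \<noteq> 0"
  shows "holomorphic_param D (\<lambda>z \<tau>. entry (cinv (1 + \<tau> *\<^sub>R (Y z - 1))) i j)"
    and "holomorphic_param D (\<lambda>z \<tau>. entry (log_integrand (Y z) \<tau>) i j)"
proof -
  have B: "holomorphic_param D (\<lambda>z \<tau>. entry (Y z - 1) i j)" for i j
    by (rule holomorphic_param_holomorphic[OF \<open>open D\<close>]) (auto intro!: holomorphic_intros Y)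
  have E: "holomorphic_param D (\<lambda>z \<tau>. entry (1 + \<tau> *\<^sub>R (Y z - 1)) i j)" for i j
    unfolding entry_add entry_scaleR scaleR_conv_of_real[where 'a = complex]
    by (intro holomorphic_param_add holomorphic_param_mult holomorphic_param_const B
        holomorphic_param_of_real continuous_intros)
  have inv: "holomorphic_param D (\<lambda>z \<tau>. entry (cinv (1 + \<tau> *\<^sub>R (Y z - 1))) i j)" for i j
  proof -
    have "holomorphic_param D (\<lambda>z \<tau>.
        det (\<chi> i' l. if l = i then (if i' = j then 1 else 0) else entry (1 + \<tau> *\<^sub>R (Y z - 1)) i' l))"
    proof (rule holomorphic_param_det)
      fix k l
      show "holomorphic_param D (\<lambda>z \<tau>. (\<chi> i' l. if l = i then if i' = j then 1 else 0
          else entry (1 + \<tau> *\<^sub>R (Y z - 1)) i' l) $ k $ l)"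
        using E[of k l] by (cases "l = i") (auto simp: holomorphic_param_const)
    qed
    moreover have "holomorphic_param D (\<lambda>z \<tau>. inverse (det (\<chi> i l. entry (1 + \<tau> *\<^sub>R (Y z - 1)) i l)))"
    proof (rule holomorphic_param_inverse)
      show "holomorphic_param D (\<lambda>z \<tau>. det (\<chi> i l. entry (1 + \<tau> *\<^sub>R (Y z - 1)) i l))"
        by (rule holomorphic_param_det) (use E in simp)
    qed (use nz in \<open>simp add: mat_of_eq_entry\<close>)
    ultimately show ?thesis
      unfolding cinv_def entry_Cmat vec_lambda_beta divide_inverse by (rule holomorphic_param_mult)
  qed
  then show "holomorphic_param D (\<lambda>z \<tau>. entry (cinv (1 + \<tau> *\<^sub>R (Y z - 1))) i j)" .
  show "holomorphic_param D (\<lambda>z \<tau>. entry (log_integrand (Y z) \<tau>) i j)"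
    unfolding log_integrand_def entry_mult
    by (intro holomorphic_param_sum holomorphic_param_mult B inv)
qed

lemma continuous_on_cmat:
  "(\<And>i j. continuous_on D (\<lambda>x. entry (f x) i j)) \<Longrightarrow> continuous_on D f"
  unfolding continuous_on_def by (subst tendsto_cmat_iff) blast

text \<open>The resolvent formula with \<open>B = Y z - 1\<close> gives the exponential. Holomorphy
  follows entry by entry, since taking an entry commutes with the integral in
  \<open>clog\<close>.\<close>

lemma
  fixes Y :: "complex \<Rightarrow> 'n::finite cmat"
  assumes "open D" "convex D" and Y: "\<And>i j. (\<lambda>z. entry (Y z) i j) holomorphic_on D"
    and nz: "\<And>z \<tau>. z \<in> D \<Longrightarrow> \<tau> \<in> {0..1} \<Longrightarrow> det (mat_of (1 + \<tau> *\<^sub>R (Y z - 1))) \<noteq> 0"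
  shows exp_clog: "z \<in> D \<Longrightarrow> exp (clog (Y z)) = Y z"
    and holomorphic_clog: "(\<lambda>z. entry (clog (Y z)) i j) holomorphic_on D"
proof -
  note hp = holomorphic_param_log_integrand[OF \<open>open D\<close> Y nz]
  have cont: "continuous_on {0..1} (log_integrand (Y z))" if "z \<in> D" for z
    by (rule continuous_on_cmat holomorphic_param_continuous[OF hp(2) that])+
  show "exp (clog (Y z)) = Y z" if "z \<in> D"
  proof -
    have "exp (clog (Y z)) = 1 + (Y z - 1)"
      unfolding clog_def log_integrand_def
    proof (rule exp_integral_resolvent)
      show "continuous_on {0..1} (\<lambda>\<tau>. cinv (1 + \<tau> *\<^sub>R (Y z - 1)))"
        by (rule continuous_on_cmat holomorphic_param_continuous[OF hp(1) that])+
    qed (use cinv nz that in blast)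
    then show ?thesis by simp
  qed
  have "(\<lambda>z. integral {0..1} (\<lambda>\<tau>. entry (log_integrand (Y z) \<tau>) i j)) holomorphic_on D"
    by (rule holomorphic_param_integral[OF hp(2) \<open>convex D\<close>])
  then show "(\<lambda>z. entry (clog (Y z)) i j) holomorphic_on D"
  proof (rule holomorphic_transform)
    fix z assume "z \<in> D"
    show "integral {0..1} (\<lambda>\<tau>. entry (log_integrand (Y z) \<tau>) i j) = entry (clog (Y z)) i j"
      using integral_linear[OF integrable_continuous_real[OF cont[OF \<open>z \<in> D\<close>]] bounded_linear_entry]
      by (simp add: clog_def o_def)
  qed
qed

lemma clog_1 [simp]: "clog 1 = 0"
proof -
  have "log_integrand (1 :: 'a cmat) = (\<lambda>_. 0)"
    by (rule ext) (simp add: log_integrand_def)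
  then show ?thesis
    by (simp add: clog_def)
qed

unbundle no vec_syntax
notation fps_nth (infixl \<open>$\<close> 75)

section \<open>The formal solution of Magnus' equation\<close>

text \<open>Real scalars on power series with noncommuting coefficients allow the division by
  factorials in a formal exponential.\<close>

instantiation fps :: (real_algebra_1) real_algebra_1
begin

definition scaleR_fps :: "real \<Rightarrow> 'a fps \<Rightarrow> 'a fps" where
  "scaleR_fps c F = Abs_fps (\<lambda>n. c *\<^sub>R (F $ n))"

instance
  by standard (simp_all add: scaleR_fps_def fps_eq_iff fps_mult_nth scaleR_right_distrib
      scaleR_left_distrib scaleR_sum_right)

end

lemma fps_nth_scaleR [simp]: "(c *\<^sub>R F) $ n = c *\<^sub>R (F $ n)"
  by (simp add: scaleR_fps_def)

definition ad :: "'a::ring \<Rightarrow> 'a \<Rightarrow> 'a" where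
  "ad x y = x * y - y * x"

lemma ad_scaleR: "ad x (c *\<^sub>R y) = c *\<^sub>R ad (x :: 'a::real_algebra) y"
  by (simp add: ad_def scaleR_diff_right)

lemma ad_sum: "ad x (sum f I) = (\<Sum>i\<in>I. ad x (f i))"
  by (simp add: ad_def sum_distrib_left sum_distrib_right sum_subtractf)

lemma ad_pow_scaleR: "(ad x ^^ m) (c *\<^sub>R y) = c *\<^sub>R (ad (x :: 'a::real_algebra) ^^ m) y"
  by (induction m) (simp_all add: ad_scaleR)

lemma ad_pow_sum: "(ad x ^^ m) (sum f I) = (\<Sum>i\<in>I. (ad x ^^ m) (f i))"
  by (induction m) (simp_all add: ad_sum)

text \<open>The part of degree \<open>k - 1\<close> in \<open>x\<close> of \<open>(\<Sum>m. ad\<^sub>x\<^sup>m y / (m + 1)!) exp x\<close>, the derivative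
  of \<open>exp\<close> at \<open>x\<close> in direction \<open>y\<close>.\<close>

definition dexp_term :: "nat \<Rightarrow> 'a::real_algebra_1 \<Rightarrow> 'a \<Rightarrow> 'a" where
  "dexp_term k x y = (\<Sum>m<k. ((ad x ^^ m) y /\<^sub>R fact (Suc m)) * (x ^ (k - 1 - m) /\<^sub>R fact (k - 1 - m)))"

text \<open>The product rule for x times \<open>x ^ k /\<^sub>R fact k\<close>. Moving the left
  factor \<open>x\<close> to the right uses \<open>x * a = ad x a + a * x\<close>, and the
  coefficients match by (k + 1) / ((m + 1)! (k - m)!) = 1 / (m! (k - m)!) + 1 / ((m + 1)! (k - 1 -
  m)!).\<close>

lemma dexp_term_Suc:
  fixes x y :: "'a::real_algebra_1"
  shows "y * (x ^ k /\<^sub>R fact k) + x * dexp_term k x y = real (Suc k) *\<^sub>R dexp_term (Suc k) x y"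
proof -
  define a where "a = (\<lambda>m. (ad x ^^ m) y)"
  have ax: "x * (a m * x ^ j) = a (Suc m) * x ^ j + a m * x ^ Suc j" for m j
  proof -
    have "a (Suc m) = x * a m - a m * x"
      by (simp add: a_def ad_def)
    then show ?thesis
      by (simp add: left_diff_distrib mult.assoc)
  qed
  define c where "c = (\<lambda>m j. inverse (fact m * fact j) :: real)"
  have 1: "x * dexp_term k x y = (\<Sum>m<k. c (Suc m) (k - 1 - m) *\<^sub>R (a (Suc m) * x ^ (k - 1 - m)))
      + (\<Sum>m<k. c (Suc m) (k - 1 - m) *\<^sub>R (a m * x ^ (k - m)))"
  proof -
    have "x * dexp_term k x y
        = (\<Sum>m<k. c (Suc m) (k - 1 - m) *\<^sub>R (x * (a m * x ^ (k - 1 - m))))"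
      by (simp add: dexp_term_def sum_distrib_left a_def c_def mult.commute)
    also have "\<dots> = (\<Sum>m<k. c (Suc m) (k - 1 - m) *\<^sub>R
        (a (Suc m) * x ^ (k - 1 - m) + a m * x ^ (k - m)))"
    proof (rule sum.cong[OF refl])
      fix m assume "m \<in> {..<k}"
      then have "Suc (k - 1 - m) = k - m" by auto
      then show "c (Suc m) (k - 1 - m) *\<^sub>R (x * (a m * x ^ (k - 1 - m))) =
          c (Suc m) (k - 1 - m) *\<^sub>R (a (Suc m) * x ^ (k - 1 - m) + a m * x ^ (k - m))"
        unfolding ax by simp
    qed
    finally show ?thesis
      by (simp add: scaleR_right_distrib sum.distrib)
  qed
  have 2: "real (Suc k) *\<^sub>R dexp_term (Suc k) x y
      = (\<Sum>m\<le>k. c m (k - m) *\<^sub>R (a m * x ^ (k - m)))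
      + (\<Sum>m<k. c (Suc m) (k - 1 - m) *\<^sub>R (a m * x ^ (k - m)))"
  proof -
    \<comment> \<open>At \<open>m = k\<close> the second fraction is absent, but natural subtraction
      would turn \<open>k - 1 - m\<close> into 0 and leave a nonzero value. Hence the case
      distinction.\<close>
    define b where "b = (\<lambda>m. if m < k then c (Suc m) (k - 1 - m) else 0)"
    have *: "real (Suc k) * c (Suc m) (k - m) = c m (k - m) + b m" if "m \<le> k" for m
    proof (cases "m = k")
      case True
      then show ?thesis by (simp add: c_def b_def del: of_nat_Suc)
    next
      case False
      with that obtain j where k: "k = Suc (m + j)"
        using less_imp_Suc_add le_neq_implies_less by metis
      \<comment> \<open>To be used with \<open>u = m + 1\<close>, \<open>v = j + 1\<close>,
        \<open>p = m!\<close> and \<open>q = j!\<close>, where \<open>k = m + j + 1\<close>.\<close>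
      have frac: "(u + v) * inverse ((u * p) * (v * q)) = inverse (p * (v * q)) + inverse ((u * p) * q)"
        if "u > 0" "v > 0" "p > 0" "q > 0" for u v p q :: real
        using that by (simp add: field_simps)
      have sum_eq: "real (Suc (Suc (m + j))) = real (Suc m) + real (Suc j)"
        by simp
      then show ?thesis
        using frac[of "real (Suc m)" "real (Suc j)" "fact m" "fact j"]
        by (simp add: c_def b_def k sum_eq del: of_nat_Suc)
    qed
    have "real (Suc k) *\<^sub>R dexp_term (Suc k) x y
        = (\<Sum>m\<le>k. (real (Suc k) * c (Suc m) (k - m)) *\<^sub>R (a m * x ^ (k - m)))"
      by (simp add: dexp_term_def scaleR_sum_right a_def c_def mult.commute lessThan_Suc_atMost
          del: of_nat_Suc sum.lessThan_Suc)
    also have "\<dots> = (\<Sum>m\<le>k. (c m (k - m) + b m) *\<^sub>R (a m * x ^ (k - m)))"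
      by (intro sum.cong refl) (simp only: atMost_iff *)
    also have "\<dots> = (\<Sum>m\<le>k. c m (k - m) *\<^sub>R (a m * x ^ (k - m)))
        + (\<Sum>m\<le>k. b m *\<^sub>R (a m * x ^ (k - m)))"
      by (simp add: scaleR_left_distrib sum.distrib)
    also have "(\<Sum>m\<le>k. b m *\<^sub>R (a m * x ^ (k - m))) = (\<Sum>m<k. b m *\<^sub>R (a m * x ^ (k - m)))"
      by (simp add: lessThan_Suc_atMost[symmetric] b_def)
    also have "\<dots> = (\<Sum>m<k. c (Suc m) (k - 1 - m) *\<^sub>R (a m * x ^ (k - m)))"
      by (simp add: b_def)
    finally show ?thesis .
  qed
  have "(\<Sum>m\<le>k. c m (k - m) *\<^sub>R (a m * x ^ (k - m)))
      = y * (x ^ k /\<^sub>R fact k) + (\<Sum>m<k. c (Suc m) (k - 1 - m) *\<^sub>R (a (Suc m) * x ^ (k - 1 - m)))"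
    by (simp add: sum.atMost_shift a_def c_def del: funpow.simps)
  then show ?thesis
    by (simp only: 1 2 add.assoc)
qed

text \<open>Differentiation is coefficientwise in the time variable. The cutoff \<open>N\<close> is
  there because the right-hand side of Magnus' equation will be a sum truncated at \<open>N\<close>,
  which is correct in degrees up to \<open>N\<close> only.\<close>

definition fps_has_derivative_upto ::
  "nat \<Rightarrow> (real \<Rightarrow> 'a::real_normed_algebra_1 fps) \<Rightarrow> 'a fps \<Rightarrow> real filter \<Rightarrow> bool" where
  "fps_has_derivative_upto N F F' net \<longleftrightarrow>
     (\<forall>n\<le>N. ((\<lambda>r. F r $ n) has_vector_derivative F' $ n) net)"

lemma fps_has_derivative_upto_mult:
  assumes "fps_has_derivative_upto N F F' (at r within D)"
    and "fps_has_derivative_upto N G G' (at r within D)"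
  shows "fps_has_derivative_upto N (\<lambda>r. F r * G r) (F' * G r + F r * G') (at r within D)"
  unfolding fps_has_derivative_upto_def
proof (intro allI impI)
  fix n assume "n \<le> N"
  then have "((\<lambda>r. \<Sum>i=0..n. F r $ i * G r $ (n - i)) has_vector_derivative
      (\<Sum>i=0..n. F r $ i * G' $ (n - i) + F' $ i * G r $ (n - i))) (at r within D)"
    using assms unfolding fps_has_derivative_upto_def
    by (intro has_vector_derivative_sum has_vector_derivative_mult) auto
  then show "((\<lambda>r. (F r * G r) $ n) has_vector_derivative (F' * G r + F r * G') $ n) (at r within D)"
    by (simp add: fps_mult_nth sum.distrib add.commute)
qed

lemma fps_has_derivative_upto_scaleR:
  "fps_has_derivative_upto N F F' net \<Longrightarrow>
    fps_has_derivative_upto N (\<lambda>r. c *\<^sub>R F r) (c *\<^sub>R F') net"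
  by (simp add: fps_has_derivative_upto_def
      bounded_linear.has_vector_derivative[OF bounded_linear_scaleR_right])

lemma fps_has_derivative_upto_sum:
  "(\<And>i. i \<in> I \<Longrightarrow> fps_has_derivative_upto N (F i) (F' i) net) \<Longrightarrow>
    fps_has_derivative_upto N (\<lambda>r. \<Sum>i\<in>I. F i r) (\<Sum>i\<in>I. F' i) net"
  unfolding fps_has_derivative_upto_def fps_sum_nth by (auto intro!: has_vector_derivative_sum)

lemma fps_has_derivative_upto_exp_term:
  assumes F: "fps_has_derivative_upto N F F' (at r within D)"
  shows "fps_has_derivative_upto N (\<lambda>r. F r ^ k /\<^sub>R fact k) (dexp_term k (F r) F') (at r within D)"
proof (induction k)
  case 0
  then show ?case
    by (simp add: fps_has_derivative_upto_def dexp_term_def)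
next
  case (Suc k)
  have "fps_has_derivative_upto N (\<lambda>r. (1 / real (Suc k)) *\<^sub>R (F r * (F r ^ k /\<^sub>R fact k)))
      ((1 / real (Suc k)) *\<^sub>R (F' * (F r ^ k /\<^sub>R fact k) + F r * dexp_term k (F r) F')) (at r within D)"
    by (intro fps_has_derivative_upto_scaleR fps_has_derivative_upto_mult F Suc.IH)
  moreover have "(1 / real (Suc k)) *\<^sub>R (F r * (F r ^ k /\<^sub>R fact k)) = F r ^ Suc k /\<^sub>R fact (Suc k)" for r
    by (simp add: field_simps)
  ultimately show ?case
    by (simp only: dexp_term_Suc) simp
qed

text \<open>Divisibility by the k-th power of the variable. Unlike a lower bound on
  \<open>subdegree\<close>, it holds for the zero series with every \<open>k\<close>.\<close>

definition fps_order_ge :: "nat \<Rightarrow> 'a::zero fps \<Rightarrow> bool" where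
  "fps_order_ge k F \<longleftrightarrow> (\<forall>n<k. F $ n = 0)"

lemma fps_order_ge_mult:
  assumes "fps_order_ge a F" "fps_order_ge b (G :: 'a::semiring_0 fps)"
  shows "fps_order_ge (a + b) (F * G)"
proof -
  have "F $ i * G $ (n - i) = 0" if "n < a + b" "i \<le> n" for n i
  proof -
    have "i < a \<or> n - i < b" using that by linarith
    then show ?thesis
      using assms by (auto simp: fps_order_ge_def)
  qed
  then show ?thesis
    by (simp add: fps_order_ge_def fps_mult_nth)
qed

lemma fps_order_ge_power:
  "fps_order_ge 1 F \<Longrightarrow> fps_order_ge k ((F :: 'a::semiring_1 fps) ^ k)"
proof (induction k)
  case (Suc k)
  then show ?case
    using fps_order_ge_mult[of 1 F k "F ^ k"] by simp
qed (simp add: fps_order_ge_def)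

text \<open>Each \<open>ad F\<close> raises the order by at least one. This is why sums over powers
  of \<open>ad F\<close> may be cut off at \<open>N\<close> without changing degrees up to
  \<open>N\<close>.\<close>

lemma fps_order_ge_ad_pow:
  assumes "fps_order_ge 1 F" "fps_order_ge 1 (G :: 'a::ring fps)"
  shows "fps_order_ge (Suc m) ((ad F ^^ m) G)"
proof (induction m)
  case (Suc m)
  then show ?case
    using fps_order_ge_mult[OF assms(1) Suc] fps_order_ge_mult[OF Suc assms(1)]
    by (simp add: ad_def fps_order_ge_def)
qed (use assms in simp)

lemma fps_order_ge_scaleR: "fps_order_ge k F \<Longrightarrow> fps_order_ge k (c *\<^sub>R F)"
  by (simp add: fps_order_ge_def)

text \<open>For positive \<open>n\<close> the recursion of \<open>bernoulli\<close> says that the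
  sum of \<open>(Suc n choose j) * bernoulli j\<close> over \<open>j \<le> n\<close> vanishes;
  dividing by \<open>fact (Suc n)\<close> gives the claim. These are the coefficients of x / (e^x -
  1) times (e^x - 1) / x.\<close>

lemma sum_bernoulli:
  "(\<Sum>j\<le>n. bernoulli j / (fact j * fact (Suc (n - j)))) = (if n = 0 then 1 else 0)"
proof (cases n)
  case (Suc m)
  have "(\<Sum>j\<le>n. real (Suc n choose j) * bernoulli j) = 0"
    by (simp add: Suc field_simps)
  moreover have "bernoulli j / (fact j * fact (Suc (n - j)))
      = (real (Suc n choose j) * bernoulli j) / fact (Suc n)" if "j \<le> n" for j
  proof -
    have "Suc n - j = Suc (n - j)" using that by simp
    then have "real (Suc n choose j) = fact (Suc n) / (fact j * fact (Suc (n - j)))"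
      using binomial_fact[of j "Suc n", where 'a = real] that by simp
    then show ?thesis
      by (simp del: fact_Suc)
  qed
  ultimately show ?thesis
    by (simp add: Suc sum_divide_distrib[symmetric] del: sum.atMost_Suc fact_Suc)
qed simp

text \<open>Magnus' equation inverts \<open>\<Omega>' \<mapsto> (\<Sum>m. ad\<^sub>\<Omega>\<^sup>m \<Omega>' / (m + 1)!)\<close>, because
  \<open>(\<Sum>j. B\<^sub>j x\<^sup>j / j!) (\<Sum>m. x\<^sup>m / (m + 1)!) = 1\<close>.\<close>

lemma dexp_inverse_upto:
  fixes F G :: "'a::real_algebra_1 fps"
  assumes F: "fps_order_ge 1 F" and G: "fps_order_ge 1 G" and "n \<le> N"
  defines "F' \<equiv> \<Sum>j\<le>N. (bernoulli j / fact j) *\<^sub>R (ad F ^^ j) G"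
  shows "(\<Sum>m\<le>N. (ad F ^^ m) F' /\<^sub>R fact (Suc m)) $ n = G $ n"
proof -
  have z: "(ad F ^^ m) G $ n = 0" if "n \<le> m" for m
    using fps_order_ge_ad_pow[OF F G, of m] that by (simp add: fps_order_ge_def)
  define g where "g = (\<lambda>m j. (bernoulli j / (fact j * fact (Suc m))) *\<^sub>R ((ad F ^^ (m + j)) G $ n))"
  have "(\<Sum>m\<le>N. (ad F ^^ m) F' /\<^sub>R fact (Suc m)) $ n = (\<Sum>m\<le>N. \<Sum>j\<le>N. g m j)"
    unfolding F'_def g_def
    by (simp add: ad_pow_sum ad_pow_scaleR fps_sum_nth scaleR_sum_right funpow_add o_def
        divide_inverse mult_ac del: fact_Suc)
  also have "\<dots> = (\<Sum>(m, j)\<in>{..N} \<times> {..N}. g m j)"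
    by (rule sum.cartesian_product)
  \<comment> \<open>Outside the triangle the total power of \<open>ad F\<close> exceeds
    \<open>N\<close>, so its coefficient of degree \<open>n\<close> is 0.\<close>
  also have "\<dots> = (\<Sum>(m, j)\<in>{(m, j). m + j \<le> N}. g m j)"
    by (rule sum.mono_neutral_right) (use \<open>n \<le> N\<close> in \<open>auto simp: g_def intro!: z\<close>)
  also have "\<dots> = (\<Sum>k\<le>N. \<Sum>m\<le>k. g m (k - m))"
    by (rule sum.triangle_reindex_eq)
  also have "\<dots> = (\<Sum>k\<le>N. (\<Sum>m\<le>k. bernoulli (k - m) / (fact (k - m) * fact (Suc m))) *\<^sub>R ((ad F ^^ k) G $ n))"
    by (intro sum.cong refl) (simp add: g_def scaleR_left.sum)
  also have "\<dots> = (\<Sum>k\<le>N. (if k = 0 then 1 else 0) *\<^sub>R ((ad F ^^ k) G $ n))"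
  proof (intro sum.cong refl arg_cong2[where f = scaleR])
    fix k
    have "(\<Sum>m\<le>k. bernoulli (k - m) / (fact (k - m) * fact (Suc m)))
        = (\<Sum>j\<le>k. bernoulli j / (fact j * fact (Suc (k - j))))"
      by (rule sum.reindex_bij_witness[of _ "\<lambda>j. k - j" "\<lambda>j. k - j"]) auto
    then show "(\<Sum>m\<le>k. bernoulli (k - m) / (fact (k - m) * fact (Suc m))) = (if k = 0 then 1 else 0 :: real)"
      by (simp only: sum_bernoulli)
  qed
  also have "\<dots> = G $ n"
  proof -
    have "(if k = 0 then 1 else 0) *\<^sub>R ((ad F ^^ k) G $ n) = (if k = 0 then G $ n else 0)" for k
      by simp
    then show ?thesis
      by (simp only: sum.delta finite_atMost) simp
  qed
  finally show ?thesis .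
qed

text \<open>The Cauchy product of the two factors of the derivative of \<open>exp\<close>, regrouped
  by total degree. The term with indices \<open>m\<close> and \<open>j\<close> has order at least
  \<open>m + 1 + j\<close>, so the terms by which the truncations differ vanish in degree
  \<open>n\<close>.\<close>

lemma sum_dexp_term:
  fixes F G :: "'a::real_algebra_1 fps"
  assumes F: "fps_order_ge 1 F" and G: "fps_order_ge 1 G" and "n \<le> N"
  shows "(\<Sum>k\<le>N. dexp_term k F G) $ n
    = ((\<Sum>m\<le>N. (ad F ^^ m) G /\<^sub>R fact (Suc m)) * (\<Sum>j\<le>N. F ^ j /\<^sub>R fact j)) $ n"
proof -
  define g where "g = (\<lambda>m j. (((ad F ^^ m) G /\<^sub>R fact (Suc m)) * (F ^ j /\<^sub>R fact j)) $ n)"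
  have z: "g m j = 0" if "n \<le> m + j" for m j
    using fps_order_ge_mult[OF fps_order_ge_scaleR[OF fps_order_ge_ad_pow[OF F G, of m], of "inverse (fact (Suc m))"]
        fps_order_ge_scaleR[OF fps_order_ge_power[OF F, of j], of "inverse (fact j)"]] that
    unfolding g_def fps_order_ge_def by simp
  have "(\<Sum>k\<le>N. dexp_term k F G) $ n = (\<Sum>k\<le>N. \<Sum>m<k. g m (k - 1 - m))"
    by (simp add: dexp_term_def g_def fps_sum_nth)
  also have "\<dots> = (\<Sum>k<N. \<Sum>m\<le>k. g m (k - m))"
    by (cases N) (simp_all add: sum.atMost_Suc_shift lessThan_Suc_atMost del: sum.atMost_Suc sum.lessThan_Suc)
  also have "\<dots> = (\<Sum>(m, j)\<in>{(m, j). m + j < N}. g m j)"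
    by (rule sum.triangle_reindex[symmetric])
  also have "\<dots> = (\<Sum>(m, j)\<in>{..N} \<times> {..N}. g m j)"
    by (rule sum.mono_neutral_left) (use \<open>n \<le> N\<close> in \<open>auto intro!: z\<close>)
  also have "\<dots> = (\<Sum>m\<le>N. \<Sum>j\<le>N. g m j)"
    by (rule sum.cartesian_product[symmetric])
  also have "\<dots> = ((\<Sum>m\<le>N. (ad F ^^ m) G /\<^sub>R fact (Suc m)) * (\<Sum>j\<le>N. F ^ j /\<^sub>R fact j)) $ n"
    by (simp add: g_def sum_product fps_sum_nth del: fact_Suc)
  finally show ?thesis .
qed

lemma fps_mult_nth_cong:
  "(\<And>i. i \<le> n \<Longrightarrow> F $ i = F' $ i) \<Longrightarrow> (F * G) $ n = (F' * G) $ n"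
  by (simp add: fps_mult_nth)

text \<open>Inserting Magnus' right-hand side into the derivative of \<open>exp\<close> cancels the
  Bernoulli factor and leaves \<open>a\<close> times the formal variable times the exponential. The
  formal variable accounts for the shift from degree \<open>n\<close> to
  \<open>Suc n\<close>.\<close>

lemma magnus_equation_exp_derivative:
  fixes F :: "real \<Rightarrow> 'a::real_normed_algebra_1 fps"
  assumes F0: "F r $ 0 = 0"
    and dF: "fps_has_derivative_upto N F
      (\<Sum>j\<le>N. (bernoulli j / fact j) *\<^sub>R (ad (F r) ^^ j) (fps_const a * fps_X)) (at r within D)"
    and "Suc n \<le> N"
  shows "((\<lambda>r. (\<Sum>k\<le>N. F r ^ k /\<^sub>R fact k) $ Suc n) has_vector_derivative
    a * (\<Sum>k\<le>N. F r ^ k /\<^sub>R fact k) $ n) (at r within D)"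
proof -
  define F' where "F' = (\<Sum>j\<le>N. (bernoulli j / fact j) *\<^sub>R (ad (F r) ^^ j) (fps_const a * fps_X))"
  have F1: "fps_order_ge 1 (F r)" and X1: "fps_order_ge 1 (fps_const a * fps_X)"
    using F0 by (simp_all add: fps_order_ge_def)
  have F'1: "fps_order_ge 1 F'"
    using fps_order_ge_ad_pow[OF F1 X1] by (simp add: F'_def fps_order_ge_def fps_sum_nth)
  have "fps_has_derivative_upto N (\<lambda>r. \<Sum>k\<le>N. F r ^ k /\<^sub>R fact k) (\<Sum>k\<le>N. dexp_term k (F r) F')
      (at r within D)"
    using dF unfolding F'_def[symmetric]
    by (intro fps_has_derivative_upto_sum fps_has_derivative_upto_exp_term)
  then have "((\<lambda>r. (\<Sum>k\<le>N. F r ^ k /\<^sub>R fact k) $ Suc n) has_vector_derivative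
      (\<Sum>k\<le>N. dexp_term k (F r) F') $ Suc n) (at r within D)"
    using \<open>Suc n \<le> N\<close> unfolding fps_has_derivative_upto_def by blast
  moreover have "(\<Sum>k\<le>N. dexp_term k (F r) F') $ Suc n
      = (fps_const a * fps_X * (\<Sum>j\<le>N. F r ^ j /\<^sub>R fact j)) $ Suc n"
    unfolding sum_dexp_term[OF F1 F'1 \<open>Suc n \<le> N\<close>]
    unfolding F'_def using \<open>Suc n \<le> N\<close>
    by (intro fps_mult_nth_cong dexp_inverse_upto[OF F1 X1]) simp
  moreover have "(fps_const a * fps_X * (\<Sum>j\<le>N. F r ^ j /\<^sub>R fact j)) $ Suc n
      = a * (\<Sum>k\<le>N. F r ^ k /\<^sub>R fact k) $ n"
    by (simp add: mult.assoc)
  ultimately show ?thesis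
    by (simp only:)
qed

section \<open>The Magnus terms as coefficients of a formal power series\<close>

declare magnus_term.simps [simp del]

lemma commutator_0 [simp]: "commutator A 0 = 0" "commutator 0 A = 0"
  by (simp_all add: commutator_def)

lemma bounded_bilinear_matrix_mult:
  "bounded_bilinear ((**) :: real ^ 'n ^ 'n \<Rightarrow> real ^ 'n ^ 'n \<Rightarrow> real ^ 'n ^ 'n)"
proof -
  have "bilinear ((**) :: real ^ 'n ^ 'n \<Rightarrow> real ^ 'n ^ 'n \<Rightarrow> real ^ 'n ^ 'n)"
    unfolding bilinear_def
    by (auto intro!: linearI simp: matrix_add_ldistrib matrix_matrix_mult_def vec_eq_iff
        sum.distrib distrib_left distrib_right scaleR_sum_right mult_ac sum_distrib_left)
  then show ?thesis
    by (simp add: bilinear_conv_bounded_bilinear)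
qed

lemmas continuous_on_matrix_mult [continuous_intros] =
  bounded_bilinear.continuous_on[OF bounded_bilinear_matrix_mult]

lemma continuous_on_commutator [continuous_intros]:
  "continuous_on D f \<Longrightarrow> continuous_on D g \<Longrightarrow> continuous_on D (\<lambda>r. commutator (f r) (g r))"
  unfolding commutator_def by (intro continuous_intros)

lemma cmat_of_real_commutator:
  "cmat_of_real (commutator A B) = ad (cmat_of_real A) (cmat_of_real B)"
  by (simp add: commutator_def ad_def cmat_of_real_diff cmat_of_real_mult)

lemma magnus_ad_eq_0: "n \<le> j \<Longrightarrow> magnus_ad A j n r = 0"
proof (induction j arbitrary: n)
  case (Suc j)
  then have "magnus_ad A j (n - m) r = 0" if "m \<in> {1..<n}" for m
    using that by auto
  then show ?case
    by simp
qed simp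

lemma magnus_term_0 [simp]: "magnus_term A 0 r = 0"
  by (simp add: magnus_term.simps)

lemma magnus_term_at_0 [simp]: "magnus_term A n 0 = 0"
  by (simp add: magnus_term.simps)

lemma continuous_on_magnus:
  assumes A: "continuous_on {0..R} A"
  shows "continuous_on {0..R} (magnus_ad A j n)" "continuous_on {0..R} (magnus_term A n)"
proof -
  have "(\<forall>j. continuous_on {0..R} (magnus_ad A j n)) \<and> continuous_on {0..R} (magnus_term A n)" for n
  proof (induction n rule: less_induct)
    case (less n)
    have ad: "continuous_on {0..R} (magnus_ad A j n)" for j
    proof (cases j)
      case 0
      then show ?thesis
        using A by (cases "n = 1") simp_all
    next
      case (Suc i)
      have "continuous_on {0..R} (\<lambda>r. \<Sum>m\<in>{1..<n}. commutator (magnus_term A m r) (magnus_ad A i (n - m) r))"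
        using less by (intro continuous_intros) auto
      then show ?thesis
        by (simp add: Suc)
    qed
    have "continuous_on {0..R} (\<lambda>r. \<Sum>j<n. (bernoulli j / fact j) *\<^sub>R integral {0..r} (magnus_ad A j n))"
      by (intro continuous_intros indefinite_integral_continuous_1 integrable_continuous_real ad)
    then show ?case
      using ad by (simp add: magnus_term.simps[abs_def])
  qed
  then show "continuous_on {0..R} (magnus_ad A j n)" "continuous_on {0..R} (magnus_term A n)"
    by blast+
qed

lemma magnus_term_has_derivative:
  assumes A: "continuous_on {0..R} A" and r: "r \<in> {0..R}"
  shows "(magnus_term A n has_vector_derivative
    (\<Sum>j<n. (bernoulli j / fact j) *\<^sub>R magnus_ad A j n r)) (at r within {0..R})"
  unfolding magnus_term.simps[abs_def]
  by (intro has_vector_derivative_sum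
      bounded_linear.has_vector_derivative[OF bounded_linear_scaleR_right]
      integral_has_vector_derivative continuous_on_magnus A r)

text \<open>The increments of Picard iteration for U' = A U, U(0) = 1. The n-th one is homogeneous
  of degree n in A and is thus the coefficient of the n-th power of the deformation
  parameter.\<close>

primrec dyson :: "(real \<Rightarrow> 'a::real_normed_algebra_1) \<Rightarrow> nat \<Rightarrow> real \<Rightarrow> 'a" where
  "dyson A 0 r = 1"
| "dyson A (Suc n) r = integral {0..r} (\<lambda>q. A q * dyson A n q)"

definition magnus_fps :: "(real \<Rightarrow> real ^ 'n ^ 'n) \<Rightarrow> real \<Rightarrow> 'n::finite cmat fps" where
  "magnus_fps A r = Abs_fps (\<lambda>n. cmat_of_real (magnus_term A n r))"

lemma magnus_fps_nth [simp]: "magnus_fps A r $ n = cmat_of_real (magnus_term A n r)"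
  by (simp add: magnus_fps_def)

text \<open>The recursion of \<open>magnus_ad\<close> is the Cauchy product formula for a commutator
  of power series, so the order in A is tracked by the degree in the formal variable.\<close>

lemma ad_pow_magnus_fps:
  "(ad (magnus_fps A r) ^^ j) (fps_const (cmat_of_real (A r)) * fps_X) $ n
    = cmat_of_real (magnus_ad A j n r)"
proof (induction j arbitrary: n)
  case 0
  then show ?case
    by (cases "n = 1") (auto simp: fps_X_def)
next
  case (Suc j)
  define G where "G = (ad (magnus_fps A r) ^^ j) (fps_const (cmat_of_real (A r)) * fps_X)"
  have G: "G $ n = cmat_of_real (magnus_ad A j n r)" for n
    by (simp add: G_def Suc.IH)
  have "ad (magnus_fps A r) G $ n
      = (\<Sum>m=0..n. ad (magnus_fps A r $ m) (G $ (n - m)))"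
  proof -
    have "(G * magnus_fps A r) $ n = (\<Sum>m=0..n. G $ (n - m) * magnus_fps A r $ m)"
      unfolding fps_mult_nth by (rule sum.reindex_bij_witness[of _ "\<lambda>m. n - m" "\<lambda>m. n - m"]) auto
    then show ?thesis
      by (simp add: ad_def fps_mult_nth sum_subtractf)
  qed
  also have "\<dots> = cmat_of_real (\<Sum>m=0..n. commutator (magnus_term A m r) (magnus_ad A j (n - m) r))"
    by (simp add: G cmat_of_real_commutator cmat_of_real_sum)
  \<comment> \<open>The extra summands vanish: at \<open>m = 0\<close> the Magnus term is 0, and at
    \<open>m = n\<close> the order of \<open>magnus_ad\<close> is 0.\<close>
  also have "(\<Sum>m=0..n. commutator (magnus_term A m r) (magnus_ad A j (n - m) r)) = magnus_ad A (Suc j) n r"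
    unfolding magnus_ad.simps(2)
    by (rule sum.mono_neutral_right) (auto simp: magnus_ad_eq_0 not_le)
  finally show ?case
    by (simp add: G_def)
qed

text \<open>Coefficient \<open>Suc n\<close> of the formal exponential has derivative
  \<open>A\<close> times coefficient \<open>n\<close> and is 0 at time 0. Integrating gives the
  recursion of \<open>dyson\<close>.\<close>

lemma exp_magnus_fps_nth:
  fixes A :: "real \<Rightarrow> real ^ 'n ^ 'n"
  assumes A: "continuous_on {0..R} A" and "r \<in> {0..R}" "n \<le> N"
  shows "(\<Sum>k\<le>N. magnus_fps A r ^ k /\<^sub>R fact k) $ n = dyson (\<lambda>r. cmat_of_real (A r)) n r"
  using \<open>r \<in> {0..R}\<close> \<open>n \<le> N\<close>
proof (induction n arbitrary: r)
  case 0
  have "(magnus_fps A r ^ k /\<^sub>R fact k) $ 0 = (if k = 0 then 1 else 0)" for k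
    using fps_order_ge_power[of "magnus_fps A r" k] by (simp add: fps_order_ge_def)
  then show ?case
    by (simp add: fps_sum_nth)
next
  case (Suc n)
  define V where "V = (\<lambda>n r. (\<Sum>k\<le>N. magnus_fps A r ^ k /\<^sub>R fact k) $ n)"
  have dV: "(V (Suc n) has_vector_derivative cmat_of_real (A q) * V n q) (at q within {0..R})"
    if q: "q \<in> {0..R}" for q
    unfolding V_def
  proof (rule magnus_equation_exp_derivative)
    show "magnus_fps A q $ 0 = 0" by simp
    show "Suc n \<le> N" by fact
    show "fps_has_derivative_upto N (magnus_fps A)
       (\<Sum>j\<le>N. (bernoulli j / fact j) *\<^sub>R
          (ad (magnus_fps A q) ^^ j) (fps_const (cmat_of_real (A q)) * fps_X)) (at q within {0..R})"
      unfolding fps_has_derivative_upto_def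
    proof (intro allI impI)
      fix i assume "i \<le> N"
      have "((\<lambda>r. magnus_fps A r $ i) has_vector_derivative
          cmat_of_real (\<Sum>j<i. (bernoulli j / fact j) *\<^sub>R magnus_ad A j i q)) (at q within {0..R})"
        unfolding magnus_fps_nth
        by (rule bounded_linear.has_vector_derivative[OF bounded_linear_cmat_of_real
              magnus_term_has_derivative[OF A q]])
      moreover have "(\<Sum>j<i. (bernoulli j / fact j) *\<^sub>R magnus_ad A j i q)
          = (\<Sum>j\<le>N. (bernoulli j / fact j) *\<^sub>R magnus_ad A j i q)"
        by (rule sum.mono_neutral_left) (use \<open>i \<le> N\<close> in \<open>auto simp: magnus_ad_eq_0\<close>)
      ultimately show "((\<lambda>r. magnus_fps A r $ i) has_vector_derivative (\<Sum>j\<le>N. (bernoulli j / fact j) *\<^sub>R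
          (ad (magnus_fps A q) ^^ j) (fps_const (cmat_of_real (A q)) * fps_X)) $ i) (at q within {0..R})"
        by (simp add: fps_sum_nth ad_pow_magnus_fps cmat_of_real_sum cmat_of_real_scaleR)
    qed
  qed
  have "magnus_fps A 0 = 0"
    by (simp add: fps_eq_iff)
  then have V0: "V (Suc n) 0 = 0"
    by (simp add: V_def power_0_left fps_sum_nth if_distrib if_distribR cong: if_cong)
  have "((\<lambda>q. cmat_of_real (A q) * V n q) has_integral V (Suc n) r - V (Suc n) 0) {0..r}"
  proof (rule fundamental_theorem_of_calculus)
    show "0 \<le> r" using Suc.prems by simp
    fix q assume "q \<in> {0..r}"
    then show "(V (Suc n) has_vector_derivative cmat_of_real (A q) * V n q) (at q within {0..r})"
      using Suc.prems by (intro has_vector_derivative_within_subset[OF dV]) auto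
  qed
  then have "V (Suc n) r = integral {0..r} (\<lambda>q. cmat_of_real (A q) * V n q)"
    by (simp add: V0 integral_unique)
  also have "\<dots> = integral {0..r} (\<lambda>q. cmat_of_real (A q) * dyson (\<lambda>r. cmat_of_real (A r)) n q)"
    using Suc by (intro integral_cong) (auto simp: V_def)
  finally show ?case
    by (simp add: V_def)
qed

section \<open>Solutions of linear differential equations\<close>

text \<open>Stated for an arbitrary sequence obeying the recursion, because it is applied both to
  the Dyson terms themselves and to the remainders of their partial sums.\<close>

lemma iterated_integral_bound:
  fixes A :: "real \<Rightarrow> 'a::{real_normed_algebra_1,banach}"
  assumes A: "continuous_on {0..R} A" and K: "\<And>r. r \<in> {0..R} \<Longrightarrow> norm (A r) \<le> K"
    and f: "\<And>n. continuous_on {0..R} (f n)" and C: "\<And>r. r \<in> {0..R} \<Longrightarrow> norm (f 0 r) \<le> C"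
    and step: "\<And>n r. r \<in> {0..R} \<Longrightarrow> f (Suc n) r = integral {0..r} (\<lambda>q. A q * f n q)"
    and "r \<in> {0..R}"
  shows "norm (f n r) \<le> C * (K * r) ^ n / fact n"
  using \<open>r \<in> {0..R}\<close>
proof (induction n arbitrary: r)
  case 0
  then show ?case using C by simp
next
  case (Suc n)
  have "0 \<le> K"
    using K[OF Suc.prems] norm_ge_zero order_trans by blast
  have sub: "{0..r} \<subseteq> {0..R}" using Suc.prems by auto
  have "((\<lambda>q. K * (C * (K * q) ^ n / fact n)) has_integral
      (C * (K * r) ^ Suc n / fact (Suc n) - C * (K * 0) ^ Suc n / fact (Suc n))) {0..r}"
  proof (rule fundamental_theorem_of_calculus)
    show "0 \<le> r" using Suc.prems by simp
    fix q
    have *: "real (Suc n) / fact (Suc n) = 1 / fact n"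
      by (simp add: divide_simps)
    have "((\<lambda>q. C * (K * q) ^ Suc n / fact (Suc n)) has_real_derivative
        (real (Suc n) / fact (Suc n)) * K * (C * (K * q) ^ n)) (at q within {0..r})"
      by (auto intro!: derivative_eq_intros simp del: fact_Suc power_Suc of_nat_Suc)
    then show "((\<lambda>q. C * (K * q) ^ Suc n / fact (Suc n)) has_vector_derivative
        K * (C * (K * q) ^ n / fact n)) (at q within {0..r})"
      unfolding * by (simp add: has_real_derivative_iff_has_vector_derivative)
  qed
  then have int: "((\<lambda>q. K * (C * (K * q) ^ n / fact n)) has_integral
      (C * (K * r) ^ Suc n / fact (Suc n))) {0..r}"
    by simp
  have "norm (integral {0..r} (\<lambda>q. A q * f n q)) \<le> integral {0..r} (\<lambda>q. K * (C * (K * q) ^ n / fact n))"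
  proof (rule integral_norm_bound_integral)
    show "(\<lambda>q. A q * f n q) integrable_on {0..r}"
      by (intro integrable_continuous_real continuous_intros continuous_on_subset[OF A sub]
          continuous_on_subset[OF f sub])
    show "(\<lambda>q. K * (C * (K * q) ^ n / fact n)) integrable_on {0..r}"
      using int by blast
    fix q assume "q \<in> {0..r}"
    then have q: "q \<in> {0..R}" using sub by blast
    show "norm (A q * f n q) \<le> K * (C * (K * q) ^ n / fact n)"
      using mult_mono[OF K[OF q] Suc.IH[OF q] \<open>0 \<le> K\<close> norm_ge_zero] norm_mult_ineq order_trans
      by blast
  qed
  then show ?case
    unfolding step[OF Suc.prems] integral_unique[OF int] .
qed

lemma continuous_on_dyson:
  fixes A :: "real \<Rightarrow> 'a::{real_normed_algebra_1,banach}"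
  assumes A: "continuous_on {0..R} A"
  shows "continuous_on {0..R} (dyson A n)"
proof (induction n)
  case (Suc n)
  have "continuous_on {0..R} (\<lambda>r. integral {0..r} (\<lambda>q. A q * dyson A n q))"
    by (intro indefinite_integral_continuous_1 integrable_continuous_real continuous_intros A Suc)
  then show ?case
    by (simp add: continuous_on_cong[of "{0..R}" "{0..R}" "dyson A (Suc n)"])
qed (simp add: continuous_on_cong[of "{0..R}" "{0..R}" "dyson A 0" "\<lambda>_. 1"])

lemma continuous_on_norm_bound:
  fixes A :: "real \<Rightarrow> 'a::real_normed_vector"
  assumes "continuous_on {0..R} A"
  obtains K where "\<And>r. r \<in> {0..R} \<Longrightarrow> norm (A r) \<le> K"
proof -
  have "bounded (A ` {0..R})"
    by (intro compact_imp_bounded compact_continuous_image assms) simp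
  then show ?thesis
    using that unfolding bounded_iff by blast
qed

lemma power_over_fact_tendsto_0: "(\<lambda>n. C * x ^ n / fact n) \<longlonglongrightarrow> (0::real)"
  using tendsto_mult_left[OF summable_LIMSEQ_zero[OF summable_exp_generic[of x]], of C]
  by (simp add: divide_inverse mult_ac)

text \<open>The differences between \<open>U\<close> and the partial sums obey the Dyson recursion
  with starting function \<open>U\<close>, and so tend to 0 factorially. In particular the integral
  equation has at most one continuous solution.\<close>

lemma dyson_sums_solution:
  fixes A :: "real \<Rightarrow> 'a::{real_normed_algebra_1,banach}"
  assumes A: "continuous_on {0..R} A" and U: "continuous_on {0..R} U"
    and eq: "\<And>r. r \<in> {0..R} \<Longrightarrow> U r = 1 + integral {0..r} (\<lambda>q. A q * U q)"
    and r: "r \<in> {0..R}"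
  shows "(\<lambda>n. dyson A n r) sums U r"
proof -
  define f where "f = (\<lambda>n r. U r - (\<Sum>i<n. dyson A i r))"
  obtain K where K: "\<And>r. r \<in> {0..R} \<Longrightarrow> norm (A r) \<le> K"
    using continuous_on_norm_bound[OF A] by blast
  obtain C where C: "\<And>r. r \<in> {0..R} \<Longrightarrow> norm (U r) \<le> C"
    using continuous_on_norm_bound[OF U] by blast
  have bound: "norm (f n r) \<le> C * (K * r) ^ n / fact n" for n
  proof (rule iterated_integral_bound[OF A K _ _ _ r])
    show "continuous_on {0..R} (f n)" for n
      unfolding f_def by (intro continuous_intros U continuous_on_dyson A)
    show "norm (f 0 r) \<le> C" if "r \<in> {0..R}" for r
      using C[OF that] by (simp add: f_def)
    fix n r assume r: "r \<in> {0..R}"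
    then have sub: "{0..r} \<subseteq> {0..R}" by auto
    have iU: "(\<lambda>q. A q * U q) integrable_on {0..r}"
      and iD: "(\<lambda>q. A q * dyson A i q) integrable_on {0..r}" for i
      by (intro integrable_continuous_real continuous_intros continuous_on_subset[OF A sub]
          continuous_on_subset[OF U sub] continuous_on_subset[OF continuous_on_dyson[OF A] sub])+
    have "integral {0..r} (\<lambda>q. A q * f n q)
        = integral {0..r} (\<lambda>q. A q * U q) - (\<Sum>i<n. integral {0..r} (\<lambda>q. A q * dyson A i q))"
      by (simp add: f_def right_diff_distrib sum_distrib_left integral_diff iU iD integrable_sum
          integral_sum)
    also have "\<dots> = f (Suc n) r"
      unfolding f_def sum.lessThan_Suc_shift by (simp add: eq[OF r])
    finally show "f (Suc n) r = integral {0..r} (\<lambda>q. A q * f n q)" ..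
  qed
  have "(\<lambda>n. U r - (\<Sum>i<n. dyson A i r)) \<longlonglongrightarrow> 0"
    by (rule Lim_null_comparison[OF _ power_over_fact_tendsto_0[of C "K * r"]])
      (use bound in \<open>auto simp: f_def\<close>)
  from tendsto_diff[OF tendsto_const[of "U r"] this] show ?thesis
    by (simp add: sums_def)
qed

text \<open>The factorial bound makes the Dyson series converge uniformly. Its sum satisfies the
  integral equation as a limit under the integral, and is therefore differentiable.\<close>

lemma solution_exists:
  fixes A :: "real \<Rightarrow> 'a::{real_normed_algebra_1,banach}"
  assumes A: "continuous_on {0..R} A"
  obtains U where "\<And>r. r \<in> {0..R} \<Longrightarrow> (\<lambda>n. dyson A n r) sums U r"
    "\<And>r. r \<in> {0..R} \<Longrightarrow> (U has_vector_derivative A r * U r) (at r within {0..R})"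
    "U 0 = 1"
proof -
  define U where "U = (\<lambda>r. if 0 \<le> r then \<Sum>n. dyson A n r else 1)"
  obtain K where K: "\<And>r. r \<in> {0..R} \<Longrightarrow> norm (A r) \<le> K"
    using continuous_on_norm_bound[OF A] by blast
  have bound: "norm (dyson A n r) \<le> (\<bar>K\<bar> * R) ^ n / fact n" if r: "r \<in> {0..R}" for n r
  proof -
    have "norm (dyson A n r) \<le> 1 * (\<bar>K\<bar> * r) ^ n / fact n"
      by (rule iterated_integral_bound[OF A _ continuous_on_dyson[OF A] _ _ r])
        (use K in \<open>auto intro: order_trans[OF K]\<close>)
    also have "\<dots> \<le> (\<bar>K\<bar> * R) ^ n / fact n"
      using r by (auto intro!: divide_right_mono power_mono mult_left_mono)
    finally show ?thesis .
  qed
  have summ: "summable (\<lambda>n. (\<bar>K\<bar> * R) ^ n / fact n)"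
    using summable_exp_generic[of "\<bar>K\<bar> * R"] by (simp add: divide_inverse mult.commute)
  have unif: "uniform_limit {0..R} (\<lambda>N r. \<Sum>n<N. dyson A n r) U sequentially"
  proof -
    have "uniform_limit {0..R} (\<lambda>N r. \<Sum>n<N. dyson A n r) (\<lambda>r. \<Sum>n. dyson A n r) sequentially"
      by (rule Weierstrass_m_test[OF bound summ])
    then show ?thesis
      by (rule uniform_limit_cong'[THEN iffD1, rotated -1]) (auto simp: U_def)
  qed
  have sums: "(\<lambda>n. dyson A n r) sums U r" if "r \<in> {0..R}" for r
    using tendsto_uniform_limitI[OF unif that] by (simp add: sums_def)
  have U: "continuous_on {0..R} U"
    by (rule uniform_limit_theorem[OF _ unif])
      (auto intro!: always_eventually continuous_intros continuous_on_dyson A)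
  have eq: "U r = 1 + integral {0..r} (\<lambda>q. A q * U q)" if r: "r \<in> {0..R}" for r
  proof -
    have sub: "{0..r} \<subseteq> {0..R}" using r by auto
    have unif_r: "uniform_limit {0..r} (\<lambda>N q. A q * (\<Sum>n<N. dyson A n q)) (\<lambda>q. A q * U q) sequentially"
    proof (rule uniform_lim_mult)
      show "uniform_limit {0..r} (\<lambda>_. A) A sequentially"
        by (rule uniform_limit_const)
      show "uniform_limit {0..r} (\<lambda>N q. \<Sum>n<N. dyson A n q) U sequentially"
        by (rule uniform_limit_on_subset[OF unif sub])
      show "bounded (A ` {0..r})" "bounded (U ` {0..r})"
        by (intro compact_imp_bounded compact_continuous_image
            continuous_on_subset[OF A sub] continuous_on_subset[OF U sub] compact_Icc)+
    qed
    have cont: "continuous_on {0..r} (\<lambda>q. A q * (\<Sum>n<N. dyson A n q))" for N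
      by (intro continuous_intros continuous_on_subset[OF A sub]
          continuous_on_subset[OF continuous_on_dyson[OF A] sub])
    obtain I J where I: "\<And>N. ((\<lambda>q. A q * (\<Sum>n<N. dyson A n q)) has_integral I N) {0..r}"
      and J: "((\<lambda>q. A q * U q) has_integral J) {0..r}" and IJ: "I \<longlonglongrightarrow> J"
      by (rule uniform_limit_integral[OF unif_r cont]) auto
    \<comment> \<open>Integrating the first \<open>N\<close> terms against \<open>A\<close> yields
      the terms with indices 1 to \<open>N\<close>, that is the next partial sum without its leading
      1.\<close>
    have "I N = (\<Sum>n<Suc N. dyson A n r) - 1" for N
    proof -
      have "(\<lambda>q. A q * dyson A i q) integrable_on {0..r}" for i
        by (intro integrable_continuous_real continuous_intros continuous_on_subset[OF A sub]
            continuous_on_subset[OF continuous_on_dyson[OF A] sub])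
      then have "I N = (\<Sum>n<N. integral {0..r} (\<lambda>q. A q * dyson A n q))"
        using integral_unique[OF I[of N]] by (simp add: sum_distrib_left integral_sum)
      then show ?thesis
        unfolding sum.lessThan_Suc_shift by simp
    qed
    moreover have "(\<lambda>N. (\<Sum>n<Suc N. dyson A n r) - 1) \<longlonglongrightarrow> U r - 1"
      using sums[OF r] unfolding sums_def by (intro tendsto_diff tendsto_const) (rule LIMSEQ_Suc)
    ultimately have "J = U r - 1"
      using IJ LIMSEQ_unique by (metis (no_types, lifting) ext)
    then show ?thesis
      using J by (simp add: integral_unique)
  qed
  have "(U has_vector_derivative A r * U r) (at r within {0..R})" if r: "r \<in> {0..R}" for r
  proof -
    have "((\<lambda>r. integral {0..r} (\<lambda>q. A q * U q)) has_vector_derivative A r * U r) (at r within {0..R})"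
      by (rule integral_has_vector_derivative[OF _ r]) (intro continuous_intros A U)
    then have "((\<lambda>r. 1 + integral {0..r} (\<lambda>q. A q * U q)) has_vector_derivative A r * U r) (at r within {0..R})"
      by (auto intro!: derivative_eq_intros)
    then show ?thesis
      by (rule has_vector_derivative_transform[OF r, rotated]) (simp add: eq)
  qed
  moreover have "U 0 = 1"
  proof -
    have "dyson A n 0 = (if n = 0 then 1 else 0)" for n
      by (cases n) auto
    then show ?thesis
      using sums_unique[OF sums_single[of 0 "\<lambda>_. 1 :: 'a"]] by (simp add: U_def)
  qed
  ultimately show ?thesis
    using that sums by blast
qed

text \<open>Homogeneity of the Dyson terms; the scalar can be pulled out because it is central. This
  makes the solution of the deformed equation a power series in \<open>z\<close>.\<close>

lemma dyson_cscalar: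
  "r \<in> {0..R} \<Longrightarrow> continuous_on {0..R} A \<Longrightarrow>
    dyson (\<lambda>q. cscalar z * A q) n r = cscalar z ^ n * dyson A n r"
proof (induction n arbitrary: r)
  case (Suc n)
  have "{0..r} \<subseteq> {0..R}" using Suc.prems by auto
  then have i: "(\<lambda>q. A q * dyson A n q) integrable_on {0..r}"
    using Suc.prems by (intro integrable_continuous_real continuous_intros
        continuous_on_subset[OF _ \<open>{0..r} \<subseteq> {0..R}\<close>] continuous_on_dyson)
  have comm: "A q * (cscalar z ^ n * X) = cscalar z ^ n * (A q * X)" for q X
    by (simp add: cscalar_power[symmetric] mult.assoc[symmetric] cscalar_commute[of _ "A q"])
  have "dyson (\<lambda>q. cscalar z * A q) (Suc n) r
      = integral {0..r} (\<lambda>q. cscalar z ^ Suc n * (A q * dyson A n q))"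
    using Suc \<open>{0..r} \<subseteq> {0..R}\<close> by (auto intro!: integral_cong simp: mult.assoc comm subset_iff)
  also have "\<dots> = cscalar z ^ Suc n * dyson A (Suc n) r"
    using integral_linear[OF i bounded_linear_mult_right[of "cscalar z ^ Suc n"]] by (simp add: o_def)
  finally show ?case .
qed simp

text \<open>A kernel vector \<open>x\<close> of the matrix would satisfy \<open>U R\<close> x = -
  ((1 - \<tau>) / \<tau>) x with \<tau> nonzero. The solution \<open>U r\<close> applied to
  \<open>x\<close> would then end in a nonpositive multiple of its initial value, which the angle
  estimate excludes.\<close>

lemma det_segment_nonzero:
  fixes A U :: "real \<Rightarrow> 'n::finite cmat"
  assumes R: "0 \<le> R" and a: "continuous_on {0..R} a"
    and Aa: "\<And>r. r \<in> {0..R} \<Longrightarrow> norm (A r) \<le> a r"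
    and pi: "integral {0..R} a < pi"
    and dU: "\<And>r. r \<in> {0..R} \<Longrightarrow> (U has_vector_derivative A r * U r) (at r within {0..R})"
    and U0: "U 0 = 1"
    and \<tau>: "0 \<le> \<tau>" "\<tau> \<le> 1"
  shows "det (mat_of (1 + \<tau> *\<^sub>R (U R - 1))) \<noteq> 0"
proof
  assume "det (mat_of (1 + \<tau> *\<^sub>R (U R - 1))) = 0"
  then obtain x where x: "x \<noteq> 0" "mat_of (1 + \<tau> *\<^sub>R (U R - 1)) *v x = 0"
    using invertible_det_nz invertible_left_inverse matrix_left_invertible_ker by metis
  define y where "y = (\<lambda>r. mat_of (U r) *v x)"
  have bl: "bounded_linear (\<lambda>M :: 'n cmat. mat_of M *v x)"
  proof (rule bounded_linear_intro[of _ "norm x"])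
    fix M N :: "'n cmat" and c :: real
    show "mat_of (M + N) *v x = mat_of M *v x + mat_of N *v x"
      by (simp add: plus_cmat.rep_eq matrix_vector_mult_add_rdistrib)
    show "mat_of (c *\<^sub>R M) *v x = c *\<^sub>R (mat_of M *v x)"
      by (simp add: scaleR_cmat.rep_eq vec_eq_iff matrix_vector_mult_def scaleR_sum_right)
    show "norm (mat_of M *v x) \<le> norm M * norm x"
      by (simp add: norm_cmat.rep_eq norm_matrix_vector_mult_complex)
  qed
  have "(y has_vector_derivative mat_of (A r) *v y r) (at r within {0..R})" if "r \<in> {0..R}" for r
    using bounded_linear.has_vector_derivative[OF bl dU[OF that]]
    by (simp add: y_def times_cmat.rep_eq matrix_vector_mul_assoc)
  moreover have "norm (mat_of (A r) *v y r) \<le> a r * norm (y r)" if "r \<in> {0..R}" for r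
    using norm_matrix_vector_mult_complex[of "mat_of (A r)" "y r"]
      mult_right_mono[OF Aa[OF that] norm_ge_zero[of "y r"]]
    by (simp add: norm_cmat.rep_eq)
  moreover have "((\<lambda>r. integral {0..r} a) has_real_derivative a r) (at r within {0..R})"
    if "r \<in> {0..R}" for r
    using integral_has_vector_derivative[OF a that]
    by (simp add: has_real_derivative_iff_has_vector_derivative)
  moreover have "0 \<le> a r" if "r \<in> {0..R}" for r
    using Aa[OF that] norm_ge_zero order_trans by blast
  moreover have y0: "y 0 = x"
    by (simp add: y_def U0 one_cmat.rep_eq)
  ultimately have *: "y R \<noteq> - \<mu> *\<^sub>R x" if "0 \<le> \<mu>" for \<mu>
    using not_opposite_direction[OF R, of y "\<lambda>r. mat_of (A r) *v y r" a "\<lambda>r. integral {0..r} a" \<mu>]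
      pi that \<open>x \<noteq> 0\<close> by simp
  have "x + \<tau> *\<^sub>R (y R - x) = 0"
  proof -
    have "mat_of (1 + \<tau> *\<^sub>R (U R - 1)) *v x = x + \<tau> *\<^sub>R (y R - x)"
      unfolding y_def
      by (simp add: linear_add[OF bounded_linear.linear[OF bl]] linear_scale[OF bounded_linear.linear[OF bl]]
          linear_diff[OF bounded_linear.linear[OF bl]] one_cmat.rep_eq)
    with x show ?thesis by simp
  qed
  then have eq: "\<tau> *\<^sub>R y R = - (1 - \<tau>) *\<^sub>R x"
    by (simp add: algebra_simps eq_neg_iff_add_eq_0)
  with \<open>x \<noteq> 0\<close> have "\<tau> \<noteq> 0" by auto
  then have "y R = (1 / \<tau>) *\<^sub>R (\<tau> *\<^sub>R y R)"
    by simp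
  also have "\<dots> = - ((1 - \<tau>) / \<tau>) *\<^sub>R x"
  proof -
    have "1 / \<tau> * - (1 - \<tau>) = - ((1 - \<tau>) / \<tau>)"
      by (simp add: minus_divide_left)
    then show ?thesis
      unfolding eq scaleR_scaleR by (simp only:)
  qed
  finally show False
    using *[of "(1 - \<tau>) / \<tau>"] \<tau> by simp
qed

section \<open>Convergence of the formal logarithm\<close>

text \<open>Without constant term, coefficient \<open>n\<close> of a power other than the first
  involves only lower coefficients: in \<open>F * F ^ j\<close> with positive \<open>j\<close>,
  coefficient \<open>n\<close> of either factor meets the constant term 0 of the other.\<close>

lemma fps_power_nth_cong:
  fixes F G :: "'a::ring_1 fps"
  assumes "F $ 0 = 0" "G $ 0 = 0" and eq: "\<And>i. i < n \<Longrightarrow> F $ i = G $ i"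
  shows "m < n \<Longrightarrow> (F ^ k) $ m = (G ^ k) $ m" and "k \<noteq> 1 \<Longrightarrow> (F ^ k) $ n = (G ^ k) $ n"
proof -
  have *: "\<forall>m<n. (F ^ k) $ m = (G ^ k) $ m" for k
  proof (induction k)
    case (Suc k)
    then show ?case
      using eq by (auto simp: fps_mult_nth intro!: sum.cong)
  qed simp
  then show "m < n \<Longrightarrow> (F ^ k) $ m = (G ^ k) $ m"
    by blast
  show "(F ^ k) $ n = (G ^ k) $ n" if "k \<noteq> 1"
  proof (cases k)
    case (Suc j)
    with that have j: "0 < j" by simp
    have "(F ^ j) $ 0 = 0" "(G ^ j) $ 0 = 0"
      using fps_order_ge_power[of F j] fps_order_ge_power[of G j] assms(1,2) j
      by (simp_all add: fps_order_ge_def)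
    then have "F $ i * (F ^ j) $ (n - i) = G $ i * (G ^ j) $ (n - i)" if "i \<le> n" for i
      using that assms(1,2) eq[of i] * by (cases "i = 0 \<or> i = n") auto
    then show ?thesis
      by (simp add: Suc fps_mult_nth)
  qed simp
qed

text \<open>In degree \<open>n\<close> only the summand \<open>k = 1\<close> contains coefficient
  \<open>n\<close> itself, so the coefficients are determined recursively by those of the
  exponential.\<close>

lemma fps_exp_unique:
  fixes F G :: "'a::real_algebra_1 fps"
  assumes "F $ 0 = 0" "G $ 0 = 0"
    and eq: "\<And>n. (\<Sum>k\<le>n. F ^ k /\<^sub>R fact k) $ n = (\<Sum>k\<le>n. G ^ k /\<^sub>R fact k) $ n"
  shows "F = G"
proof -
  have "F $ n = G $ n" for n
  proof (induction n rule: less_induct)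
    case (less n)
    show ?case
    proof (cases "n = 0")
      case False
      then have 1: "1 \<in> {..n}" by simp
      have "(F ^ k) $ n = (G ^ k) $ n" if "k \<in> {..n} - {1}" for k
        using fps_power_nth_cong(2)[of F G n k] assms(1,2) less that by auto
      then have "(\<Sum>k\<in>{..n} - {1}. (F ^ k /\<^sub>R fact k) $ n) = (\<Sum>k\<in>{..n} - {1}. (G ^ k /\<^sub>R fact k) $ n)"
        by (intro sum.cong) auto
      then show ?thesis
        using eq[of n] by (simp add: fps_sum_nth sum.remove[OF _ 1])
    qed (use assms in simp)
  qed
  then show ?thesis
    by (simp add: fps_eq_iff)
qed

text \<open>Dividing by the power \<open>d\<close> of the lowest nonvanishing term leaves a function
  with nonzero limit at 0. If \<open>d\<close> were below \<open>N\<close>, the bound would force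
  this limit to be 0.\<close>

lemma has_fps_expansion_bounded_imp_nth_0:
  fixes f :: "complex \<Rightarrow> complex"
  assumes f: "f has_fps_expansion F" and bound: "eventually (\<lambda>z. norm (f z) \<le> C * norm z ^ N) (at 0)"
    and "n < N"
  shows "F $ n = 0"
proof (rule ccontr)
  assume n: "F $ n \<noteq> 0"
  define d where "d = subdegree F"
  have d: "d < N" "F $ d \<noteq> 0"
    using n \<open>n < N\<close> subdegree_leI[OF n] by (auto simp: d_def)
  have "((\<lambda>z. if z = 0 then F $ d else f z / z ^ d) \<longlongrightarrow> fps_shift d F $ 0) (nhds 0)"
    by (intro has_fps_expansion_imp_tendsto_0 has_fps_expansion_shift[OF f]) (simp_all add: d_def)
  then have "((\<lambda>z. if z = 0 then F $ d else f z / z ^ d) \<longlongrightarrow> F $ d) (at 0)"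
    by (simp add: tendsto_nhds_iff)
  then have "((\<lambda>z. f z / z ^ d) \<longlongrightarrow> F $ d) (at 0)"
    by (rule Lim_transform_eventually) (simp add: eventually_at_filter)
  moreover have "((\<lambda>z. f z / z ^ d) \<longlongrightarrow> 0) (at 0)"
  proof (rule Lim_null_comparison)
    show "((\<lambda>z :: complex. C * norm z ^ (N - d)) \<longlongrightarrow> 0) (at 0)"
      using d by (auto intro!: tendsto_eq_intros)
    show "eventually (\<lambda>z. norm (f z / z ^ d) \<le> C * norm z ^ (N - d)) (at 0)"
      using bound eventually_neq_at_within[of 0]
    proof eventually_elim
      case (elim z)
      have "norm z ^ N = norm z ^ (N - d) * norm z ^ d"
        using d by (simp add: power_add[symmetric])
      then show ?case
        using elim by (simp add: norm_divide norm_power divide_le_eq)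
    qed
  qed
  ultimately show False
    using d LIM_unique by blast
qed

lemma has_fps_expansion_linear_bound:
  fixes f :: "complex \<Rightarrow> complex"
  assumes f: "f has_fps_expansion F" and "F $ 0 = 0"
  obtains C where "0 \<le> C" "eventually (\<lambda>z. norm (f z) \<le> C * norm z) (at 0)"
proof (cases "F = 0")
  case True
  with f have "eventually (\<lambda>z. f z = 0) (nhds 0)"
    by (simp add: has_fps_expansion_0_iff)
  then have "eventually (\<lambda>z. norm (f z) \<le> 0 * norm z) (at 0)"
    unfolding eventually_at_filter by eventually_elim simp
  then show ?thesis
    by (rule that[rotated]) simp
next
  case False
  then have "1 \<le> subdegree F"
    using \<open>F $ 0 = 0\<close> by (intro subdegree_geI) auto
  then have "((\<lambda>z. if z = 0 then F $ 1 else f z / z ^ 1) \<longlongrightarrow> fps_shift 1 F $ 0) (nhds 0)"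
    by (intro has_fps_expansion_imp_tendsto_0 has_fps_expansion_shift[OF f]) simp_all
  then have "eventually (\<lambda>z. norm (if z = 0 then F $ 1 else f z / z ^ 1) < norm (fps_shift 1 F $ 0) + 1) (nhds 0)"
    by (intro order_tendstoD(2)[OF tendsto_norm]) auto
  then have "eventually (\<lambda>z. norm (f z) \<le> (norm (F $ 1) + 1) * norm z) (at 0)"
    unfolding eventually_at_filter
    by eventually_elim (auto simp: norm_divide divide_less_eq)
  then show ?thesis
    by (rule that[rotated]) simp
qed

section \<open>Power series expansions of matrix-valued functions\<close>

definition entry_fps :: "'n::finite cmat fps \<Rightarrow> 'n \<Rightarrow> 'n \<Rightarrow> complex fps" where
  "entry_fps F i j = Abs_fps (\<lambda>n. entry (F $ n) i j)"

lemma entry_sum: "entry (sum f I) i j = (\<Sum>x\<in>I. entry (f x) i j)"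
  by (rule linear_sum[OF bounded_linear.linear[OF bounded_linear_entry]])

definition has_cmat_expansion :: "(complex \<Rightarrow> 'n::finite cmat) \<Rightarrow> 'n cmat fps \<Rightarrow> bool" where
  "has_cmat_expansion f F \<longleftrightarrow> (\<forall>i j. (\<lambda>z. entry (f z) i j) has_fps_expansion entry_fps F i j)"

lemma has_cmat_expansion_mult:
  assumes "has_cmat_expansion f F" "has_cmat_expansion g G"
  shows "has_cmat_expansion (\<lambda>z. f z * g z) (F * G)"
proof -
  have "entry_fps (F * G) i j = (\<Sum>k\<in>UNIV. entry_fps F i k * entry_fps G k j)" for i j
    by (rule fps_ext) (simp add: entry_fps_def fps_mult_nth entry_sum entry_mult fps_sum_nth sum.swap[of _ "UNIV"])
  then show ?thesis
    using assms by (auto simp: has_cmat_expansion_def entry_mult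
        intro!: has_fps_expansion_sum has_fps_expansion_mult)
qed

lemma has_cmat_expansion_1: "has_cmat_expansion (\<lambda>z. 1) 1"
proof -
  have "entry_fps 1 i j = fps_const (entry 1 i j)" for i j :: 'a
    by (rule fps_ext) (simp add: entry_fps_def)
  then show ?thesis
    by (simp add: has_cmat_expansion_def)
qed

lemma has_cmat_expansion_power:
  "has_cmat_expansion f F \<Longrightarrow> has_cmat_expansion (\<lambda>z. f z ^ k) (F ^ k)"
  by (induction k) (simp_all add: has_cmat_expansion_1 has_cmat_expansion_mult)

lemma has_cmat_expansion_scaleR:
  assumes "has_cmat_expansion f F"
  shows "has_cmat_expansion (\<lambda>z. c *\<^sub>R f z) (c *\<^sub>R F)"
proof -
  have "entry_fps (c *\<^sub>R F) i j = fps_const (of_real c) * entry_fps F i j" for i j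
    by (rule fps_ext) (simp add: entry_fps_def scaleR_conv_of_real[where 'a = complex])
  then show ?thesis
    using assms by (simp add: has_cmat_expansion_def has_fps_expansion_scaleR)
qed

lemma has_cmat_expansion_diff:
  assumes "has_cmat_expansion f F" "has_cmat_expansion g G"
  shows "has_cmat_expansion (\<lambda>z. f z - g z) (F - G)"
proof -
  have "entry_fps (F - G) i j = entry_fps F i j - entry_fps G i j" for i j
    by (rule fps_ext) (simp add: entry_fps_def)
  then show ?thesis
    using assms by (simp add: has_cmat_expansion_def has_fps_expansion_diff)
qed

lemma has_cmat_expansion_sum:
  assumes "\<And>x. x \<in> I \<Longrightarrow> has_cmat_expansion (f x) (F x)"
  shows "has_cmat_expansion (\<lambda>z. \<Sum>x\<in>I. f x z) (\<Sum>x\<in>I. F x)"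
proof -
  have "entry_fps (\<Sum>x\<in>I. F x) i j = (\<Sum>x\<in>I. entry_fps (F x) i j)" for i j
    by (rule fps_ext) (simp add: entry_fps_def fps_sum_nth entry_sum)
  then show ?thesis
    using assms by (auto simp: has_cmat_expansion_def entry_sum intro!: has_fps_expansion_sum)
qed

text \<open>The link between analytic and formal exponential. Since \<open>L\<close> is O(z),
  \<open>exp (L z)\<close> differs from its partial sum up to the power \<open>n\<close> by
  O(z^(n+1)), and such an error has no coefficients up to degree \<open>n\<close>.\<close>

lemma exp_expansion_nth:
  fixes L :: "complex \<Rightarrow> 'n::finite cmat"
  assumes L: "has_cmat_expansion L G" and "G $ 0 = 0"
    and Y: "has_cmat_expansion Y H"
    and exp: "eventually (\<lambda>z. exp (L z) = Y z) (at 0)"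
  shows "(\<Sum>k\<le>n. G ^ k /\<^sub>R fact k) $ n = H $ n"
proof (rule cmat_eqI)
  fix i j
  define D where "D = (\<lambda>z. Y z - (\<Sum>k\<le>n. L z ^ k /\<^sub>R fact k))"
  have D: "has_cmat_expansion D (H - (\<Sum>k\<le>n. G ^ k /\<^sub>R fact k))"
    unfolding D_def
    by (intro has_cmat_expansion_diff has_cmat_expansion_sum has_cmat_expansion_scaleR
        has_cmat_expansion_power L Y)
  have "\<forall>i j. \<exists>C\<ge>0. eventually (\<lambda>z. norm (entry (L z) i j) \<le> C * norm z) (at 0)"
  proof (intro allI)
    fix i j
    have "(\<lambda>z. entry (L z) i j) has_fps_expansion entry_fps G i j"
      using L by (simp add: has_cmat_expansion_def)
    then show "\<exists>C\<ge>0. eventually (\<lambda>z. norm (entry (L z) i j) \<le> C * norm z) (at 0)"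
      by (rule has_fps_expansion_linear_bound) (use \<open>G $ 0 = 0\<close> in \<open>auto simp: entry_fps_def\<close>)
  qed
  then obtain C where C0: "\<And>i j. 0 \<le> C i j"
    and C: "\<And>i j. eventually (\<lambda>z. norm (entry (L z) i j) \<le> C i j * norm z) (at 0)"
    by metis
  define K where "K = (\<Sum>i\<in>UNIV. \<Sum>j\<in>UNIV. C i j)"
  have "0 \<le> K"
    by (simp add: K_def C0 sum_nonneg)
  have L_bound: "eventually (\<lambda>z. norm (L z) \<le> K * norm z) (at 0)"
  proof -
    have "eventually (\<lambda>z. \<forall>i\<in>UNIV. \<forall>j\<in>UNIV. norm (entry (L z) i j) \<le> C i j * norm z) (at 0)"
      by (intro eventually_ball_finite ballI C) simp_all
    then show ?thesis
    proof eventually_elim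
      case (elim z)
      have "norm (L z) \<le> (\<Sum>i\<in>UNIV. \<Sum>j\<in>UNIV. norm (entry (L z) i j))"
        by (rule norm_cmat_le_sum)
      also have "\<dots> \<le> (\<Sum>i\<in>UNIV. \<Sum>j\<in>UNIV. C i j * norm z)"
        using elim by (intro sum_mono) auto
      finally show ?case
        by (simp add: K_def sum_distrib_right)
    qed
  qed
  have small: "eventually (\<lambda>z :: complex. norm z < 1) (at 0)"
    using eventually_at_in_open'[of "ball 0 1" "0 :: complex"] by (simp add: dist_norm)
  have "eventually (\<lambda>z. norm (entry (D z) i j) \<le> (K ^ Suc n * exp K) * norm z ^ Suc n) (at 0)"
    using L_bound small exp
  proof eventually_elim
    case (elim z)
    have "norm (L z) \<le> K"
      using elim mult_left_le[of "norm z" K] \<open>0 \<le> K\<close> by linarith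
    have "norm (entry (D z) i j) \<le> norm (exp (L z) - (\<Sum>k<Suc n. L z ^ k /\<^sub>R fact k))"
      unfolding elim D_def lessThan_Suc_atMost by (rule norm_entry_le)
    also have "\<dots> \<le> norm (L z) ^ Suc n * exp (norm (L z))"
      by (rule exp_remainder_bound)
    also have "\<dots> \<le> (K * norm z) ^ Suc n * exp K"
      using elim \<open>norm (L z) \<le> K\<close> \<open>0 \<le> K\<close> by (intro mult_mono power_mono) auto
    finally show ?case
      by (simp add: power_mult_distrib mult_ac)
  qed
  from has_fps_expansion_bounded_imp_nth_0[OF _ this, of "entry_fps (H - (\<Sum>k\<le>n. G ^ k /\<^sub>R fact k)) i j" n]
  show "entry ((\<Sum>k\<le>n. G ^ k /\<^sub>R fact k) $ n) i j = entry (H $ n) i j"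
    using D by (simp add: has_cmat_expansion_def entry_fps_def)
qed

text \<open>The Taylor series \<open>G\<close> of \<open>clog\<close> composed with \<open>Y\<close>
  has \<open>Y\<close> as its formal exponential, and so does \<open>F\<close>. By uniqueness they
  coincide, and \<open>F\<close> inherits the whole disc of holomorphy as its domain of
  convergence.\<close>

lemma formal_log_converges:
  fixes Y :: "complex \<Rightarrow> 'n::finite cmat"
  assumes \<rho>: "1 < \<rho>"
    and Y: "\<And>z. norm z < \<rho> \<Longrightarrow> (\<lambda>n. cscalar z ^ n * c n) sums Y z"
    and "c 0 = 1"
    and nz: "\<And>z \<tau>. norm z < \<rho> \<Longrightarrow> \<tau> \<in> {0..1} \<Longrightarrow> det (mat_of (1 + \<tau> *\<^sub>R (Y z - 1))) \<noteq> 0"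
    and F: "F $ 0 = 0" "\<And>n. (\<Sum>k\<le>n. F ^ k /\<^sub>R fact k) $ n = c n"
  shows "summable (\<lambda>n. norm (F $ n))" and "exp (\<Sum>n. F $ n) = Y 1"
proof -
  define D where "D = ball (0 :: complex) \<rho>"
  have D: "open D" "convex D" "0 \<in> D" "1 \<in> D"
    using \<rho> by (auto simp: D_def)
  have in_D: "z \<in> D \<longleftrightarrow> norm z < \<rho>" for z
    by (simp add: D_def)
  have entry_sums: "(\<lambda>n. entry (c n) i j * z ^ n) sums entry (Y z) i j" if "z \<in> D" for z i j
    using bounded_linear.sums[OF bounded_linear_entry Y, of z i j] that
    by (simp add: in_D cscalar_power[symmetric] mult.commute)
  have holY: "(\<lambda>z. entry (Y z) i j) holomorphic_on D" for i j
    unfolding D_def by (rule power_series_holomorphic[of _ _ "\<lambda>n. entry (c n) i j"])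
      (use entry_sums in \<open>simp add: D_def\<close>)
  define L where "L = (\<lambda>z. clog (Y z))"
  have nz': "det (mat_of (1 + \<tau> *\<^sub>R (Y z - 1))) \<noteq> 0" if "z \<in> D" "\<tau> \<in> {0..1}" for z \<tau>
    using nz that by (simp add: in_D)
  have exp_L: "exp (L z) = Y z" if "z \<in> D" for z
    unfolding L_def by (rule exp_clog[OF D(1,2) holY nz' that])
  have holL: "(\<lambda>z. entry (L z) i j) holomorphic_on D" for i j
    unfolding L_def by (rule holomorphic_clog[OF D(1,2) holY nz'])
  have "Y 0 = 1"
  proof (rule cmat_eqI)
    fix i j
    have "(\<lambda>n. entry (c n) i j * 0 ^ n) sums entry (c 0) i j"
      using powser_sums_zero[of "\<lambda>n. entry (c n) i j"] by simp
    then show "entry (Y 0) i j = entry 1 i j"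
      using sums_unique2[OF entry_sums[OF D(3)]] \<open>c 0 = 1\<close> by metis
  qed
  then have "L 0 = 0"
    by (simp add: L_def)
  define G where "G = Abs_fps (\<lambda>n. Cmat (vec_lambda (\<lambda>i. vec_lambda (\<lambda>j.
      fps_expansion (\<lambda>z. entry (L z) i j) 0 $ n))))"
  have G: "entry_fps G i j = fps_expansion (\<lambda>z. entry (L z) i j) 0" for i j
    by (rule fps_ext) (simp add: G_def entry_fps_def)
  have expL: "has_cmat_expansion L G"
    unfolding has_cmat_expansion_def G using holL D by blast
  have expY: "has_cmat_expansion Y (Abs_fps c)"
    unfolding has_cmat_expansion_def
  proof (intro allI has_fps_expansionI)
    fix i j
    show "eventually (\<lambda>u. (\<lambda>n. entry_fps (Abs_fps c) i j $ n * u ^ n) sums entry (Y u) i j) (nhds 0)"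
      using eventually_nhds_in_open[OF D(1,3)]
      by eventually_elim (simp add: entry_fps_def entry_sums)
  qed
  have G0: "G $ 0 = 0"
  proof (rule cmat_eqI)
    fix i j
    have "entry (L 0) i j = entry_fps G i j $ 0"
      using expL unfolding has_cmat_expansion_def by (intro has_fps_expansion_imp_0_eq_fps_nth_0) blast
    then show "entry (G $ 0) i j = entry 0 i j"
      by (simp add: \<open>L 0 = 0\<close> entry_fps_def)
  qed
  have "eventually (\<lambda>z. exp (L z) = Y z) (at 0)"
    using eventually_at_in_open'[OF D(1,3)] by eventually_elim (rule exp_L)
  from exp_expansion_nth[OF expL G0 expY this] have "F = G"
    by (intro fps_exp_unique) (simp_all add: F G0)
  have sums: "(\<lambda>n. entry (F $ n) i j * z ^ n) sums entry (L z) i j" if "z \<in> D" for z i j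
    using has_fps_expansion_imp_sums_complex[of "\<lambda>z. entry (L z) i j" "entry_fps F i j" "ereal \<rho>" z]
      expL holL that by (simp add: \<open>F = G\<close> has_cmat_expansion_def entry_fps_def D_def in_D)
  have "summable (\<lambda>n. norm (entry (F $ n) i j))" for i j
  proof -
    \<comment> \<open>A point strictly between 1 and \<open>\<rho>\<close>: convergence there
      implies absolute convergence at 1.\<close>
    define w :: complex where "w = of_real ((1 + \<rho>) / 2)"
    have "norm w = (1 + \<rho>) / 2"
      unfolding w_def norm_of_real using \<rho> by simp
    then have w: "1 < norm w" "w \<in> D"
      using \<rho> by (simp_all add: in_D)
    from powser_insidea[OF sums_summable[OF sums[OF w(2)]], of 1] w(1) show ?thesis
      by simp
  qed
  then have "summable (\<lambda>n. \<Sum>i\<in>UNIV. \<Sum>j\<in>UNIV. norm (entry (F $ n) i j))"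
    by (intro summable_sum)
  then show summ: "summable (\<lambda>n. norm (F $ n))"
    by (rule summable_comparison_test[rotated]) (auto intro!: exI[of _ 0] norm_cmat_le_sum)
  have "(\<Sum>n. F $ n) = L 1"
  proof (rule cmat_eqI)
    fix i j
    have "(\<lambda>n. entry (F $ n) i j) sums entry (\<Sum>n. F $ n) i j"
      by (rule bounded_linear.sums[OF bounded_linear_entry summable_sums[OF summable_norm_cancel[OF summ]]])
    moreover have "(\<lambda>n. entry (F $ n) i j) sums entry (L 1) i j"
      using sums[OF D(4)] by simp
    ultimately show "entry (\<Sum>n. F $ n) i j = entry (L 1) i j"
      by (rule sums_unique2)
  qed
  then show "exp (\<Sum>n. F $ n) = Y 1"
    using exp_L[OF D(4)] by simp
qed

no_notation fps_nth (infixl \<open>$\<close> 75)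
unbundle vec_syntax

section \<open>The Magnus series\<close>

lemma magnus_convergence:
  fixes A U :: "real \<Rightarrow> real ^ 'n ^ 'n"
  assumes R: "0 \<le> R" and A: "continuous_on {0..R} A" and a: "continuous_on {0..R} a"
    and Aa: "\<And>r. r \<in> {0..R} \<Longrightarrow> norm (cmat_of_real (A r)) \<le> a r"
    and pi: "integral {0..R} a < pi"
    and U: "continuous_on {0..R} U"
    and U_eq: "\<And>r. r \<in> {0..R} \<Longrightarrow> U r = mat 1 + integral {0..r} (\<lambda>q. A q ** U q)"
  shows "summable (\<lambda>n. norm (magnus_term A n R))"
    and "mat_exp (\<Sum>n. magnus_term A n R) = U R"
proof -
  define \<gamma> where "\<gamma> = integral {0..R} a"
  have "0 \<le> \<gamma>"
    unfolding \<gamma>_def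
    by (intro integral_nonneg integrable_continuous_real a) (use Aa norm_ge_zero order_trans in blast)
  \<comment> \<open>The radius must exceed 1 and satisfy \<open>\<rho> * \<gamma> < pi\<close>.
    Dividing the slack by \<open>\<gamma> + 1\<close> also covers
    \<open>\<gamma> = 0\<close>.\<close>
  define \<rho> where "\<rho> = 1 + (pi - \<gamma>) / (\<gamma> + 1)"
  have \<rho>: "1 < \<rho>"
    using pi \<open>0 \<le> \<gamma>\<close> by (simp add: \<rho>_def \<gamma>_def)
  have \<rho>\<gamma>: "x * \<gamma> < pi" if "0 \<le> x" "x < \<rho>" for x
  proof -
    have "x * \<gamma> \<le> \<rho> * \<gamma>"
      using that \<open>0 \<le> \<gamma>\<close> by (intro mult_right_mono) auto
    also have "\<rho> * \<gamma> = \<gamma> + (pi - \<gamma>) * (\<gamma> / (\<gamma> + 1))"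
      by (simp add: \<rho>_def algebra_simps)
    also have "\<dots> < \<gamma> + (pi - \<gamma>) * 1"
      using pi \<open>0 \<le> \<gamma>\<close> by (intro add_strict_left_mono mult_strict_left_mono) (auto simp: \<gamma>_def)
    finally show ?thesis by simp
  qed
  define B where "B = (\<lambda>r. cmat_of_real (A r))"
  have B: "continuous_on {0..R} B"
    unfolding B_def by (intro bounded_linear.continuous_on[OF bounded_linear_cmat_of_real] A)
  \<comment> \<open>The sum exists for every \<open>z\<close>, so choice yields a total function
    \<open>Y\<close>; only the determinant condition is tied to the disc.\<close>
  have "\<exists>V. (\<lambda>n. cscalar z ^ n * dyson B n R) sums V \<and>
      (norm z < \<rho> \<longrightarrow> (\<forall>\<tau>\<in>{0..1}. det (mat_of (1 + \<tau> *\<^sub>R (V - 1))) \<noteq> 0))" for z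
  proof -
    have zB: "continuous_on {0..R} (\<lambda>q. cscalar z * B q)"
      by (intro continuous_intros B)
    obtain W where W: "\<And>r. r \<in> {0..R} \<Longrightarrow> (\<lambda>n. dyson (\<lambda>q. cscalar z * B q) n r) sums W r"
      and dW: "\<And>r. r \<in> {0..R} \<Longrightarrow>
        (W has_vector_derivative (cscalar z * B r) * W r) (at r within {0..R})"
      and "W 0 = 1"
      by (rule solution_exists[OF zB]) blast
    have "(\<lambda>n. cscalar z ^ n * dyson B n R) sums W R"
      using W[of R] R by (simp add: dyson_cscalar[OF _ B])
    moreover have "det (mat_of (1 + \<tau> *\<^sub>R (W R - 1))) \<noteq> 0" if "norm z < \<rho>" "\<tau> \<in> {0..1}" for \<tau>
    proof (rule det_segment_nonzero[OF R _ _ _ dW \<open>W 0 = 1\<close>])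
      show "continuous_on {0..R} (\<lambda>r. norm z * a r)"
        by (intro continuous_intros a)
      show "norm (cscalar z * B r) \<le> norm z * a r" if "r \<in> {0..R}" for r
        using norm_mult_ineq[of "cscalar z" "B r"] mult_left_mono[OF Aa[OF that] norm_ge_zero[of z]]
        by (simp add: B_def)
      show "integral {0..R} (\<lambda>r. norm z * a r) < pi"
        using \<rho>\<gamma>[of "norm z"] that by (simp add: \<gamma>_def)
    qed (use that in auto)
    ultimately show ?thesis
      by blast
  qed
  then obtain Y where Y: "\<And>z. (\<lambda>n. cscalar z ^ n * dyson B n R) sums Y z"
    and nz: "\<And>z \<tau>. norm z < \<rho> \<Longrightarrow> \<tau> \<in> {0..1} \<Longrightarrow> det (mat_of (1 + \<tau> *\<^sub>R (Y z - 1))) \<noteq> 0"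
    by metis
  have F: "fps_nth (\<Sum>k\<le>n. magnus_fps A R ^ k /\<^sub>R fact k) n = dyson B n R" for n
    unfolding B_def using R by (intro exp_magnus_fps_nth[OF A]) auto
  have F0: "fps_nth (magnus_fps A R) 0 = 0"
    by simp
  have "dyson B 0 R = 1" by simp
  note log = formal_log_converges[OF \<rho> Y this nz F0 F, unfolded magnus_fps_nth]
  \<comment> \<open>The given solution \<open>U\<close> is the Dyson sum as well, which identifies
    it with \<open>Y 1\<close>.\<close>
  have "(\<lambda>n. dyson B n R) sums cmat_of_real (U R)"
  proof (rule dyson_sums_solution[OF B])
    show "continuous_on {0..R} (\<lambda>r. cmat_of_real (U r))"
      by (intro bounded_linear.continuous_on[OF bounded_linear_cmat_of_real] U)
    fix r assume r: "r \<in> {0..R}"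
    then have "(\<lambda>q. A q ** U q) integrable_on {0..r}"
      by (intro integrable_continuous_real continuous_intros continuous_on_subset[OF A]
          continuous_on_subset[OF U]) auto
    from integral_linear[OF this bounded_linear_cmat_of_real]
    show "cmat_of_real (U r) = 1 + integral {0..r} (\<lambda>q. B q * cmat_of_real (U q))"
      by (simp add: U_eq[OF r] cmat_of_real_add cmat_of_real_mat_1 cmat_of_real_mult o_def B_def)
  qed (use R in simp)
  then have Y1: "Y 1 = cmat_of_real (U R)"
    using sums_unique2[OF Y[of 1]] by simp
  obtain K where K: "\<And>x :: 'n cmat. norm (cmat_Re x) \<le> norm x * K"
    using bounded_linear.bounded[OF bounded_linear_cmat_Re] by blast
  show summ: "summable (\<lambda>n. norm (magnus_term A n R))"
  proof (rule summable_comparison_test)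
    show "summable (\<lambda>n. norm (cmat_of_real (magnus_term A n R)) * K)"
      by (rule summable_mult2[OF log(1)])
    show "\<exists>N. \<forall>n\<ge>N. norm (norm (magnus_term A n R)) \<le> norm (cmat_of_real (magnus_term A n R)) * K"
      using K[of "cmat_of_real (magnus_term A _ R)"] by auto
  qed
  have "cmat_of_real (\<Sum>n. magnus_term A n R) = (\<Sum>n. cmat_of_real (magnus_term A n R))"
    by (rule bounded_linear.suminf[OF bounded_linear_cmat_of_real summable_norm_cancel[OF summ]])
  then show "mat_exp (\<Sum>n. magnus_term A n R) = U R"
    using log(2) by (simp add: mat_exp_eq Y1)
qed

text \<open>Off the null set the algebraic recursion agrees pointwise; the Magnus terms agree
  everywhere because they are integrals. This will absorb the arbitrary value of the generator
  matrix at the final time.\<close>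

lemma magnus_cong:
  fixes A B :: "real \<Rightarrow> real ^ 'n ^ 'n"
  assumes N: "negligible N" and AB: "\<And>r. r \<in> {0..R} - N \<Longrightarrow> A r = B r"
  shows "r \<in> {0..R} - N \<Longrightarrow> magnus_ad A j n r = magnus_ad B j n r"
    and "r \<in> {0..R} \<Longrightarrow> magnus_term A n r = magnus_term B n r"
proof -
  have "(\<forall>j. \<forall>r\<in>{0..R} - N. magnus_ad A j n r = magnus_ad B j n r) \<and>
      (\<forall>r\<in>{0..R}. magnus_term A n r = magnus_term B n r)" for n
  proof (induction n rule: less_induct)
    case (less n)
    have ad: "magnus_ad A j n r = magnus_ad B j n r" if "r \<in> {0..R} - N" for j r
    proof (cases j)
      case 0
      then show ?thesis using AB[OF that] by simp
    next
      case (Suc i)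
      show ?thesis
        unfolding Suc magnus_ad.simps
        using less that by (intro sum.cong refl arg_cong2[where f = commutator]) auto
    qed
    have "integral {0..r} (magnus_ad A j n) = integral {0..r} (magnus_ad B j n)" if "r \<in> {0..R}" for j r
      by (rule integral_spike[OF N]) (use that ad in auto)
    then show ?case
      using ad by (simp add: magnus_term.simps)
  qed
  then show "r \<in> {0..R} - N \<Longrightarrow> magnus_ad A j n r = magnus_ad B j n r"
    and "r \<in> {0..R} \<Longrightarrow> magnus_term A n r = magnus_term B n r"
    by blast+
qed

section \<open>Explicit form of the first three Magnus terms\<close>

lemma bernoulli_1: "bernoulli (Suc 0) = - 1 / 2"
  and bernoulli_2: "bernoulli (Suc (Suc 0)) = 1 / 6"
  by (simp_all add: eval_nat_numeral)

lemma bounded_bilinear_commutator: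
  "bounded_bilinear (commutator :: real ^ 'n ^ 'n \<Rightarrow> _)"
proof -
  interpret bounded_bilinear "(**) :: real ^ 'n ^ 'n \<Rightarrow> real ^ 'n ^ 'n \<Rightarrow> real ^ 'n ^ 'n"
    by (rule bounded_bilinear_matrix_mult)
  have "bilinear (commutator :: real ^ 'n ^ 'n \<Rightarrow> _)"
    unfolding bilinear_def commutator_def
    by (auto intro!: linearI simp: add_left add_right scaleR_left scaleR_right scaleR_diff_right)
  then show ?thesis
    by (simp add: bilinear_conv_bounded_bilinear)
qed

lemmas commutator_has_vector_derivative =
  bounded_bilinear.has_vector_derivative[OF bounded_bilinear_commutator]

lemma integral_commutator_left:
  "f integrable_on S \<Longrightarrow> integral S (\<lambda>v. commutator (f v) X) = commutator (integral S f) X"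
  using integral_linear[OF _ bounded_bilinear.bounded_linear_left[OF bounded_bilinear_commutator]]
  by (simp add: o_def)

lemma magnus_term_1: "magnus_term A 1 r = integral {0..r} A"
proof -
  have "magnus_ad A 0 1 = A"
    by (rule ext) simp
  then show ?thesis
    by (simp add: magnus_term.simps)
qed

lemma magnus_term_2_aux:
  "magnus_term A 2 r = - (1 / 2) *\<^sub>R integral {0..r} (\<lambda>u. commutator (integral {0..u} A) (A u))"
proof -
  have "magnus_ad A 0 2 = (\<lambda>_. 0)" "magnus_ad A 1 2 = (\<lambda>u. commutator (integral {0..u} A) (A u))"
    using magnus_term_1[of A] by (simp_all add: fun_eq_iff eval_nat_numeral)
  then show ?thesis
    unfolding magnus_term.simps[of A 2]
    by (simp add: eval_nat_numeral bernoulli_1 del: bernoulli.simps magnus_ad.simps)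
qed

lemma magnus_term_2:
  assumes A: "continuous_on {0..R} A" and r: "r \<in> {0..R}"
  shows "magnus_term A 2 r
    = - (1 / 2) *\<^sub>R integral {0..r} (\<lambda>u. integral {0..u} (\<lambda>v. commutator (A v) (A u)))"
  unfolding magnus_term_2_aux
proof (intro arg_cong[where f = "scaleR _"] integral_cong)
  fix u assume "u \<in> {0..r}"
  then have "A integrable_on {0..u}"
    by (intro integrable_continuous_real continuous_on_subset[OF A]) (use r in auto)
  then show "commutator (integral {0..u} A) (A u) = integral {0..u} (\<lambda>v. commutator (A v) (A u))"
    by (rule integral_commutator_left[symmetric])
qed

text \<open>With a, b, c as in the proof, the Jacobi identity reads b = c - a, and both sides become
  (a + c) / 6. The weight 1/4 is the square of the first Bernoulli number, 1/12 is the second one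
  divided by 2!.\<close>

lemma commutator_jacobi:
  fixes V W X :: "real ^ 'n ^ 'n"
  shows "(1 / 4) *\<^sub>R commutator (commutator W V) X
      + (1 / 12) *\<^sub>R (commutator V (commutator W X) + commutator W (commutator V X))
    = (1 / 6) *\<^sub>R (commutator (commutator W V) X + commutator (commutator X V) W)"
proof -
  define a b c where "a = commutator (commutator W V) X"
    and "b = commutator V (commutator W X)" and "c = commutator W (commutator V X)"
  have "b = c - a"
    by (simp add: a_def b_def c_def cmat_of_real_eq_iff[symmetric] cmat_of_real_commutator
        cmat_of_real_diff ad_def algebra_simps)
  moreover have "commutator (commutator X V) W = c"
    by (simp add: c_def cmat_of_real_eq_iff[symmetric] cmat_of_real_commutator ad_def algebra_simps)
  ultimately show ?thesis
    by (simp only: a_def[symmetric] b_def[symmetric] c_def[symmetric])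
      (simp add: vec_eq_iff algebra_simps)
qed

text \<open>The recursion gives products of the single integral \<open>I u\<close>, not a triple
  integral over the simplex. For fixed \<open>u\<close>, differentiating the integrand with respect
  to the upper limit of \<open>I\<close> and \<open>J\<close> leaves an expression linear in
  \<open>I v\<close>, which is an integral once more; the Jacobi identity then brings the kernel
  into the stated form.\<close>

lemma magnus_term_3:
  assumes A: "continuous_on {0..R} A" and r: "r \<in> {0..R}"
  shows "magnus_term A 3 r = (1 / 6) *\<^sub>R integral {0..r} (\<lambda>u. integral {0..u} (\<lambda>v. integral {0..v} (\<lambda>w.
    commutator (commutator (A w) (A v)) (A u) + commutator (commutator (A u) (A v)) (A w))))"
proof -
  define I where "I = (\<lambda>u. integral {0..u} A)"
  define J where "J = (\<lambda>u. integral {0..u} (\<lambda>v. commutator (I v) (A v)))"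
  have I: "continuous_on {0..R} I"
    unfolding I_def by (intro indefinite_integral_continuous_1 integrable_continuous_real A)
  have IA: "continuous_on {0..R} (\<lambda>v. commutator (I v) (A v))"
    by (intro continuous_intros I A)
  have J: "continuous_on {0..R} J"
    unfolding J_def by (intro indefinite_integral_continuous_1 integrable_continuous_real IA)
  have term2: "magnus_term A 2 u = - (1 / 2) *\<^sub>R J u" for u
    by (simp add: magnus_term_2_aux J_def I_def)
  have ad: "magnus_ad A 0 3 = (\<lambda>_. 0)" "magnus_ad A 1 3 = (\<lambda>u. commutator (magnus_term A 2 u) (A u))"
    "magnus_ad A 2 3 = (\<lambda>u. commutator (I u) (commutator (I u) (A u)))"
    using magnus_term_1[of A] by (simp_all add: fun_eq_iff eval_nat_numeral I_def)
  have int: "f integrable_on {0..r}" if "continuous_on {0..R} f" for f :: "real \<Rightarrow> real ^ 'a ^ 'a"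
    by (intro integrable_continuous_real continuous_on_subset[OF that]) (use r in auto)
  have "magnus_term A 3 r = - (1 / 2) *\<^sub>R integral {0..r} (\<lambda>u. commutator (- (1 / 2) *\<^sub>R J u) (A u))
      + (1 / 12) *\<^sub>R integral {0..r} (\<lambda>u. commutator (I u) (commutator (I u) (A u)))"
    unfolding magnus_term.simps[of A 3] term2[symmetric] using ad
    by (simp add: eval_nat_numeral bernoulli_1 bernoulli_2 del: bernoulli.simps magnus_ad.simps)
  also have "\<dots> = integral {0..r} (\<lambda>u. (1 / 4) *\<^sub>R commutator (J u) (A u)
      + (1 / 12) *\<^sub>R commutator (I u) (commutator (I u) (A u)))"
  proof -
    have "commutator (- (1 / 2) *\<^sub>R J u) (A u) = - (1 / 2) *\<^sub>R commutator (J u) (A u)" for u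
      by (rule bounded_bilinear.scaleR_left[OF bounded_bilinear_commutator])
    then show ?thesis
      by (subst integral_add) (simp_all add: int continuous_intros I J A)
  qed
  also have "\<dots> = integral {0..r} (\<lambda>u. integral {0..u} (\<lambda>v. integral {0..v} (\<lambda>w.
      (1 / 6) *\<^sub>R (commutator (commutator (A w) (A v)) (A u) + commutator (commutator (A u) (A v)) (A w)))))"
  proof (rule integral_cong)
    fix u assume u: "u \<in> {0..r}"
    then have sub: "{0..u} \<subseteq> {0..R}" using r by auto
    \<comment> \<open>\<open>A u\<close> is frozen so that only the upper limit in \<open>I\<close>
      and \<open>J\<close> is differentiated below.\<close>
    define X where "X = A u"
    \<comment> \<open>\<open>q v (I v)\<close> is the derivative at \<open>v\<close>. Linearity of
      \<open>q v\<close> allows it to be moved inside the integral defining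
      \<open>I v\<close>.\<close>
    define q where "q = (\<lambda>v Y. (1 / 4) *\<^sub>R commutator (commutator Y (A v)) X
      + (1 / 12) *\<^sub>R (commutator (A v) (commutator Y X) + commutator Y (commutator (A v) X)))"
    have "((\<lambda>v. q v (I v)) has_integral
        ((1 / 4) *\<^sub>R commutator (J u) X + (1 / 12) *\<^sub>R commutator (I u) (commutator (I u) X)) -
        ((1 / 4) *\<^sub>R commutator (J 0) X + (1 / 12) *\<^sub>R commutator (I 0) (commutator (I 0) X))) {0..u}"
    proof (rule fundamental_theorem_of_calculus)
      show "0 \<le> u" using u by simp
      fix v assume v: "v \<in> {0..u}"
      have dI: "(I has_vector_derivative A v) (at v within {0..u})"
        unfolding I_def by (rule integral_has_vector_derivative[OF continuous_on_subset[OF A sub] v])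
      have dJ: "(J has_vector_derivative commutator (I v) (A v)) (at v within {0..u})"
        unfolding J_def by (rule integral_has_vector_derivative[OF continuous_on_subset[OF IA sub] v])
      have "((\<lambda>v. (1 / 4) *\<^sub>R commutator (J v) X + (1 / 12) *\<^sub>R commutator (I v) (commutator (I v) X))
          has_vector_derivative
          (1 / 4) *\<^sub>R (commutator (J v) 0 + commutator (commutator (I v) (A v)) X)
          + (1 / 12) *\<^sub>R (commutator (I v) (commutator (I v) 0 + commutator (A v) X)
            + commutator (A v) (commutator (I v) X))) (at v within {0..u})"
        by (intro has_vector_derivative_add
            bounded_linear.has_vector_derivative[OF bounded_linear_scaleR_right]
            commutator_has_vector_derivative dI dJ has_vector_derivative_const)
      then show "((\<lambda>v. (1 / 4) *\<^sub>R commutator (J v) X + (1 / 12) *\<^sub>R commutator (I v) (commutator (I v) X))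
          has_vector_derivative q v (I v)) (at v within {0..u})"
        by (simp add: q_def add.commute)
    qed
    moreover have "I 0 = 0" "J 0 = 0"
      by (simp_all add: I_def J_def)
    ultimately have "(1 / 4) *\<^sub>R commutator (J u) X + (1 / 12) *\<^sub>R commutator (I u) (commutator (I u) X)
        = integral {0..u} (\<lambda>v. q v (I v))"
      by (simp add: integral_unique)
    also have "\<dots> = integral {0..u} (\<lambda>v. integral {0..v} (\<lambda>w.
      (1 / 6) *\<^sub>R (commutator (commutator (A w) (A v)) X + commutator (commutator X (A v)) (A w))))"
    proof (rule integral_cong)
      fix v assume v: "v \<in> {0..u}"
      have "bounded_linear (q v)"
        unfolding q_def
        by (intro bounded_linear_add bounded_linear_compose[OF bounded_linear_scaleR_right]
            bounded_linear_compose[OF bounded_bilinear.bounded_linear_left[OF bounded_bilinear_commutator]]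
            bounded_linear_compose[OF bounded_bilinear.bounded_linear_right[OF bounded_bilinear_commutator]]
            bounded_linear_ident)
      moreover have "A integrable_on {0..v}"
        by (intro integrable_continuous_real continuous_on_subset[OF A]) (use v sub in auto)
      ultimately have "q v (I v) = integral {0..v} (\<lambda>w. q v (A w))"
        using integral_linear[of A "{0..v}" "q v"] by (simp add: I_def o_def)
      then show "q v (I v) = integral {0..v} (\<lambda>w.
          (1 / 6) *\<^sub>R (commutator (commutator (A w) (A v)) X + commutator (commutator X (A v)) (A w)))"
        by (simp only: q_def commutator_jacobi)
    qed
    finally show "(1 / 4) *\<^sub>R commutator (J u) (A u) + (1 / 12) *\<^sub>R commutator (I u) (commutator (I u) (A u))
      = integral {0..u} (\<lambda>v. integral {0..v} (\<lambda>w.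
      (1 / 6) *\<^sub>R (commutator (commutator (A w) (A v)) (A u) + commutator (commutator (A u) (A v)) (A w))))"
      by (simp only: X_def)
  qed
  finally show ?thesis
    by (simp only: integral_cmul)
qed

section \<open>From the transposed, shifted equation back to the generator matrices\<close>

lemma integral_transpose:
  fixes f :: "real \<Rightarrow> real ^ 'n ^ 'n"
  shows "integral S (\<lambda>x. transpose (f x)) = transpose (integral S f)"
proof (cases "f integrable_on S")
  case True
  from integral_linear[OF this bounded_linear_transpose] show ?thesis
    by (simp add: o_def)
next
  case False
  \<comment> \<open>Transposition is an involution, so integrability passes in both directions; in
    this case both integrals have the default value 0.\<close>
  then have "\<not> (\<lambda>x. transpose (f x)) integrable_on S"
    using integrable_linear[OF _ bounded_linear_transpose, of "\<lambda>x. transpose (f x)" S]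
    by (auto simp: o_def)
  moreover have "transpose (0 :: real ^ 'n ^ 'n) = 0"
    by (simp add: transpose_def vec_eq_iff)
  ultimately show ?thesis
    using False by (simp add: not_integrable_integral)
qed

lemma integral_shift: "integral {0..u} (\<lambda>v. f (s + v)) = integral {s..s + u} f" for s u :: real
  using integral_shift_Icc_real[of 0 u f s] by (simp add: o_def add.commute)

lemma integral_transpose_shift:
  fixes f :: "real \<Rightarrow> real ^ 'n ^ 'n"
  shows "integral {0..u} (\<lambda>v. transpose (f (s + v))) = transpose (integral {s..s + u} f)"
  unfolding integral_transpose integral_shift[of u f s] ..

text \<open>Transposition reverses the order in a commutator; this accounts for the order of the
  arguments in the second and third coefficients.\<close>

lemma commutator_transpose:
  "commutator (transpose A) (transpose B) = transpose (commutator B A)" for A :: "real ^ 'n ^ 'n"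
proof -
  have "transpose (X - Y) = transpose X - transpose Y" for X Y :: "real ^ 'n ^ 'n"
    by (simp add: transpose_def vec_eq_iff)
  then show ?thesis
    by (simp add: commutator_def matrix_transpose_mul)
qed

lemma transpose_add: "transpose (X + Y) = transpose X + transpose Y" for X :: "real ^ 'n ^ 'n"
  by (simp add: transpose_def vec_eq_iff)

lemma transpose_scaleR: "transpose (c *\<^sub>R X) = c *\<^sub>R transpose X" for X :: "real ^ 'n ^ 'n"
  by (simp add: transpose_def vec_eq_iff)

lemma transpose_uminus: "transpose (- X) = - transpose X" for X :: "real ^ 'n ^ 'n"
  by (simp add: transpose_def vec_eq_iff)

lemma continuous_on_transpose_shift:
  fixes H :: "real \<Rightarrow> real ^ 'n ^ 'n"
  assumes "continuous_on {s..t} H"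
  shows "continuous_on {0..t - s} (\<lambda>r. transpose (H (s + r)))"
  by (intro bounded_linear.continuous_on[OF bounded_linear_transpose]
      continuous_on_compose2[OF assms] continuous_intros) auto

lemma magnus_coeff_1: "magnus_coeff H s t 1 = integral {s..t} H"
  unfolding magnus_coeff_def magnus_term_1 integral_transpose_shift by simp

lemma magnus_coeff_2:
  assumes H: "continuous_on {s..t} H" and "s \<le> t"
  shows "magnus_coeff H s t 2
    = - (1 / 2) *\<^sub>R integral {s..t} (\<lambda>u. integral {s..u} (\<lambda>v. commutator (H u) (H v)))"
proof -
  define E where "E = (\<lambda>u v. commutator (H u) (H v))"
  define E1 where "E1 = (\<lambda>u. integral {s..u} (E u))"
  have 1: "integral {0..u} (\<lambda>v. transpose (E (s + u) (s + v))) = transpose (E1 (s + u))" for u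
    unfolding E1_def by (rule integral_transpose_shift)
  have 2: "integral {0..u} (\<lambda>u. transpose (E1 (s + u))) = transpose (integral {s..s + u} E1)" for u
    by (rule integral_transpose_shift)
  have "magnus_term (\<lambda>r. transpose (H (s + r))) 2 (t - s)
      = - (1 / 2) *\<^sub>R integral {0..t - s} (\<lambda>u. integral {0..u} (\<lambda>v. transpose (E (s + u) (s + v))))"
    unfolding E_def commutator_transpose[symmetric]
    by (rule magnus_term_2[OF continuous_on_transpose_shift[OF H]]) (use \<open>s \<le> t\<close> in simp)
  then have "magnus_coeff H s t 2 = - (1 / 2) *\<^sub>R integral {s..t} E1"
    unfolding magnus_coeff_def 1 2 transpose_scaleR by (simp add: transpose_scaleR transpose_uminus)
  then show ?thesis
    by (simp only: E1_def E_def)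
qed

lemma magnus_coeff_3:
  assumes H: "continuous_on {s..t} H" and "s \<le> t"
  shows "magnus_coeff H s t 3 = (1 / 6) *\<^sub>R
    integral {s..t} (\<lambda>u. integral {s..u} (\<lambda>v. integral {s..v} (\<lambda>w.
      commutator (H u) (commutator (H v) (H w)) + commutator (H w) (commutator (H v) (H u)))))"
proof -
  define E where "E = (\<lambda>u v w.
    commutator (H u) (commutator (H v) (H w)) + commutator (H w) (commutator (H v) (H u)))"
  define E1 where "E1 = (\<lambda>u v. integral {s..v} (E u v))"
  define E2 where "E2 = (\<lambda>u. integral {s..u} (E1 u))"
  have 1: "integral {0..v} (\<lambda>w. transpose (E (s + u) (s + v) (s + w))) = transpose (E1 (s + u) (s + v))" for u v
    unfolding E1_def by (rule integral_transpose_shift)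
  have 2: "integral {0..u} (\<lambda>v. transpose (E1 (s + u) (s + v))) = transpose (E2 (s + u))" for u
    unfolding E2_def by (rule integral_transpose_shift)
  have 3: "integral {0..u} (\<lambda>u. transpose (E2 (s + u))) = transpose (integral {s..s + u} E2)" for u
    by (rule integral_transpose_shift)
  have "magnus_term (\<lambda>r. transpose (H (s + r))) 3 (t - s) = (1 / 6) *\<^sub>R
      integral {0..t - s} (\<lambda>u. integral {0..u} (\<lambda>v. integral {0..v} (\<lambda>w. transpose (E (s + u) (s + v) (s + w)))))"
    unfolding E_def transpose_add commutator_transpose[symmetric]
    by (rule magnus_term_3[OF continuous_on_transpose_shift[OF H]]) (use \<open>s \<le> t\<close> in simp)
  then have "magnus_coeff H s t 3 = (1 / 6) *\<^sub>R integral {s..t} E2"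
    unfolding magnus_coeff_def 1 2 3 by (simp add: transpose_scaleR)
  then show ?thesis
    by (simp only: E2_def E1_def E_def)
qed

section \<open>The transition matrices\<close>

text \<open>For nonnegative functions the identity is that of \<open>nn_integral_bind\<close>. Its
  finite value yields integrability of the inner integral as well as the transfer to Bochner
  integrals. Signed functions follow by splitting into positive and negative parts.\<close>

lemma integral_bind_nonneg:
  fixes f :: "'b \<Rightarrow> real"
  assumes N: "N \<in> measurable M (subprob_algebra B)" and f: "f \<in> borel_measurable B"
    and nonneg: "\<And>x. 0 \<le> f x"
    and int: "integrable (M \<bind> N) f" and intN: "\<And>y. y \<in> space M \<Longrightarrow> integrable (N y) f"
  shows "integrable M (\<lambda>y. \<integral>x. f x \<partial>N y)"
    and "(\<integral>x. f x \<partial>(M \<bind> N)) = (\<integral>y. \<integral>x. f x \<partial>N y \<partial>M)"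
proof -
  define g where "g = (\<lambda>y. \<integral>x. f x \<partial>N y)"
  have g: "g \<in> borel_measurable M"
    unfolding g_def by (rule measurable_compose[OF N integral_measurable_subprob_algebra[OF f]])
  have g0: "0 \<le> g y" for y
    by (simp add: g_def nonneg)
  have eq: "(\<integral>\<^sup>+y. ennreal (g y) \<partial>M) = ennreal (\<integral>x. f x \<partial>(M \<bind> N))"
  proof -
    have "(\<integral>\<^sup>+y. ennreal (g y) \<partial>M) = (\<integral>\<^sup>+y. \<integral>\<^sup>+x. ennreal (f x) \<partial>N y \<partial>M)"
      by (rule nn_integral_cong) (simp add: g_def nn_integral_eq_integral[OF intN] nonneg)
    also have "\<dots> = (\<integral>\<^sup>+x. ennreal (f x) \<partial>(M \<bind> N))"
      using f by (intro nn_integral_bind[symmetric, OF _ N]) simp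
    also have "\<dots> = ennreal (\<integral>x. f x \<partial>(M \<bind> N))"
      by (rule nn_integral_eq_integral[OF int]) (simp add: nonneg)
    finally show ?thesis .
  qed
  show "integrable M (\<lambda>y. \<integral>x. f x \<partial>N y)"
    using integrableI_nn_integral_finite[OF g _ eq] g0 by (simp add: g_def)
  show "(\<integral>x. f x \<partial>(M \<bind> N)) = (\<integral>y. \<integral>x. f x \<partial>N y \<partial>M)"
    using integral_eq_nn_integral[OF g] g0 eq by (simp add: g_def nonneg)
qed

lemma integral_bind_integrable:
  fixes f :: "'b \<Rightarrow> real"
  assumes N: "N \<in> measurable M (subprob_algebra B)" and f: "f \<in> borel_measurable B"
    and int: "integrable (M \<bind> N) f" and intN: "\<And>y. y \<in> space M \<Longrightarrow> integrable (N y) f"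
  shows "(\<integral>x. f x \<partial>(M \<bind> N)) = (\<integral>y. \<integral>x. f x \<partial>N y \<partial>M)"
proof -
  define f1 f2 where "f1 = (\<lambda>x. max 0 (f x))" and "f2 = (\<lambda>x. max 0 (- f x))"
  have split: "f x = f1 x - f2 x" for x
    by (simp add: f1_def f2_def max_def)
  have m: "f1 \<in> borel_measurable B" "f2 \<in> borel_measurable B"
    using f by (simp_all add: f1_def f2_def)
  have i: "integrable Q f1" "integrable Q f2" if "integrable Q f" for Q
    using that by (simp_all add: f1_def f2_def)
  note 1 = integral_bind_nonneg[OF N m(1) _ i(1)[OF int] i(1)[OF intN]]
  note 2 = integral_bind_nonneg[OF N m(2) _ i(2)[OF int] i(2)[OF intN]]
  have nn: "0 \<le> f1 x" "0 \<le> f2 x" for x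
    by (simp_all add: f1_def f2_def)
  have "(\<integral>x. f x \<partial>(M \<bind> N)) = (\<integral>x. f1 x \<partial>(M \<bind> N)) - (\<integral>x. f2 x \<partial>(M \<bind> N))"
    unfolding split by (intro Bochner_Integration.integral_diff i int)
  also have "\<dots> = (\<integral>y. (\<integral>x. f1 x \<partial>N y) - (\<integral>x. f2 x \<partial>N y) \<partial>M)"
    by (simp add: 1 2 nn)
  also have "\<dots> = (\<integral>y. \<integral>x. f x \<partial>N y \<partial>M)"
    unfolding split
    by (intro Bochner_Integration.integral_cong refl Bochner_Integration.integral_diff[symmetric] i intN)
  finally show ?thesis .
qed

lemma (in transition_function) kernel_measurable:
  assumes tu: "(t, u) \<in> time_triangle T"
  shows "(\<lambda>y. p t u y) \<in> measurable (restrict_space borel S) (subprob_algebra (restrict_space borel S))"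
proof (rule measurable_subprob_algebra)
  fix y assume "y \<in> space (restrict_space borel S)"
  then have y: "y \<in> S" by (simp add: space_restrict_space)
  then interpret P: prob_space "p t u y"
    by (rule prob_space_p[OF tu])
  show "subprob_space (p t u y)"
    by (rule P.subprob_space_axioms)
  show "sets (p t u y) = sets (restrict_space borel S)"
    by (rule sets_p[OF tu y])
next
  fix A assume A: "A \<in> sets (restrict_space borel S)"
  have "(\<lambda>y. (t, u, y)) \<in> measurable (restrict_space borel S)
      (restrict_space borel {(s, t, x). (s, t) \<in> time_triangle T \<and> x \<in> S})"
    using tu by (intro measurable_restrict_space2 measurable_restrict_space1 borel_measurable_continuous_onI
        continuous_intros) (auto simp: space_restrict_space)
  from measurable_compose[OF this measurable_p[OF A]]
  have "(\<lambda>y. measure (p t u y) A) \<in> borel_measurable (restrict_space borel S)"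
    by simp
  then have "(\<lambda>y. ennreal (measure (p t u y) A)) \<in> borel_measurable (restrict_space borel S)"
    by simp
  then show "(\<lambda>y. emeasure (p t u y) A) \<in> borel_measurable (restrict_space borel S)"
  proof (rule measurable_cong[THEN iffD1, rotated])
    fix y assume "y \<in> space (restrict_space borel S)"
    then interpret P: prob_space "p t u y"
      by (intro prob_space_p[OF tu]) (simp add: space_restrict_space)
    show "ennreal (measure (p t u y) A) = emeasure (p t u y) A"
      by (simp add: P.emeasure_eq_measure)
  qed
qed

lemma (in transition_function) space_p:
  "(s, t) \<in> time_triangle T \<Longrightarrow> x \<in> S \<Longrightarrow> space (p s t x) = S"
  using sets_eq_imp_space_eq[OF sets_p] by (simp add: space_restrict_space)

text \<open>Chapman-Kolmogorov, assumed for sets, in a form that extends to integrals of unbounded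
  functions such as polynomials.\<close>

lemma (in transition_function) p_eq_bind:
  assumes st: "(s, t) \<in> time_triangle T" and tu: "(t, u) \<in> time_triangle T" and x: "x \<in> S"
  shows "p s u x = p s t x \<bind> p t u"
proof (rule measure_eqI)
  have su: "(s, u) \<in> time_triangle T"
    using st tu by (auto simp: time_triangle_def)
  have ne: "space (p s t x) \<noteq> {}"
    using x by (simp add: space_p[OF st x]) blast
  have K: "p t u \<in> measurable (p s t x) (subprob_algebra (restrict_space borel S))"
    using kernel_measurable[OF tu] measurable_cong_sets[OF sets_p[OF st x] refl] by blast
  show "sets (p s u x) = sets (p s t x \<bind> p t u)"
    using sets_p[OF su x] sets_bind[OF sets_kernel[OF K] ne] by simp
  fix A assume "A \<in> sets (p s u x)"
  then have A: "A \<in> sets (restrict_space borel S)"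
    by (simp add: sets_p[OF su x])
  interpret su: prob_space "p s u x" by (rule prob_space_p[OF su x])
  interpret st: prob_space "p s t x" by (rule prob_space_p[OF st x])
  have tu_prob: "prob_space (p t u y)" if "y \<in> space (p s t x)" for y
    using prob_space_p[OF tu] that by (simp add: space_p[OF st x])
  have emeasure_tu: "emeasure (p t u y) A = ennreal (measure (p t u y) A)" if "y \<in> space (p s t x)" for y
    using tu_prob[OF that] by (intro finite_measure.emeasure_eq_measure prob_space.finite_measure)
  have m: "(\<lambda>y. measure (p t u y) A) \<in> borel_measurable (p s t x)"
  proof -
    have "(\<lambda>y. enn2real (emeasure (p t u y) A)) \<in> borel_measurable (p s t x)"
      using measurable_emeasure_kernel[OF K A] by simp
    then show ?thesis
      by (simp add: measure_def)
  qed
  have "integrable (p s t x) (\<lambda>y. measure (p t u y) A)"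
    by (rule st.integrable_const_bound[of _ 1])
      (use m tu_prob in \<open>auto intro!: AE_I2 prob_space.prob_le_1\<close>)
  then have "(\<integral>\<^sup>+y. ennreal (measure (p t u y) A) \<partial>p s t x) = ennreal (\<integral>y. measure (p t u y) A \<partial>p s t x)"
    by (rule nn_integral_eq_integral) simp
  also have "\<dots> = emeasure (p s u x) A"
    using Chapman_Kolmogorov[of s t u x A] st tu x A
    by (simp add: su.emeasure_eq_measure time_triangle_def)
  finally have "emeasure (p s u x) A = (\<integral>\<^sup>+y. emeasure (p t u y) A \<partial>p s t x)"
    by (subst nn_integral_cong[OF emeasure_tu]) simp_all
  then show "emeasure (p s u x) A = emeasure (p s t x \<bind> p t u) A"
    using emeasure_bind[OF ne K A] by simp
qed

lemma (in transition_function) transition_op_compose: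
  assumes st: "(s, t) \<in> time_triangle T" and tu: "(t, u) \<in> time_triangle T" and x: "x \<in> S"
    and int: "\<And>a b x. (a, b) \<in> time_triangle T \<Longrightarrow> x \<in> S \<Longrightarrow> integrable (p a b x) f"
  shows "transition_op p s u f x = transition_op p s t (transition_op p t u f) x"
proof -
  have su: "(s, u) \<in> time_triangle T"
    using st tu by (auto simp: time_triangle_def)
  have K: "p t u \<in> measurable (p s t x) (subprob_algebra (restrict_space borel S))"
    using kernel_measurable[OF tu] measurable_cong_sets[OF sets_p[OF st x] refl] by blast
  have f: "f \<in> borel_measurable (restrict_space borel S)"
    using borel_measurable_integrable[OF int[OF su x]] measurable_cong_sets[OF sets_p[OF su x] refl]
    by blast
  show ?thesis
    unfolding transition_op_def p_eq_bind[OF st tu x]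
  proof (rule integral_bind_integrable[OF K f])
    show "integrable (p s t x \<bind> p t u) f"
      using int[OF su x] by (simp add: p_eq_bind[OF st tu x])
  qed (use int[OF tu] in \<open>simp add: space_p[OF st x]\<close>)
qed

section \<open>Polynomials, continuously differentiable coefficients and representing
  matrices\<close>

lemma finite_mindices: "finite (mindices k :: ('d::finite \<Rightarrow> nat) set)"
proof (rule finite_subset)
  show "mindices k \<subseteq> (PiE UNIV (\<lambda>_ :: 'd. {..k}))"
  proof
    fix l :: "'d \<Rightarrow> nat"
    assume "l \<in> mindices k"
    then have "l i \<le> k" for i
      using member_le_sum[of i UNIV l] by (simp add: mindices_def)
    then show "l \<in> PiE UNIV (\<lambda>_. {..k})"
      by auto
  qed
qed (simp add: finite_PiE)

lemma monomial_in_polys_on: "l \<in> mindices k \<Longrightarrow> monomial l \<in> polys_on S k"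
  unfolding polys_on_def
  by (rule CollectI, rule exI[of _ "\<lambda>l'. if l' = l then 1 else 0"])
    (simp add: if_distrib if_distribR finite_mindices cong: if_cong)

lemma C1_on_cmult: "C1_on D f \<Longrightarrow> C1_on D (\<lambda>z. f z * c)"
  unfolding C1_on_def
proof (elim exE conjE)
  fix a b
  assume *: "continuous_on D a" "continuous_on D b"
    "\<forall>z\<in>D. (f has_derivative (\<lambda>(h, k). a z * h + b z * k)) (at z within D)"
  show "\<exists>a b. continuous_on D a \<and> continuous_on D b \<and>
      (\<forall>z\<in>D. ((\<lambda>z. f z * c) has_derivative (\<lambda>(h, k). a z * h + b z * k)) (at z within D))"
  proof (rule exI[of _ "\<lambda>z. a z * c"], rule exI[of _ "\<lambda>z. b z * c"],
      intro conjI ballI continuous_intros *)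
    fix z assume "z \<in> D"
    then have "((\<lambda>z. f z * c) has_derivative (\<lambda>x. (case x of (h, k) \<Rightarrow> a z * h + b z * k) * c)) (at z within D)"
      using * by (intro has_derivative_mult_left) blast
    then show "((\<lambda>z. f z * c) has_derivative (\<lambda>(h, k). a z * c * h + b z * c * k)) (at z within D)"
      by (rule has_derivative_eq_rhs) (auto simp: algebra_simps)
  qed
qed

lemma C1_on_add: "C1_on D f \<Longrightarrow> C1_on D g \<Longrightarrow> C1_on D (\<lambda>z. f z + g z)"
  unfolding C1_on_def
proof (elim exE conjE)
  fix a b a' b'
  assume *: "continuous_on D a" "continuous_on D b" "continuous_on D a'" "continuous_on D b'"
    "\<forall>z\<in>D. (f has_derivative (\<lambda>(h, k). a z * h + b z * k)) (at z within D)"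
    "\<forall>z\<in>D. (g has_derivative (\<lambda>(h, k). a' z * h + b' z * k)) (at z within D)"
  show "\<exists>a b. continuous_on D a \<and> continuous_on D b \<and>
      (\<forall>z\<in>D. ((\<lambda>z. f z + g z) has_derivative (\<lambda>(h, k). a z * h + b z * k)) (at z within D))"
  proof (rule exI[of _ "\<lambda>z. a z + a' z"], rule exI[of _ "\<lambda>z. b z + b' z"],
      intro conjI ballI continuous_intros *)
    fix z assume "z \<in> D"
    then have "((\<lambda>z. f z + g z) has_derivative (\<lambda>x. (case x of (h, k) \<Rightarrow> a z * h + b z * k) +
        (case x of (h, k) \<Rightarrow> a' z * h + b' z * k))) (at z within D)"
      using * by (intro has_derivative_add) blast+
    then show "((\<lambda>z. f z + g z) has_derivative (\<lambda>(h, k). (a z + a' z) * h + (b z + b' z) * k)) (at z within D)"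
      by (rule has_derivative_eq_rhs) (auto simp: algebra_simps)
  qed
qed

lemma C1_on_0: "C1_on D (\<lambda>z. 0)"
proof -
  have "(\<lambda>(h :: real, k :: real). 0 * h + 0 * k) = (\<lambda>_. 0 :: real)"
    by auto
  then show ?thesis
    unfolding C1_on_def
    by (intro exI[of _ "\<lambda>_. 0"] conjI ballI continuous_on_const) (simp only: has_derivative_const)
qed

lemma C1_on_sum: "(\<And>i. i \<in> I \<Longrightarrow> C1_on D (f i)) \<Longrightarrow> C1_on D (\<lambda>z. \<Sum>i\<in>I. f i z)"
  by (induction I rule: infinite_finite_induct) (simp_all add: C1_on_0 C1_on_add)

text \<open>Linear independence of the basis makes the definite description unique, so exhibiting
  coefficients is enough.\<close>

lemma representing_matrix_eq:
  assumes e: "is_basis_on S V e" and A: "\<And>j x. x \<in> S \<Longrightarrow> L (e j) x = (\<Sum>i\<in>UNIV. A $ i $ j * e i x)"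
  shows "representing_matrix S e L = A"
  unfolding representing_matrix_def
proof (rule the_equality)
  show "\<forall>j. \<forall>x\<in>S. L (e j) x = (\<Sum>i\<in>UNIV. A $ i $ j * e i x)"
    using A by blast
  fix B assume B: "\<forall>j. \<forall>x\<in>S. L (e j) x = (\<Sum>i\<in>UNIV. B $ i $ j * e i x)"
  show "B = A"
  proof -
    have "\<forall>i. B $ i $ j - A $ i $ j = 0" for j
    proof -
      have "\<forall>x\<in>S. (\<Sum>i\<in>UNIV. (B $ i $ j - A $ i $ j) * e i x) = 0"
        using A B by (simp add: left_diff_distrib sum_subtractf)
      with e show ?thesis
        unfolding is_basis_on_def by (elim conjE allE[of _ "\<lambda>i. B $ i $ j - A $ i $ j"]) blast
    qed
    then show ?thesis
      by (simp add: vec_eq_iff)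
  qed
qed

lemma matrix_has_vector_derivativeI:
  fixes f :: "real \<Rightarrow> real ^ 'n ^ 'm"
  assumes "\<And>i j. ((\<lambda>r. f r $ i $ j) has_real_derivative d $ i $ j) F"
  shows "(f has_vector_derivative d) F"
proof -
  have expand: "A = (\<Sum>i\<in>UNIV. \<Sum>j\<in>UNIV. (A $ i $ j) *\<^sub>R axis i (axis j 1))" for A :: "real ^ 'n ^ 'm"
    by (simp add: vec_eq_iff axis_def if_distrib if_distribR sum.If_cases cong: if_cong)
  have "((\<lambda>r. \<Sum>i\<in>UNIV. \<Sum>j\<in>UNIV. (f r $ i $ j) *\<^sub>R (axis i (axis j 1) :: real ^ 'n ^ 'm)) has_vector_derivative
      (\<Sum>i\<in>UNIV. \<Sum>j\<in>UNIV. (d $ i $ j) *\<^sub>R axis i (axis j 1))) F"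
    using assms unfolding has_real_derivative_iff_has_vector_derivative
    by (intro has_vector_derivative_sum bounded_linear.has_vector_derivative[OF bounded_linear_scaleR_left])
  then show ?thesis
    by (simp only: expand[symmetric])
qed

context transition_function
begin

lemma transition_op_refl:
  assumes "0 \<le> t" "t \<le> T" "x \<in> S" "integrable (p t t x) f"
  shows "transition_op p t t f x = f x"
proof -
  have "f \<in> borel_measurable (return (restrict_space borel S) x)"
    using borel_measurable_integrable[OF assms(4)] by (simp add: p_refl[OF assms(1-3)])
  then have "f \<in> borel_measurable (restrict_space borel S)"
    by simp
  then show ?thesis
    unfolding transition_op_def p_refl[OF assms(1-3)]
    using \<open>x \<in> S\<close> by (intro integral_return) (simp_all add: space_restrict_space)
qed

text \<open>The monomials may be linearly dependent on \<open>S\<close>, so their coefficients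
  \<open>\<alpha>\<close> are not matrix entries. Expanding each monomial in the basis with constant
  coefficients turns them into entries that are still continuously differentiable.\<close>

lemma transition_matrix_C1:
  fixes e :: "'n::finite \<Rightarrow> real ^ 'd \<Rightarrow> real"
  assumes poly: "m_polynomial T S p k" and e: "is_basis_on S (polys_on S k) e"
  obtains Q :: "real \<times> real \<Rightarrow> real ^ 'n ^ 'n"
  where "\<And>i j. C1_on (time_triangle T) (\<lambda>z. Q z $ i $ j)"
    and "\<And>a b j x. (a, b) \<in> time_triangle T \<Longrightarrow> x \<in> S \<Longrightarrow>
      transition_op p a b (e j) x = (\<Sum>i\<in>UNIV. Q (a, b) $ i $ j * e i x)"
proof -
  have ej: "e j \<in> polys_on S k" for j
    using e by (simp add: is_basis_on_def)
  have "\<forall>j. \<exists>\<alpha>. (\<forall>l\<in>mindices k. C1_on (time_triangle T) (\<alpha> l)) \<and>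
     (\<forall>(a, b)\<in>time_triangle T. \<forall>x\<in>S. transition_op p a b (e j) x = (\<Sum>l\<in>mindices k. \<alpha> l (a, b) * monomial l x))"
  proof
    fix j
    have "(\<lambda>(s, t, x). transition_op p s t (e j) x) \<in> time_polys_on T S k"
      using poly ej[of j] unfolding m_polynomial_def by blast
    then show "\<exists>\<alpha>. (\<forall>l\<in>mindices k. C1_on (time_triangle T) (\<alpha> l)) \<and>
     (\<forall>(a, b)\<in>time_triangle T. \<forall>x\<in>S. transition_op p a b (e j) x = (\<Sum>l\<in>mindices k. \<alpha> l (a, b) * monomial l x))"
      by (simp add: time_polys_on_def)
  qed
  then obtain \<alpha> where "\<forall>j. (\<forall>l\<in>mindices k. C1_on (time_triangle T) (\<alpha> j l)) \<and>
     (\<forall>(a, b)\<in>time_triangle T. \<forall>x\<in>S. transition_op p a b (e j) x = (\<Sum>l\<in>mindices k. \<alpha> j l (a, b) * monomial l x))"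
    by (rule choice[THEN exE])
  then have \<alpha>: "\<And>j l. l \<in> mindices k \<Longrightarrow> C1_on (time_triangle T) (\<alpha> j l)"
    and \<alpha>_eq: "\<And>j a b x. (a, b) \<in> time_triangle T \<Longrightarrow> x \<in> S \<Longrightarrow>
      transition_op p a b (e j) x = (\<Sum>l\<in>mindices k. \<alpha> j l (a, b) * monomial l x)"
    by blast+
  have "\<forall>l\<in>mindices k. \<exists>c. \<forall>x\<in>S. monomial l x = (\<Sum>i\<in>UNIV. c i * e i x)"
    using e monomial_in_polys_on unfolding is_basis_on_def by blast
  then obtain c where c: "\<And>l x. l \<in> mindices k \<Longrightarrow> x \<in> S \<Longrightarrow> monomial l x = (\<Sum>i\<in>UNIV. c l i * e i x)"
    by metis
  show ?thesis
  proof (rule that[of "\<lambda>z. \<chi> i j. \<Sum>l\<in>mindices k. \<alpha> j l z * c l i"])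
    fix i j
    show "C1_on (time_triangle T) (\<lambda>z. (\<chi> i j. \<Sum>l\<in>mindices k. \<alpha> j l z * c l i) $ i $ j)"
      by (simp add: C1_on_sum C1_on_cmult \<alpha>)
  next
    fix a b j x assume ab: "(a, b) \<in> time_triangle T" and x: "x \<in> S"
    have "transition_op p a b (e j) x = (\<Sum>l\<in>mindices k. \<Sum>i\<in>UNIV. \<alpha> j l (a, b) * c l i * e i x)"
      by (simp add: \<alpha>_eq[OF ab x] c x sum_distrib_left mult.assoc)
    also have "\<dots> = (\<Sum>i\<in>UNIV. \<Sum>l\<in>mindices k. \<alpha> j l (a, b) * c l i * e i x)"
      by (rule sum.swap)
    finally show "transition_op p a b (e j) x
        = (\<Sum>i\<in>UNIV. (\<chi> i j. \<Sum>l\<in>mindices k. \<alpha> j l (a, b) * c l i) $ i $ j * e i x)"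
      by (simp add: sum_distrib_right)
  qed
qed

text \<open>\<open>G u\<close> is the derivative of \<open>P u t\<close> in \<open>t\<close> on the
  diagonal \<open>t = u\<close>. Before T it is a right derivative there and so represents the
  generator, and it stays continuous up to T. The semigroup property carries the diagonal derivative
  to all start times: d/dt P = P G.\<close>

lemma transition_matrix_equation:
  fixes e :: "'n::finite \<Rightarrow> real ^ 'd \<Rightarrow> real" and P :: "real \<Rightarrow> real \<Rightarrow> real ^ 'n ^ 'n"
    and H :: "real \<Rightarrow> real ^ 'n ^ 'n"
  assumes poly: "m_polynomial T S p k" and e: "is_basis_on S (polys_on S k) e"
    and P: "\<And>a b. (a, b) \<in> time_triangle T \<Longrightarrow> P a b = representing_matrix S e (transition_op p a b)"
    and H: "\<And>u. 0 \<le> u \<Longrightarrow> u < T \<Longrightarrow> H u = representing_matrix S e (generator S p u)"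
  obtains G where "continuous_on {0..T} G" and "\<And>u. 0 \<le> u \<Longrightarrow> u < T \<Longrightarrow> H u = G u"
    and "\<And>s. 0 \<le> s \<Longrightarrow> s \<le> T \<Longrightarrow> continuous_on {s..T} (P s)"
    and "\<And>s t. 0 \<le> s \<Longrightarrow> s \<le> t \<Longrightarrow> t \<le> T \<Longrightarrow>
      P s t = mat 1 + integral {s..t} (\<lambda>u. P s u ** G u)"
proof -
  obtain Q :: "real \<times> real \<Rightarrow> real ^ 'n ^ 'n"
    where C1: "\<And>i j. C1_on (time_triangle T) (\<lambda>z. Q z $ i $ j)"
    and Q: "\<And>a b j x. (a, b) \<in> time_triangle T \<Longrightarrow> x \<in> S \<Longrightarrow>
      transition_op p a b (e j) x = (\<Sum>i\<in>UNIV. Q (a, b) $ i $ j * e i x)"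
    using transition_matrix_C1[OF poly e] by blast
  have PQ: "P a b = Q (a, b)" if "(a, b) \<in> time_triangle T" for a b
    unfolding P[OF that] by (rule representing_matrix_eq[OF e]) (rule Q[OF that])
  have int: "integrable (p a b x) (e j)" if "(a, b) \<in> time_triangle T" "x \<in> S" for a b x j
    using poly e that unfolding m_polynomial_def is_basis_on_def by blast
  \<comment> \<open>\<open>b i j\<close> will be the partial derivative of an entry in the end time,
    chosen as one continuous function on the triangle.\<close>
  have "\<forall>i j. \<exists>b. continuous_on (time_triangle T) b \<and> (\<forall>z\<in>time_triangle T.
      \<exists>a. ((\<lambda>z. Q z $ i $ j) has_derivative (\<lambda>(h, k). a * h + b z * k)) (at z within time_triangle T))"
    using C1 unfolding C1_on_def by blast
  then obtain b where b: "\<And>i j. continuous_on (time_triangle T) (b i j)"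
    and db: "\<And>i j z. z \<in> time_triangle T \<Longrightarrow>
      \<exists>a. ((\<lambda>z. Q z $ i $ j) has_derivative (\<lambda>(h, k). a * h + b i j z * k)) (at z within time_triangle T)"
    by metis
  define D where "D = (\<lambda>s t. \<chi> i j. b i j (s, t))"
  define G where "G = (\<lambda>u. D u u)"
  have dP_entry: "((\<lambda>t. P s t $ i $ j) has_real_derivative b i j (s, t)) (at t within {s..T})"
    if st: "(s, t) \<in> time_triangle T" for s t i j
  proof -
    obtain a where a: "((\<lambda>z. Q z $ i $ j) has_derivative (\<lambda>(h, k). a * h + b i j (s, t) * k))
        (at (s, t) within time_triangle T)"
      using db[OF st] by blast
    have sub: "Pair s ` {s..T} \<subseteq> time_triangle T"
      using st by (auto simp: time_triangle_def)
    have "(Pair s has_derivative (\<lambda>k. (0, k))) (at t within {s..T})"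
      by (auto intro!: derivative_eq_intros)
    from has_derivative_in_compose[OF this has_derivative_subset[OF a sub]]
    have "((\<lambda>t. Q (s, t) $ i $ j) has_derivative (*) (b i j (s, t))) (at t within {s..T})"
      by (simp add: case_prod_beta)
    then have "((\<lambda>t. Q (s, t) $ i $ j) has_real_derivative b i j (s, t)) (at t within {s..T})"
      by (simp add: has_field_derivative_def)
    then show ?thesis
      by (rule has_field_derivative_transform_within[OF _ zero_less_one])
        (use st PQ in \<open>auto simp: time_triangle_def\<close>)
  qed
  have dP: "(P s has_vector_derivative D s t) (at t within {s..T})" if "(s, t) \<in> time_triangle T" for s t
    by (rule matrix_has_vector_derivativeI) (simp add: D_def dP_entry[OF that])
  have HG: "H u = G u" if u: "0 \<le> u" "u < T" for u
    unfolding H[OF u]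
  proof (rule representing_matrix_eq[OF e])
    fix j x assume x: "x \<in> S"
    have uu: "(u, u) \<in> time_triangle T"
      using u by (simp add: time_triangle_def)
    have near: "eventually (\<lambda>h. (u, u + h) \<in> time_triangle T) (at_right 0)"
      using eventually_at_right_less[of 0] eventually_at_right_field[of "\<lambda>h. h < T - u" 0] u
      by (auto simp: time_triangle_def eventually_at_right_field intro: exI[of _ "T - u"])
    have lim: "((\<lambda>h. (transition_op p u (u + h) (e j) x - e j x) / h) \<longlongrightarrow>
        (\<Sum>i\<in>UNIV. G u $ i $ j * e i x)) (at_right 0)" if x: "x \<in> S" for x
    proof -
      have "((\<lambda>h. (P u (u + h) $ i $ j - P u u $ i $ j) / h) \<longlongrightarrow> b i j (u, u)) (at_right 0)" for i
        using dP_entry[OF uu, of i j] u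
        by (simp add: has_field_derivative_iff at_within_Icc_at_right filterlim_at_right_to_0[of _ _ u] add.commute)
      then have "((\<lambda>h. \<Sum>i\<in>UNIV. (P u (u + h) $ i $ j - P u u $ i $ j) / h * e i x) \<longlongrightarrow>
          (\<Sum>i\<in>UNIV. b i j (u, u) * e i x)) (at_right 0)"
        by (intro tendsto_intros)
      then have "((\<lambda>h. \<Sum>i\<in>UNIV. (P u (u + h) $ i $ j - P u u $ i $ j) / h * e i x) \<longlongrightarrow>
          (\<Sum>i\<in>UNIV. G u $ i $ j * e i x)) (at_right 0)"
        by (simp add: G_def D_def)
      moreover have "eventually (\<lambda>h. (\<Sum>i\<in>UNIV. (P u (u + h) $ i $ j - P u u $ i $ j) / h * e i x)
          = (transition_op p u (u + h) (e j) x - e j x) / h) (at_right 0)"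
        using near
      proof eventually_elim
        case (elim h)
        have "e j x = (\<Sum>i\<in>UNIV. P u u $ i $ j * e i x)"
          using Q[OF uu x, of j] transition_op_refl[OF _ _ x int[OF uu x], of j] u by (simp add: PQ[OF uu])
        then show ?case
          by (simp add: Q[OF elim x] PQ[OF elim] sum_subtractf[symmetric] sum_divide_distrib
              left_diff_distrib[symmetric] diff_divide_distrib[symmetric])
      qed
      ultimately show ?thesis
        by (rule Lim_transform_eventually)
    qed
    have "e j \<in> borel_measurable (restrict_space borel S)"
      using borel_measurable_integrable[OF int[OF uu x]] measurable_cong_sets[OF sets_p[OF uu x] refl]
      by blast
    moreover have "eventually (\<lambda>h. integrable (p u (u + h) y) (e j)) (at_right 0)" if "y \<in> S" for y
      using near by eventually_elim (rule int[OF _ that])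
    ultimately have "e j \<in> generator_domain S p u"
      unfolding generator_domain_def mem_Collect_eq using lim by blast
    then show "generator S p u (e j) x = (\<Sum>i\<in>UNIV. G u $ i $ j * e i x)"
      unfolding generator_def using tendsto_Lim[OF _ lim[OF x]] by simp
  qed
  have semigroup: "P s u = P s t ** P t u" if s: "0 \<le> s" "s \<le> t" "t \<le> u" "u \<le> T" for s t u
  proof -
    have st: "(s, t) \<in> time_triangle T" and tu: "(t, u) \<in> time_triangle T" and su: "(s, u) \<in> time_triangle T"
      using s by (auto simp: time_triangle_def)
    show ?thesis
      unfolding P[OF su]
    proof (rule representing_matrix_eq[OF e])
      fix j x assume x: "x \<in> S"
      have "transition_op p s u (e j) x = transition_op p s t (transition_op p t u (e j)) x"
        by (rule transition_op_compose[OF st tu x int])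
      also have "\<dots> = transition_op p s t (\<lambda>y. \<Sum>l\<in>UNIV. P t u $ l $ j * e l y) x"
        unfolding transition_op_def[of p s t]
        by (intro Bochner_Integration.integral_cong refl)
          (simp add: Q[OF tu] PQ[OF tu] space_p[OF st x])
      also have "\<dots> = (\<Sum>l\<in>UNIV. P t u $ l $ j * transition_op p s t (e l) x)"
        unfolding transition_op_def[of p s t] by (simp add: int[OF st x])
      also have "\<dots> = (\<Sum>l\<in>UNIV. \<Sum>i\<in>UNIV. P s t $ i $ l * P t u $ l $ j * e i x)"
        by (simp add: Q[OF st x] PQ[OF st] sum_distrib_left mult_ac)
      also have "\<dots> = (\<Sum>i\<in>UNIV. (P s t ** P t u) $ i $ j * e i x)"
        by (subst sum.swap) (simp add: matrix_matrix_mult_def sum_distrib_right)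
      finally show "transition_op p s u (e j) x = (\<Sum>i\<in>UNIV. (P s t ** P t u) $ i $ j * e i x)" .
    qed
  qed
  have refl: "P t t = mat 1" if t: "0 \<le> t" "t \<le> T" for t
  proof -
    have tt: "(t, t) \<in> time_triangle T"
      using t by (simp add: time_triangle_def)
    show ?thesis
      unfolding P[OF tt]
    proof (rule representing_matrix_eq[OF e])
      fix j x assume x: "x \<in> S"
      show "transition_op p t t (e j) x = (\<Sum>i\<in>UNIV. mat 1 $ i $ j * e i x)"
        unfolding transition_op_refl[OF t x int[OF tt x]]
        by (simp add: mat_def if_distrib if_distribR cong: if_cong)
    qed
  qed
  \<comment> \<open>Both sides are derivatives of \<open>P s\<close> at \<open>t\<close> from the
    right, the second one through \<open>P s u = P s t ** P t u\<close>. One-sided derivatives are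
    unique as long as \<open>t < T\<close>.\<close>
  have D_eq: "D s t = P s t ** G t" if s: "0 \<le> s" "s \<le> t" "t < T" for s t
  proof (rule vector_derivative_unique_within[of t "{t..T}" "P s"])
    show "at t within {t..T} \<noteq> bot"
      using s by (simp add: at_within_Icc_at_right)
    show "(P s has_vector_derivative D s t) (at t within {t..T})"
      by (rule has_vector_derivative_within_subset[OF dP]) (use s in \<open>auto simp: time_triangle_def\<close>)
    have "(P t has_vector_derivative G t) (at t within {t..T})"
      unfolding G_def by (rule dP) (use s in \<open>auto simp: time_triangle_def\<close>)
    then have "((\<lambda>u. P s t ** P t u) has_vector_derivative P s t ** G t) (at t within {t..T})"
      by (rule bounded_linear.has_vector_derivative[OF
            bounded_bilinear.bounded_linear_right[OF bounded_bilinear_matrix_mult]])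
    then show "(P s has_vector_derivative P s t ** G t) (at t within {t..T})"
    proof (rule has_vector_derivative_transform[rotated -1])
      show "t \<in> {t..T}" using s by simp
      show "P s u = P s t ** P t u" if "u \<in> {t..T}" for u
        by (rule semigroup) (use that s in auto)
    qed
  qed
  have contP: "continuous_on {s..T} (P s)" if s: "0 \<le> s" "s \<le> T" for s
    unfolding continuous_on_eq_continuous_within
    by (intro ballI has_vector_derivative_continuous[OF dP]) (use s in \<open>auto simp: time_triangle_def\<close>)
  show ?thesis
  proof (rule that[of G])
    have "continuous_on {0..T} (\<lambda>u. b i j (u, u))" for i j
      by (rule continuous_on_compose2[OF b]) (auto intro!: continuous_intros simp: time_triangle_def)
    then show "continuous_on {0..T} G"
      unfolding G_def D_def by (intro continuous_on_vec_lambda)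
    fix s t assume s: "0 \<le> s" "s \<le> t" "t \<le> T"
    \<comment> \<open>The interior version of the fundamental theorem is used because the
      differential equation is available only before T, while \<open>t\<close> may equal T.\<close>
    have "((\<lambda>u. P s u ** G u) has_integral P s t - P s s) {s..t}"
    proof (rule fundamental_theorem_of_calculus_interior[OF \<open>s \<le> t\<close>])
      show "continuous_on {s..t} (P s)"
        by (rule continuous_on_subset[OF contP]) (use s in auto)
      fix u assume u: "u \<in> {s<..<t}"
      then have "(P s has_vector_derivative D s u) (at u)"
        using dP[of s u] s by (simp add: time_triangle_def at_within_Icc_at)
      then show "(P s has_vector_derivative P s u ** G u) (at u)"
        using D_eq[of s u] u s by simp
    qed
    then show "P s t = mat 1 + integral {s..t} (\<lambda>u. P s u ** G u)"
      using s by (simp add: integral_unique refl)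
  qed (use HG contP in auto)
qed

end

section \<open>The spectral norm under complexification and transposition\<close>

lemma norm_complexify:
  fixes x :: "real ^ 'n"
  shows "norm (\<chi> i. complex_of_real (x $ i)) = norm x"
  by (simp add: norm_vec_def)

text \<open>A real matrix acts separately on real and imaginary parts, whose squared norms add up.
  Hence complex vectors are stretched no more than real ones.\<close>

lemma norm_cmat_of_real: "norm (cmat_of_real A) = spectral_norm A"
proof (rule antisym)
  show "spectral_norm A \<le> norm (cmat_of_real A)"
    unfolding spectral_norm_def
  proof (rule onorm_le)
    fix x :: "real ^ 'a"
    define cx where "cx = (\<chi> i. complex_of_real (x $ i))"
    have "mat_of (cmat_of_real A) *v cx = (\<chi> i. complex_of_real ((A *v x) $ i))"
      by (simp add: vec_eq_iff mat_of_eq_entry matrix_vector_mult_def cx_def)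
    then have "norm (A *v x) = norm (mat_of (cmat_of_real A) *v cx)"
      by (simp only: norm_complexify)
    also have "\<dots> \<le> norm (cmat_of_real A) * norm cx"
      by (simp add: norm_cmat.rep_eq norm_matrix_vector_mult_complex)
    finally show "norm (A *v x) \<le> norm (cmat_of_real A) * norm x"
      by (simp add: cx_def norm_complexify)
  qed
  show "norm (cmat_of_real A) \<le> spectral_norm A"
    unfolding norm_cmat.rep_eq
  proof (rule onorm_le)
    fix x :: "complex ^ 'a"
    define u v where "u = (\<chi> i. Re (x $ i))" and "v = (\<chi> i. Im (x $ i))"
    have norm_split: "(norm y)\<^sup>2 = (norm (\<chi> i. Re (y $ i)))\<^sup>2 + (norm (\<chi> i. Im (y $ i)))\<^sup>2"
      for y :: "complex ^ 'a"
      by (simp add: norm_vec_def L2_set_def sum_nonneg cmod_power2 sum.distrib)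
    define y where "y = mat_of (cmat_of_real A) *v x"
    have y: "(\<chi> i. Re (y $ i)) = A *v u" "(\<chi> i. Im (y $ i)) = A *v v"
      by (simp_all add: y_def vec_eq_iff mat_of_eq_entry matrix_vector_mult_def u_def v_def)
    have le: "norm (A *v w) \<le> spectral_norm A * norm w" for w
      unfolding spectral_norm_def by (rule onorm[OF matrix_vector_mul_bounded_linear])
    have "(norm y)\<^sup>2 \<le> (spectral_norm A * norm u)\<^sup>2 + (spectral_norm A * norm v)\<^sup>2"
      unfolding norm_split[of y] y by (intro add_mono power_mono le norm_ge_zero)
    also have "\<dots> = (spectral_norm A * norm x)\<^sup>2"
      by (simp add: norm_split[of x] u_def v_def power_mult_distrib distrib_left)
    finally show "norm (mat_of (cmat_of_real A) *v x) \<le> spectral_norm A * norm x"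
      unfolding y_def[symmetric]
      by (rule power2_le_imp_le)
        (simp add: spectral_norm_def onorm_pos_le[OF matrix_vector_mul_bounded_linear])
  qed
qed

text \<open>With y the image of \<open>x\<close> under the transpose,
  \<open>y \<bullet> y = x \<bullet> (A *v y)\<close>; apply Cauchy-Schwarz and cancel one factor
  \<open>norm y\<close>.\<close>

lemma spectral_norm_transpose_le: "spectral_norm (transpose A) \<le> spectral_norm A"
  unfolding spectral_norm_def[of "transpose A"]
proof (rule onorm_le)
  fix x :: "real ^ 'a"
  define y where "y = transpose A *v x"
  have "norm y * norm y = y \<bullet> y"
    by (simp add: power2_norm_eq_inner[symmetric] power2_eq_square)
  also have "\<dots> = x \<bullet> (A *v y)"
    unfolding y_def by (metis dot_lmul_matrix vector_transpose_matrix transpose_transpose)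
  also have "\<dots> \<le> norm x * norm (A *v y)"
    by (rule norm_cauchy_schwarz)
  also have "\<dots> \<le> norm x * (spectral_norm A * norm y)"
    unfolding spectral_norm_def
    by (intro mult_left_mono onorm[OF matrix_vector_mul_bounded_linear] norm_ge_zero)
  finally have "norm y * norm y \<le> (spectral_norm A * norm x) * norm y"
    by (simp add: mult_ac)
  then show "norm y \<le> spectral_norm A * norm x"
    by (cases "norm y = 0")
      (simp_all add: spectral_norm_def onorm_pos_le[OF matrix_vector_mul_bounded_linear])
qed

lemma continuous_on_spectral_norm:
  "continuous_on D f \<Longrightarrow> continuous_on D (\<lambda>r. spectral_norm (f r))"
  unfolding norm_cmat_of_real[symmetric]
  by (intro continuous_on_norm bounded_linear.continuous_on[OF bounded_linear_cmat_of_real])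

lemma magnus_coeff_cong:
  assumes "s \<le> t" and "negligible N" and HH: "\<And>u. u \<in> {s..t} - N \<Longrightarrow> H u = H' u"
  shows "magnus_coeff H s t n = magnus_coeff H' s t n"
proof -
  have "magnus_term (\<lambda>r. transpose (H (s + r))) n (t - s)
      = magnus_term (\<lambda>r. transpose (H' (s + r))) n (t - s)"
  proof (rule magnus_cong(2)[of "(\<lambda>x. - s + x) ` N"])
    show "negligible ((\<lambda>x. - s + x) ` N)"
      by (rule negligible_translation[OF \<open>negligible N\<close>])
    fix r assume r: "r \<in> {0..t - s} - (\<lambda>x. - s + x) ` N"
    have "s + r \<notin> N"
      using r by (auto simp: image_iff)
    then show "transpose (H (s + r)) = transpose (H' (s + r))"
      using r HH[of "s + r"] by simp
  qed (use \<open>s \<le> t\<close> in simp)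
  then show ?thesis
    by (simp add: magnus_coeff_def)
qed

text \<open>Transposing and shifting time to 0 turns P' = P G into U' = A U, to which
  \<open>magnus_convergence\<close> applies; \<open>mat_exp\<close> and the summation commute with
  transposition.\<close>

lemma magnus_coeff_convergence:
  fixes P :: "real \<Rightarrow> real ^ 'n ^ 'n"
  assumes "s \<le> t" and G: "continuous_on {s..t} G"
    and pi: "integral {s..t} (\<lambda>u. spectral_norm (G u)) < pi"
    and P: "continuous_on {s..t} P"
    and P_eq: "\<And>u. u \<in> {s..t} \<Longrightarrow> P u = mat 1 + integral {s..u} (\<lambda>q. P q ** G q)"
  shows "summable (\<lambda>n. norm (magnus_coeff G s t (Suc n)))"
    and "P t = mat_exp (\<Sum>n. magnus_coeff G s t (Suc n))"
proof -
  define A where "A = (\<lambda>r. transpose (G (s + r)))"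
  define U where "U = (\<lambda>r. transpose (P (s + r)))"
  define R where "R = t - s"
  have A: "continuous_on {0..R} A" and U: "continuous_on {0..R} U"
    unfolding A_def U_def R_def by (intro continuous_on_transpose_shift G P)+
  have a: "continuous_on {0..R} (\<lambda>r. spectral_norm (G (s + r)))"
    unfolding R_def by (intro continuous_on_spectral_norm continuous_on_compose2[OF G] continuous_intros) auto
  have Aa: "norm (cmat_of_real (A r)) \<le> spectral_norm (G (s + r))" for r
    unfolding norm_cmat_of_real A_def by (rule spectral_norm_transpose_le)
  have pi': "integral {0..R} (\<lambda>r. spectral_norm (G (s + r))) < pi"
    using pi integral_shift[of R "\<lambda>u. spectral_norm (G u)" s] by (simp add: R_def)
  have U_eq: "U r = mat 1 + integral {0..r} (\<lambda>q. A q ** U q)" if r: "r \<in> {0..R}" for r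
  proof -
    have "U r = mat 1 + transpose (integral {s..s + r} (\<lambda>q. P q ** G q))"
      using P_eq[of "s + r"] r by (simp add: U_def R_def transpose_add)
    also have "transpose (integral {s..s + r} (\<lambda>q. P q ** G q))
        = integral {0..r} (\<lambda>q. transpose (P (s + q) ** G (s + q)))"
      by (rule integral_transpose_shift[symmetric])
    also have "\<dots> = integral {0..r} (\<lambda>q. A q ** U q)"
      by (simp only: matrix_transpose_mul A_def U_def)
    finally show ?thesis .
  qed
  have R: "0 \<le> R"
    using \<open>s \<le> t\<close> by (simp add: R_def)
  note conv = magnus_convergence[OF R A a Aa pi' U U_eq]
  have c: "magnus_coeff G s t n = transpose (magnus_term A n R)" for n
    by (simp add: magnus_coeff_def A_def R_def)
  obtain K where K: "\<And>X :: real ^ 'n ^ 'n. norm (transpose X) \<le> norm X * K"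
    using bounded_linear.bounded[OF bounded_linear_transpose] by blast
  have summ: "summable (\<lambda>n. norm (magnus_term A (Suc n) R))"
    using iffD2[OF summable_Suc_iff[of "\<lambda>n. norm (magnus_term A n R)"] conv(1)] .
  show "summable (\<lambda>n. norm (magnus_coeff G s t (Suc n)))"
    by (rule summable_comparison_test[OF _ summable_mult2[OF summ, of K]]) (simp add: c K)
  have "(\<Sum>n. magnus_coeff G s t (Suc n)) = transpose (\<Sum>n. magnus_term A (Suc n) R)"
    unfolding c by (rule bounded_linear.suminf[OF bounded_linear_transpose summable_norm_cancel[OF summ], symmetric])
  \<comment> \<open>The Magnus term with index 0 is 0, so the series may start at 1.\<close>
  also have "(\<Sum>n. magnus_term A (Suc n) R) = (\<Sum>n. magnus_term A n R)"
    using suminf_split_head[OF summable_norm_cancel[OF conv(1)]] by simp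
  finally have "mat_exp (\<Sum>n. magnus_coeff G s t (Suc n)) = transpose (U R)"
    by (simp only: mat_exp_transpose conv(2))
  then show "P t = mat_exp (\<Sum>n. magnus_coeff G s t (Suc n))"
    by (simp add: U_def R_def)
qed

text \<open>Dependence of the coefficients on \<open>H\<close> between \<open>s\<close> and
  \<open>t\<close> alone is expressed by the clause over all \<open>H'\<close> that agree with
  \<open>H\<close> there. For \<open>s \<le> T\<close> the norm integral in the hypothesis is a
  genuine one, not a default 0, since \<open>H\<close> agrees with a continuous function except at
  T.\<close>

theorem theorem7p3:
  fixes T s :: real and S :: "(real ^ 'd) set"
    and p :: "real \<Rightarrow> real \<Rightarrow> real ^ 'd \<Rightarrow> (real ^ 'd) measure"
    and M :: "'w measure" and F :: "real \<Rightarrow> 'w measure" and X :: "real \<Rightarrow> 'w \<Rightarrow> real ^ 'd"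
    and k :: nat and e :: "'n::finite \<Rightarrow> real ^ 'd \<Rightarrow> real"
    and P :: "real \<Rightarrow> real \<Rightarrow> real ^ 'n ^ 'n" and H :: "real \<Rightarrow> real ^ 'n ^ 'n"
  assumes "closed S"
    and "polynomial_process T S p M F X"
    and "is_basis_on S (polys_on S k) e"
    and "\<And>a b. (a, b) \<in> time_triangle T \<Longrightarrow> P a b = representing_matrix S e (transition_op p a b)"
    and "\<And>u. 0 \<le> u \<Longrightarrow> u < T \<Longrightarrow> H u = representing_matrix S e (generator S p u)"
    and "0 \<le> s"
    and "integral {s..T} (\<lambda>u. spectral_norm (H u)) < pi"
  shows "\<forall>t\<in>{s..T}.
      summable (\<lambda>n. norm (magnus_coeff H s t (Suc n)))
    \<and> P s t = mat_exp (\<Sum>n. magnus_coeff H s t (Suc n))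
    \<and> (\<forall>H'. (\<forall>u\<in>{s..t}. H' u = H u) \<longrightarrow> (\<forall>n. magnus_coeff H' s t n = magnus_coeff H s t n))
    \<and> magnus_coeff H s t 1 = integral {s..t} H
    \<and> magnus_coeff H s t 2 = - (1 / 2) *\<^sub>R
        integral {s..t} (\<lambda>u. integral {s..u} (\<lambda>v. commutator (H u) (H v)))
    \<and> magnus_coeff H s t 3 = (1 / 6) *\<^sub>R
        integral {s..t} (\<lambda>u. integral {s..u} (\<lambda>v. integral {s..v} (\<lambda>w.
          commutator (H u) (commutator (H v) (H w)) + commutator (H w) (commutator (H v) (H u)))))"
proof
  fix t assume t: "t \<in> {s..T}"
  then have st: "s \<le> t" "t \<le> T" and sT: "s \<le> T" by auto
  interpret polynomial_process T S p M F X by fact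
  obtain G where G: "continuous_on {0..T} G" and HG: "\<And>u. 0 \<le> u \<Longrightarrow> u < T \<Longrightarrow> H u = G u"
    and P: "\<And>s. 0 \<le> s \<Longrightarrow> s \<le> T \<Longrightarrow> continuous_on {s..T} (P s)"
    and P_eq: "\<And>s t. 0 \<le> s \<Longrightarrow> s \<le> t \<Longrightarrow> t \<le> T \<Longrightarrow>
      P s t = mat 1 + integral {s..t} (\<lambda>u. P s u ** G u)"
    using transition_matrix_equation[OF polynomial assms(3-5)] by blast
  have HG': "H u = G u" if "s \<le> u" "u \<le> t" "u \<noteq> T" for u
    using HG[of u] that st \<open>0 \<le> s\<close> by simp
  have G_st: "continuous_on {s..t} G" and G_sT: "continuous_on {s..T} G"
    using \<open>0 \<le> s\<close> st by (auto intro: continuous_on_subset[OF G])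
  \<comment> \<open>The generator does not determine \<open>H T\<close>; the exceptional null set
    {T} allows \<open>G\<close> to replace \<open>H\<close> in every coefficient even when
    \<open>t = T\<close>.\<close>
  have coeff: "magnus_coeff H s t n = magnus_coeff G s t n" for n
    by (rule magnus_coeff_cong[OF st(1), of "{T}"]) (auto simp: HG')
  have spike: "integral {s..t} f = integral {s..t} g" if "\<And>u. u \<in> {s..t} - {T} \<Longrightarrow> f u = g u"
    for f g :: "real \<Rightarrow> real ^ 'n ^ 'n"
    by (rule integral_spike[of "{T}"]) (use that in auto)
  \<comment> \<open>The hypothesis bounds the integral up to T; nonnegativity of the norm gives the
    bound up to \<open>t\<close>.\<close>
  have "integral {s..t} (\<lambda>u. spectral_norm (G u)) \<le> integral {s..T} (\<lambda>u. spectral_norm (G u))"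
    using st by (intro integral_subset_le integrable_continuous_real continuous_on_spectral_norm G_st G_sT)
      (auto simp: spectral_norm_def onorm_pos_le[OF matrix_vector_mul_bounded_linear])
  also have "\<dots> = integral {s..T} (\<lambda>u. spectral_norm (H u))"
    by (rule integral_spike[of "{T}"]) (use HG \<open>0 \<le> s\<close> in auto)
  finally have pi: "integral {s..t} (\<lambda>u. spectral_norm (G u)) < pi"
    using assms(7) by simp
  note conv = magnus_coeff_convergence[OF st(1) G_st pi
      continuous_on_subset[OF P[OF \<open>0 \<le> s\<close> sT]] P_eq[OF \<open>0 \<le> s\<close>]]
  show "summable (\<lambda>n. norm (magnus_coeff H s t (Suc n)))
    \<and> P s t = mat_exp (\<Sum>n. magnus_coeff H s t (Suc n))
    \<and> (\<forall>H'. (\<forall>u\<in>{s..t}. H' u = H u) \<longrightarrow> (\<forall>n. magnus_coeff H' s t n = magnus_coeff H s t n))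
    \<and> magnus_coeff H s t 1 = integral {s..t} H
    \<and> magnus_coeff H s t 2 = - (1 / 2) *\<^sub>R
        integral {s..t} (\<lambda>u. integral {s..u} (\<lambda>v. commutator (H u) (H v)))
    \<and> magnus_coeff H s t 3 = (1 / 6) *\<^sub>R
        integral {s..t} (\<lambda>u. integral {s..u} (\<lambda>v. integral {s..v} (\<lambda>w.
          commutator (H u) (commutator (H v) (H w)) + commutator (H w) (commutator (H v) (H u)))))"
  proof (intro conjI allI impI)
    show "summable (\<lambda>n. norm (magnus_coeff H s t (Suc n)))"
      and "P s t = mat_exp (\<Sum>n. magnus_coeff H s t (Suc n))"
      unfolding coeff by (rule conv; use st in simp)+
    show "magnus_coeff H' s t n = magnus_coeff H s t n" if "\<forall>u\<in>{s..t}. H' u = H u" for H' n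
      by (rule magnus_coeff_cong[OF st(1), of "{}"]) (use that in auto)
    show "magnus_coeff H s t 1 = integral {s..t} H"
      by (rule magnus_coeff_1)
    have "integral {s..t} (\<lambda>u. integral {s..u} (\<lambda>v. commutator (G u) (G v)))
        = integral {s..t} (\<lambda>u. integral {s..u} (\<lambda>v. commutator (H u) (H v)))"
      by (rule spike, rule integral_cong) (use st HG' in auto)
    then show "magnus_coeff H s t 2 = - (1 / 2) *\<^sub>R
        integral {s..t} (\<lambda>u. integral {s..u} (\<lambda>v. commutator (H u) (H v)))"
      unfolding coeff magnus_coeff_2[OF G_st st(1)] by (rule arg_cong)
    have "integral {s..t} (\<lambda>u. integral {s..u} (\<lambda>v. integral {s..v} (\<lambda>w.
          commutator (G u) (commutator (G v) (G w)) + commutator (G w) (commutator (G v) (G u)))))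
        = integral {s..t} (\<lambda>u. integral {s..u} (\<lambda>v. integral {s..v} (\<lambda>w.
          commutator (H u) (commutator (H v) (H w)) + commutator (H w) (commutator (H v) (H u)))))"
      by (rule spike, rule integral_cong, rule integral_cong) (use st HG' in auto)
    then show "magnus_coeff H s t 3 = (1 / 6) *\<^sub>R
        integral {s..t} (\<lambda>u. integral {s..u} (\<lambda>v. integral {s..v} (\<lambda>w.
          commutator (H u) (commutator (H v) (H w)) + commutator (H w) (commutator (H v) (H u)))))"
      unfolding coeff magnus_coeff_3[OF G_st st(1)] by (rule arg_cong)
  qed
qed

end
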